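(* Consider a degraded 2DMBC specified by the degraded DMBCs $X_f\rightarrow(Y_f,Z_f)$ and $X_b\rightarrow(Y_b,Z_b)$, where $$X_f=[X_{f,O},X_{f,R}],\quad Y_f=[Y_{f,O},Y_{f,R}],\quad Z_f=[Z_{f,O},Z_{f,R}],$$ $$X_b=[X_{b,O},X_{b,R}],\quad Y_b=[Y_{b,O},Y_{b,R}],\quad Z_b=[Z_{b,O},Z_{b,R}]$$ are the representations by independent subchannels, the subchannels with index $O$ being obversely degraded and those with index $R$ being reversely degraded. Then the secret-key capacity of this 2DMBC equals $$C^{d-2DMBC}_{sk}=\max_{P_{X_{f,O},X_{b,O}}}\{\,I(X_{f,O};Y_{f,O}|Z_{f,O}),\ I(X_{b,O};Y_{b,O}|Z_{b,O})\,\},$$ i.e. the maximum, over the input distributions of $X_{f,O}$ and $X_{b,O}$, of the larger of the two conditional mutual informations.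
   Context: All alphabets are finite; logarithms are base 2; $H$ and $I$ denote Shannon entropy and (conditional) mutual information; $X\leftrightarrow Y\leftrightarrow Z$ means that $X,Y,Z$ form a Markov chain in this order (and similarly for longer chains). Channels. A discrete memoryless broadcast channel (DMBC) $X\rightarrow(Y,Z)$ is a memoryless channel with input $X$ and outputs $Y,Z$, specified by a conditional distribution $P_{Y,Z|X}$. A 2DMBC is a pair of independent DMBCs: a forward DMBC $X_f\rightarrow(Y_f,Z_f)$ (input by Alice, $Y_f$ received by Bob, $Z_f$ received by the passive adversary Eve), specified by $P_{Y_f,Z_f|X_f}$ over finite sets, and a backward DMBC $X_b\rightarrow(Y_b,Z_b)$ (input by Bob, $Y_b$ received by Alice, $Z_b$ received by Eve), specified by $P_{Y_b,Z_b|X_b}$ over finite sets. Degradedness. A DMBC $X\rightarrow(Y,Z)$ is obversely degraded if $X\leftrightarrow Y\leftrightarrow Z$ is a Markov chain, and reversely degraded if $X\leftrightarrow Z\leftrightarrow Y$ is a Markov chain. The DMBC has two independent subchannels $X_O\rightarrow(Y_O,Z_O)$ and $X_R\rightarrow(Y_R,Z_R)$ if its input and outputs can be represented as $X=[X_O,X_R]$, $Y=[Y_O,Y_R]$, $Z=[Z_O,Z_R]$ such that $(Y_O,Z_O)\leftrightarrow X_O\leftrightarrow X_R\leftrightarrow(Y_R,Z_R)$ is a Markov chain. The DMBC is degraded if it can be represented by two independent subchannels $X_O\rightarrow(Y_O,Z_O)$ and $X_R\rightarrow(Y_R,Z_R)$ such that the former is obversely degraded and the latter is reversely degraded, implying that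 $Z_O\leftrightarrow Y_O\leftrightarrow X_O\leftrightarrow X_R\leftrightarrow Z_R\leftrightarrow Y_R$ is a Markov chain (one of the subchannels may be absent, i.e. trivial). A 2DMBC is degraded if both of its one-way DMBCs are degraded. SKE protocol. A secret key establishment (SKE) protocol in the 2DMBC setup consists of an arbitrary finite number of consecutive communication rounds; either party may initiate. In each round either Alice sends a sequence of symbols over the forward DMBC or Bob sends a sequence of symbols over the backward DMBC; the legitimate receiver of the round then computes the sequence to be sent in the next round. A sent sequence is a (possibly randomized) function of all sequences previously sent or received by the sender, the local randomness being independent of the other parties' views. The view of a party at the end of the protocol is the collection of all sequences it sent and/or received: $View_A$ for Alice (forward inputs and backward outputs $Y_b$), $View_B$ for Bob (backward inputs and forward outputs $Y_f$), $View_E$ for Eve (all outputs $Z_f$ and $Z_b$). At the end, one of Alice and Bob computes a key $S$ as a function of his/her view, and the other computes an estimate $\hat S$ of it as a function of his/her view. Let $n_f$ and $n_b$ be the total numbers of uses of the forward and backward channels in the protocol. For $R_{sk}\ge 0$ and $0\le\delta\le1$, the protocol is $(R_{sk},\delta)$-secure if $$\frac{H(S)}{n_f+n_b}>R_{sk}-\delta,\qquad \Pr(\hat S\ne S)<\delta,\qquad \frac{H(S|View_E)}{H(S)}>1-\delta .$$ The last condition is regarded as satisfied if $H(S)=0$. The secret-key capacity of a 2DMBC is the largest $R_{sk}\ge0$ such that for any arbitrarily small $\delta>0$ there exists an $(R_{sk},\delta)$-secure SKE protocol; $C^{d-2DMBC}_{sk}$ denotes the secret-key capacity of the degraded 2DMBC.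 *)

theory Defs
  imports "HOL-Probability.Probability"
begin

section \<open>Information measures and Markov chains\<close>

text \<open>
  A random variable on a discrete space \<open>p\<close> is a function on the carrier type of \<open>p\<close>. The
  reference measures are counting measures on the whole value types. For finite channel alphabets
  all value types occurring below are countable and all distributions are finitely supported.
\<close>

abbreviation H_ent :: "'a pmf \<Rightarrow> ('a \<Rightarrow> 'b) \<Rightarrow> real" where
  "H_ent p X \<equiv> prob_space.entropy (measure_pmf p) 2 (count_space UNIV) X"

abbreviation H_cond :: "'a pmf \<Rightarrow> ('a \<Rightarrow> 'b) \<Rightarrow> ('a \<Rightarrow> 'c) \<Rightarrow> real" where
  "H_cond p X Y \<equiv>
    prob_space.conditional_entropy (measure_pmf p) 2 (count_space UNIV) (count_space UNIV) X Y"

abbreviation I_cond :: "'a pmf \<Rightarrow> ('a \<Rightarrow> 'b) \<Rightarrow> ('a \<Rightarrow> 'c) \<Rightarrow> ('a \<Rightarrow> 'd) \<Rightarrow> real" where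
  "I_cond p X Y Z \<equiv>
    prob_space.conditional_mutual_information (measure_pmf p) 2
      (count_space UNIV) (count_space UNIV) (count_space UNIV) X Y Z"

text \<open>Both sides of the equation are \<open>0\<close> when the conditioning event has probability \<open>0\<close>.\<close>

definition markov_chain :: "'a pmf \<Rightarrow> ('a \<Rightarrow> 'b) \<Rightarrow> ('a \<Rightarrow> 'c) \<Rightarrow> ('a \<Rightarrow> 'd) \<Rightarrow> bool" where
  "markov_chain p X Y Z \<longleftrightarrow>
    (\<forall>x y z. \<P>(w in measure_pmf p. X w = x \<and> Z w = z \<bar> Y w = y) =
       \<P>(w in measure_pmf p. X w = x \<bar> Y w = y) * \<P>(w in measure_pmf p. Z w = z \<bar> Y w = y))"

definition markov_chain4 ::
  "'a pmf \<Rightarrow> ('a \<Rightarrow> 'b) \<Rightarrow> ('a \<Rightarrow> 'c) \<Rightarrow> ('a \<Rightarrow> 'd) \<Rightarrow> ('a \<Rightarrow> 'e) \<Rightarrow> bool" where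
  "markov_chain4 p A B C D \<longleftrightarrow>
    markov_chain p A B (\<lambda>w. (C w, D w)) \<and> markov_chain p (\<lambda>w. (A w, B w)) C D"

section \<open>Broadcast channels\<close>

type_synonym ('x, 'y, 'z) dmbc = "'x \<Rightarrow> ('y \<times> 'z) pmf"

text \<open>The joint distribution of \<open>(X, Y, Z)\<close> for the input distribution \<open>P\<close>.\<close>

definition joint :: "'x pmf \<Rightarrow> ('x, 'y, 'z) dmbc \<Rightarrow> ('x \<times> 'y \<times> 'z) pmf" where
  "joint P W = bind_pmf P (\<lambda>x. map_pmf (Pair x) (W x))"

text \<open>
  Markov conditions on a channel are required for every input distribution; for a fixed one they
  would say nothing about inputs of probability \<open>0\<close>.
\<close>

definition obversely_degraded :: "('x, 'y, 'z) dmbc \<Rightarrow> bool" where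
  "obversely_degraded W \<longleftrightarrow>
    (\<forall>P. markov_chain (joint P W) (\<lambda>(x, y, z). x) (\<lambda>(x, y, z). y) (\<lambda>(x, y, z). z))"

definition reversely_degraded :: "('x, 'y, 'z) dmbc \<Rightarrow> bool" where
  "reversely_degraded W \<longleftrightarrow>
    (\<forall>P. markov_chain (joint P W) (\<lambda>(x, y, z). x) (\<lambda>(x, y, z). z) (\<lambda>(x, y, z). y))"

text \<open>
  \<open>W\<close> has the independent subchannels \<open>WO\<close> and \<open>WR\<close>: these are the conditional distributions of
  \<open>(Y\<^sub>O, Z\<^sub>O)\<close> given \<open>X\<^sub>O\<close> and of \<open>(Y\<^sub>R, Z\<^sub>R)\<close> given \<open>X\<^sub>R\<close>, and the Markov condition holds. A missing
  subchannel is one whose alphabets are all \<^typ>\<open>unit\<close>.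
\<close>

definition independent_subchannels ::
  "('xo \<times> 'xr, 'yo \<times> 'yr, 'zo \<times> 'zr) dmbc \<Rightarrow> ('xo, 'yo, 'zo) dmbc \<Rightarrow> ('xr, 'yr, 'zr) dmbc \<Rightarrow> bool" where
  "independent_subchannels W WO WR \<longleftrightarrow>
    (\<forall>xo xr. map_pmf (\<lambda>((yo, yr), (zo, zr)). (yo, zo)) (W (xo, xr)) = WO xo \<and>
             map_pmf (\<lambda>((yo, yr), (zo, zr)). (yr, zr)) (W (xo, xr)) = WR xr) \<and>
    (\<forall>P. markov_chain4 (joint P W)
           (\<lambda>((xo, xr), (yo, yr), (zo, zr)). (yo, zo))
           (\<lambda>((xo, xr), (yo, yr), (zo, zr)). xo)
           (\<lambda>((xo, xr), (yo, yr), (zo, zr)). xr)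
           (\<lambda>((xo, xr), (yo, yr), (zo, zr)). (yr, zr)))"

definition degraded_dmbc ::
  "('xo \<times> 'xr, 'yo \<times> 'yr, 'zo \<times> 'zr) dmbc \<Rightarrow> ('xo, 'yo, 'zo) dmbc \<Rightarrow> ('xr, 'yr, 'zr) dmbc \<Rightarrow> bool" where
  "degraded_dmbc W WO WR \<longleftrightarrow>
    independent_subchannels W WO WR \<and> obversely_degraded WO \<and> reversely_degraded WR"

text \<open>\<open>I(X; Y | Z)\<close> for the channel \<open>W\<close> with input distribution \<open>P\<close>.\<close>

definition channel_I_cond :: "'x pmf \<Rightarrow> ('x, 'y, 'z) dmbc \<Rightarrow> real" where
  "channel_I_cond P W =
    I_cond (joint P W) (\<lambda>(x, y, z). x) (\<lambda>(x, y, z). y) (\<lambda>(x, y, z). z)"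

primrec transmit :: "('x, 'y, 'z) dmbc \<Rightarrow> 'x list \<Rightarrow> ('y \<times> 'z) list pmf" where
  "transmit W [] = return_pmf []"
| "transmit W (x # xs) =
    bind_pmf (W x) (\<lambda>yz. bind_pmf (transmit W xs) (\<lambda>yzs. return_pmf (yz # yzs)))"

section \<open>Secret key establishment protocols\<close>

datatype party = Alice | Bob

fun other :: "party \<Rightarrow> party" where
  "other Alice = Bob"
| "other Bob = Alice"

text \<open>A round consists of the sequence sent and the sequence of outputs at the two receivers.\<close>

datatype ('xf, 'yf, 'zf, 'xb, 'yb, 'zb) round_record =
    Forward "'xf list" "('yf \<times> 'zf) list"
  | Backward "'xb list" "('yb \<times> 'zb) list"

text \<open>In every view, \<^const>\<open>Inl\<close> marks forward rounds and \<^const>\<open>Inr\<close> backward rounds.\<close>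

fun view_A :: "('xf, 'yf, 'zf, 'xb, 'yb, 'zb) round_record \<Rightarrow> 'xf list + 'yb list" where
  "view_A (Forward xs yzs) = Inl xs"
| "view_A (Backward xs yzs) = Inr (map fst yzs)"

fun view_B :: "('xf, 'yf, 'zf, 'xb, 'yb, 'zb) round_record \<Rightarrow> 'yf list + 'xb list" where
  "view_B (Forward xs yzs) = Inl (map fst yzs)"
| "view_B (Backward xs yzs) = Inr xs"

fun view_E :: "('xf, 'yf, 'zf, 'xb, 'yb, 'zb) round_record \<Rightarrow> 'zf list + 'zb list" where
  "view_E (Forward xs yzs) = Inl (map snd yzs)"
| "view_E (Backward xs yzs) = Inr (map snd yzs)"

abbreviation View_A :: "('xf, 'yf, 'zf, 'xb, 'yb, 'zb) round_record list \<Rightarrow> ('xf list + 'yb list) list" where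
  "View_A \<equiv> map view_A"

abbreviation View_B :: "('xf, 'yf, 'zf, 'xb, 'yb, 'zb) round_record list \<Rightarrow> ('yf list + 'xb list) list" where
  "View_B \<equiv> map view_B"

abbreviation View_E :: "('xf, 'yf, 'zf, 'xb, 'yb, 'zb) round_record list \<Rightarrow> ('zf list + 'zb list) list" where
  "View_E \<equiv> map view_E"

text \<open>
  The rounds alternate between the parties, and round \<open>i\<close> uses the sender's channel
  \<open>lens ! i\<close> times. An encoder maps the sender's current view to the distribution of the sequence
  sent next, so that the local randomness is drawn afresh and independently of the other parties'
  views; the length of the view tells the encoder which round it is in. Key values are coded as
  natural numbers. The party \<open>key_party\<close> computes the key and the other one the estimate.
\<close>

record ('xf, 'yf, 'xb, 'yb) ske_protocol =
  initiator :: party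
  lens :: "nat list"
  enc_A :: "('xf list + 'yb list) list \<Rightarrow> 'xf list pmf"
  enc_B :: "('yf list + 'xb list) list \<Rightarrow> 'xb list pmf"
  key_party :: party
  key_A :: "('xf list + 'yb list) list \<Rightarrow> nat"
  key_B :: "('yf list + 'xb list) list \<Rightarrow> nat"

definition sender :: "('xf, 'yf, 'xb, 'yb) ske_protocol \<Rightarrow> nat \<Rightarrow> party" where
  "sender \<pi> i = (if even i then initiator \<pi> else other (initiator \<pi>))"

definition valid_protocol :: "('xf, 'yf, 'xb, 'yb) ske_protocol \<Rightarrow> bool" where
  "valid_protocol \<pi> \<longleftrightarrow>
    (\<forall>v. length v < length (lens \<pi>) \<and> sender \<pi> (length v) = Alice \<longrightarrow>
       (\<forall>xs \<in> set_pmf (enc_A \<pi> v). length xs = lens \<pi> ! length v)) \<and>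
    (\<forall>v. length v < length (lens \<pi>) \<and> sender \<pi> (length v) = Bob \<longrightarrow>
       (\<forall>xs \<in> set_pmf (enc_B \<pi> v). length xs = lens \<pi> ! length v))"

definition channel_uses :: "('xf, 'yf, 'xb, 'yb) ske_protocol \<Rightarrow> party \<Rightarrow> nat" where
  "channel_uses \<pi> a = (\<Sum>i | i < length (lens \<pi>) \<and> sender \<pi> i = a. lens \<pi> ! i)"

abbreviation n_f :: "('xf, 'yf, 'xb, 'yb) ske_protocol \<Rightarrow> nat" where
  "n_f \<pi> \<equiv> channel_uses \<pi> Alice"

abbreviation n_b :: "('xf, 'yf, 'xb, 'yb) ske_protocol \<Rightarrow> nat" where
  "n_b \<pi> \<equiv> channel_uses \<pi> Bob"

primrec run_rounds ::
  "('xf, 'yf, 'zf) dmbc \<Rightarrow> ('xb, 'yb, 'zb) dmbc \<Rightarrow> ('xf, 'yf, 'xb, 'yb) ske_protocol \<Rightarrow> nat \<Rightarrow>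
   ('xf, 'yf, 'zf, 'xb, 'yb, 'zb) round_record list pmf" where
  "run_rounds Wf Wb \<pi> 0 = return_pmf []"
| "run_rounds Wf Wb \<pi> (Suc i) =
    bind_pmf (run_rounds Wf Wb \<pi> i) (\<lambda>t.
      case sender \<pi> i of
        Alice \<Rightarrow> bind_pmf (enc_A \<pi> (View_A t)) (\<lambda>xs.
                   bind_pmf (transmit Wf xs) (\<lambda>yzs. return_pmf (t @ [Forward xs yzs])))
      | Bob \<Rightarrow> bind_pmf (enc_B \<pi> (View_B t)) (\<lambda>xs.
                 bind_pmf (transmit Wb xs) (\<lambda>yzs. return_pmf (t @ [Backward xs yzs]))))"

definition run ::
  "('xf, 'yf, 'zf) dmbc \<Rightarrow> ('xb, 'yb, 'zb) dmbc \<Rightarrow> ('xf, 'yf, 'xb, 'yb) ske_protocol \<Rightarrow>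
   ('xf, 'yf, 'zf, 'xb, 'yb, 'zb) round_record list pmf" where
  "run Wf Wb \<pi> = run_rounds Wf Wb \<pi> (length (lens \<pi>))"

definition party_key ::
  "('xf, 'yf, 'xb, 'yb) ske_protocol \<Rightarrow> party \<Rightarrow>
   ('xf, 'yf, 'zf, 'xb, 'yb, 'zb) round_record list \<Rightarrow> nat" where
  "party_key \<pi> a t = (case a of Alice \<Rightarrow> key_A \<pi> (View_A t) | Bob \<Rightarrow> key_B \<pi> (View_B t))"

definition key ::
  "('xf, 'yf, 'xb, 'yb) ske_protocol \<Rightarrow> ('xf, 'yf, 'zf, 'xb, 'yb, 'zb) round_record list \<Rightarrow> nat" where
  "key \<pi> = party_key \<pi> (key_party \<pi>)"

definition key_estimate ::
  "('xf, 'yf, 'xb, 'yb) ske_protocol \<Rightarrow> ('xf, 'yf, 'zf, 'xb, 'yb, 'zb) round_record list \<Rightarrow> nat" where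
  "key_estimate \<pi> = party_key \<pi> (other (key_party \<pi>))"

text \<open>
  The clause \<open>0 < n_f \<pi> + n_b \<pi>\<close> only keeps the quotient in the rate condition meaningful, as HOL
  puts \<open>x / 0 = 0\<close>: a protocol without any channel use has a constant key.
\<close>

definition secure_protocol ::
  "('xf, 'yf, 'zf) dmbc \<Rightarrow> ('xb, 'yb, 'zb) dmbc \<Rightarrow> real \<Rightarrow> real \<Rightarrow>
   ('xf, 'yf, 'xb, 'yb) ske_protocol \<Rightarrow> bool" where
  "secure_protocol Wf Wb R \<delta> \<pi> \<longleftrightarrow>
    (let T = run Wf Wb \<pi> in
      valid_protocol \<pi> \<and> 0 < n_f \<pi> + n_b \<pi> \<and>
      H_ent T (key \<pi>) / real (n_f \<pi> + n_b \<pi>) > R - \<delta> \<and>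
      \<P>(t in measure_pmf T. key_estimate \<pi> t \<noteq> key \<pi> t) < \<delta> \<and>
      (H_ent T (key \<pi>) = 0 \<or> H_cond T (key \<pi>) View_E / H_ent T (key \<pi>) > 1 - \<delta>))"

definition achievable_rate ::
  "('xf, 'yf, 'zf) dmbc \<Rightarrow> ('xb, 'yb, 'zb) dmbc \<Rightarrow> real \<Rightarrow> bool" where
  "achievable_rate Wf Wb R \<longleftrightarrow>
    R \<ge> 0 \<and> (\<forall>\<delta>. 0 < \<delta> \<and> \<delta> \<le> 1 \<longrightarrow> (\<exists>\<pi>. secure_protocol Wf Wb R \<delta> \<pi>))"

definition is_maximum :: "real set \<Rightarrow> real \<Rightarrow> bool" where
  "is_maximum A m \<longleftrightarrow> m \<in> A \<and> (\<forall>a \<in> A. a \<le> m)"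

text \<open>
  The capacity is a relation, so that the existence of a largest achievable rate is part of
  any assertion about its value.
\<close>

definition is_secret_key_capacity ::
  "('xf, 'yf, 'zf) dmbc \<Rightarrow> ('xb, 'yb, 'zb) dmbc \<Rightarrow> real \<Rightarrow> bool" where
  "is_secret_key_capacity Wf Wb C \<longleftrightarrow> is_maximum {R. achievable_rate Wf Wb R} C"

end

theory Submission
  imports Defs "HOL-Real_Asymp.Real_Asymp"
begin

text \<open>
  Converse: \<open>I(View\<^sub>A; View\<^sub>B | View\<^sub>E)\<close> bounds the key entropy up to Fano and leakage terms, and in
  each round it grows by at most the sum of \<open>I(X; Y | Z)\<close> over the channel uses. For a degraded
  channel that information is at most \<open>I(X\<^sub>O; Y\<^sub>O | Z\<^sub>O)\<close>, because the reversely degraded subchannel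
  contributes nothing.

  Achievability: a single round suffices. The party owning the better obversely degraded
  subchannel sends a random wiretap codeword \<open>c (s, u)\<close>. The rate of the pairs \<open>(s, u)\<close> is just below
  \<open>I(X; Y)\<close>, so that a threshold decoder finds \<open>(s, u)\<close>, and that of \<open>u\<close> is just above \<open>I(X; Z)\<close>, so that
  for every \<open>s\<close> the subcode nearly simulates Eve's output distribution (soft covering). The
  difference is \<open>I(X; Y | Z)\<close> by degradedness. As the key must be a function of the codeword,
  which need not determine \<open>s\<close>, it is read off an arbitrary right inverse of \<open>c\<close>.
\<close>

section \<open>Entropy of finitely supported distributions\<close>

text \<open>Secrecy is demanded only relative to \<open>H(S)\<close>, so a total leakage of order
  sqrt n is affordable. Second moments of the information density therefore suffice: Chebyshev's
  inequality handles decoding, and the mean square bounds the divergence in soft covering. In the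
  converse, the randomness that a sender adds in a round enters H(A, E) and H(A, B, E) with the same
  summand and cancels; this is why interaction and feedback gain nothing beyond the channel's own
  I(X; Y | Z). Keys are arbitrary natural numbers, so the alphabet size in Fano's inequality has to
  come from counting transcripts, whose number is exponential in the channel uses. The length of a
  secure protocol is unknown, so it is divided out and only \<delta> tends to 0; in the direct part
  \<delta> is fixed and the block length grows. Reading the key off a right inverse is harmless
  because a code with small decoding error has few colliding codewords. All estimates are made for
  entropies of finitely supported distributions; the library's measure-theoretic notions are
  translated into these once.\<close>

abbreviation E_pmf :: "'a pmf \<Rightarrow> ('a \<Rightarrow> real) \<Rightarrow> real" where
  "E_pmf p f \<equiv> measure_pmf.expectation p f"

lemma E_pmf_eq_sum: "finite (set_pmf p) \<Longrightarrow> E_pmf p f = (\<Sum>x\<in>set_pmf p. pmf p x * f x)"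
  by (subst integral_measure_pmf[of "set_pmf p"]) (auto simp: mult.commute)

lemma E_pmf_mono:
  "finite (set_pmf p) \<Longrightarrow> (\<And>x. x \<in> set_pmf p \<Longrightarrow> f x \<le> g x) \<Longrightarrow> E_pmf p f \<le> E_pmf p g"
  by (auto simp: E_pmf_eq_sum intro!: sum_mono mult_left_mono)

lemma E_pmf_cong:
  "(\<And>x. x \<in> set_pmf p \<Longrightarrow> f x = g x) \<Longrightarrow> E_pmf p f = E_pmf p g"
  by (intro integral_cong_AE) (auto simp: AE_measure_pmf_iff)

lemma E_pmf_add: "finite (set_pmf p) \<Longrightarrow> E_pmf p (\<lambda>x. f x + g x) = E_pmf p f + E_pmf p g"
  by (simp add: integrable_measure_pmf_finite)

lemma E_pmf_diff: "finite (set_pmf p) \<Longrightarrow> E_pmf p (\<lambda>x. f x - g x) = E_pmf p f - E_pmf p g"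
  by (simp add: integrable_measure_pmf_finite)

lemma E_pmf_sum:
  "finite (set_pmf p) \<Longrightarrow> E_pmf p (\<lambda>x. \<Sum>i\<in>I. f i x) = (\<Sum>i\<in>I. E_pmf p (f i))"
  by (simp add: integrable_measure_pmf_finite)

lemma E_pmf_swap:
  assumes "finite (set_pmf p)" "finite (set_pmf q)"
  shows "E_pmf p (\<lambda>x. E_pmf q (f x)) = E_pmf q (\<lambda>y. E_pmf p (\<lambda>x. f x y))"
  using assms by (simp add: E_pmf_eq_sum sum_distrib_left mult.left_commute, subst sum.swap, simp)

lemma E_pmf_bind:
  assumes "finite (set_pmf p)" "\<And>x. x \<in> set_pmf p \<Longrightarrow> finite (set_pmf (K x))"
  shows "E_pmf (bind_pmf p K) f = E_pmf p (\<lambda>x. E_pmf (K x) f)"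
proof -
  let ?A = "\<Union>x\<in>set_pmf p. set_pmf (K x)"
  have fin: "finite ?A" using assms by auto
  have "E_pmf (bind_pmf p K) f = (\<Sum>a\<in>?A. pmf (bind_pmf p K) a * f a)"
    using fin by (subst integral_measure_pmf[of ?A]) auto
  also have "\<dots> = (\<Sum>a\<in>?A. \<Sum>x\<in>set_pmf p. pmf p x * pmf (K x) a * f a)"
    using assms by (simp add: pmf_bind E_pmf_eq_sum sum_distrib_right)
  also have "\<dots> = (\<Sum>x\<in>set_pmf p. \<Sum>a\<in>?A. pmf p x * pmf (K x) a * f a)"
    by (rule sum.swap)
  also have "\<dots> = (\<Sum>x\<in>set_pmf p. pmf p x * E_pmf (K x) f)"
  proof (rule sum.cong[OF refl])
    fix x assume x: "x \<in> set_pmf p"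
    have "E_pmf (K x) f = (\<Sum>a\<in>?A. pmf (K x) a * f a)"
      using fin x by (subst integral_measure_pmf[of ?A]) auto
    thus "(\<Sum>a\<in>?A. pmf p x * pmf (K x) a * f a) = pmf p x * E_pmf (K x) f"
      by (simp add: sum_distrib_left mult.assoc)
  qed
  finally show ?thesis using assms by (simp add: E_pmf_eq_sum)
qed

lemma E_pmf_pair:
  assumes "finite (set_pmf p)" "finite (set_pmf q)"
  shows "E_pmf (pair_pmf p q) f = E_pmf p (\<lambda>x. E_pmf q (\<lambda>y. f (x, y)))"
  using assms by (simp add: pair_pmf_def E_pmf_bind)

lemma prob_eq_E_pmf: "measure_pmf.prob p A = E_pmf p (indicator A)"
  by simp

section \<open>Shannon entropy, Gibbs' inequality and its consequences\<close>

definition ent :: "'a pmf \<Rightarrow> real" where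
  "ent p = E_pmf p (\<lambda>x. - log 2 (pmf p x))"

abbreviation H :: "'a pmf \<Rightarrow> ('a \<Rightarrow> 'b) \<Rightarrow> real" where
  "H p X \<equiv> ent (map_pmf X p)"

lemma pmf_map_fiber: "pmf (map_pmf X p) (X w) = measure_pmf.prob p {w'. X w' = X w}"
  by (simp add: pmf_map vimage_def)

lemma pmf_map_pos: "w \<in> set_pmf p \<Longrightarrow> 0 < pmf (map_pmf X p) (X w)"
  by (simp add: pmf_positive)

lemma H_eq_E_pmf: "H p X = E_pmf p (\<lambda>w. - log 2 (pmf (map_pmf X p) (X w)))"
  by (simp add: ent_def)

text \<open>If \<open>Y\<close> determines \<open>X\<close> on the support, almost all of each fibre
  of \<open>Y\<close> lies inside a fibre of \<open>X\<close>, so already the integrands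
  \<open>- log 2\<close> compare pointwise.\<close>

lemma H_mono:
  assumes "finite (set_pmf p)"
    and "\<And>w w'. w \<in> set_pmf p \<Longrightarrow> w' \<in> set_pmf p \<Longrightarrow> Y w = Y w' \<Longrightarrow> X w = X w'"
  shows "H p X \<le> H p Y"
  unfolding H_eq_E_pmf
proof (rule E_pmf_mono[OF assms(1)])
  fix w assume w: "w \<in> set_pmf p"
  have "pmf (map_pmf Y p) (Y w) \<le> pmf (map_pmf X p) (X w)"
    unfolding pmf_map_fiber
  proof (rule measure_pmf.finite_measure_mono_AE)
    show "AE w' in measure_pmf p. w' \<in> {w'. Y w' = Y w} \<longrightarrow> w' \<in> {w'. X w' = X w}"
      unfolding AE_measure_pmf_iff using assms(2)[OF _ w] by blast
  qed simp
  thus "- log 2 (pmf (map_pmf X p) (X w)) \<le> - log 2 (pmf (map_pmf Y p) (Y w))"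
    using w by (simp add: pmf_map_pos)
qed

lemma H_cong:
  assumes "finite (set_pmf p)"
    and "\<And>w w'. w \<in> set_pmf p \<Longrightarrow> w' \<in> set_pmf p \<Longrightarrow> X w = X w' \<longleftrightarrow> Y w = Y w'"
  shows "H p X = H p Y"
proof (rule antisym)
  show "H p X \<le> H p Y" using assms(2) by (intro H_mono[OF assms(1)]) blast
  show "H p Y \<le> H p X" using assms(2) by (intro H_mono[OF assms(1)]) blast
qed

lemma log2_le: "0 < x \<Longrightarrow> log 2 x \<le> (x - 1) / ln 2"
  using ln_le_minus_one[of x] by (simp add: log_def divide_right_mono)

text \<open>The bound log t \<le> (t - 1) / ln 2 at t = q / p. The guess \<open>q\<close> need only
  be positive with total weight at most 1 on the support, so products and quotients of marginals can
  serve as guesses without being normalised.\<close>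

lemma gibbs:
  assumes fin: "finite (set_pmf p)"
    and q: "\<And>x. x \<in> set_pmf p \<Longrightarrow> 0 < q x" "(\<Sum>x\<in>set_pmf p. q x) \<le> 1"
  shows "ent p \<le> E_pmf p (\<lambda>x. - log 2 (q x))"
proof -
  have "ent p - E_pmf p (\<lambda>x. - log 2 (q x)) = E_pmf p (\<lambda>x. log 2 (q x) - log 2 (pmf p x))"
    unfolding ent_def using fin by (simp add: E_pmf_diff)
  also have "\<dots> \<le> E_pmf p (\<lambda>x. (q x / pmf p x - 1) / ln 2)"
  proof (rule E_pmf_mono[OF fin])
    fix x assume x: "x \<in> set_pmf p"
    hence pos: "0 < pmf p x" by (simp add: pmf_positive)
    show "log 2 (q x) - log 2 (pmf p x) \<le> (q x / pmf p x - 1) / ln 2"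
      using log2_le[of "q x / pmf p x"] pos q(1)[OF x] by (simp add: log_divide_pos)
  qed
  also have "\<dots> = ((\<Sum>x\<in>set_pmf p. q x) - 1) / ln 2"
  proof -
    have "E_pmf p (\<lambda>x. (q x / pmf p x - 1) / ln 2) = (E_pmf p (\<lambda>x. q x / pmf p x) - 1) / ln 2"
      using fin by (simp add: E_pmf_diff)
    also have "E_pmf p (\<lambda>x. q x / pmf p x) = (\<Sum>x\<in>set_pmf p. q x)"
      using fin by (auto simp: E_pmf_eq_sum set_pmf_iff intro!: sum.cong)
    finally show ?thesis .
  qed
  also have "\<dots> \<le> 0" using q(2) by (simp add: divide_nonpos_pos)
  finally show ?thesis by simp
qed

lemma gibbs_pmf:
  assumes "finite (set_pmf p)" "set_pmf p \<subseteq> set_pmf q"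
  shows "ent p \<le> E_pmf p (\<lambda>x. - log 2 (pmf q x))"
proof (rule gibbs[OF assms(1)])
  show "0 < pmf q x" if "x \<in> set_pmf p" for x using assms that by (auto simp: pmf_positive)
  show "(\<Sum>x\<in>set_pmf p. pmf q x) \<le> 1"
    using assms(1) by (metis measure_measure_pmf_finite measure_pmf.prob_le_1)
qed

lemma ent_le_log_card:
  assumes "finite A" "set_pmf p \<subseteq> A"
  shows "ent p \<le> log 2 (card A)"
proof -
  have fin: "finite (set_pmf p)" using assms finite_subset by auto
  have c: "0 < card A" using assms set_pmf_not_empty[of p] by (auto simp: card_gt_0_iff)
  have "ent p \<le> E_pmf p (\<lambda>x. - log 2 (1 / card A))"
    using assms c card_mono[OF assms] by (intro gibbs[OF fin]) (auto simp: field_simps)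
  thus ?thesis using c by (simp add: log_divide_pos)
qed

lemma ent_nonneg: "0 \<le> ent p"
  unfolding ent_def
  by (intro integral_nonneg_AE) (auto simp: AE_measure_pmf_iff pmf_positive pmf_le_1)

lemma sum_pmf_map_pair:
  assumes "finite (set_pmf p)" "finite A" "X ` set_pmf p \<subseteq> A"
  shows "(\<Sum>x\<in>A. pmf (map_pmf (\<lambda>w. (X w, Z w)) p) (x, z)) = pmf (map_pmf Z p) z"
proof -
  have "(\<Sum>x\<in>A. pmf (map_pmf (\<lambda>w. (X w, Z w)) p) (x, z))
      = (\<Sum>x\<in>A. E_pmf p (\<lambda>w. indicator {w. X w = x \<and> Z w = z} w))"
    by (simp add: pmf_map vimage_def)
  also have "\<dots> = E_pmf p (\<lambda>w. \<Sum>x\<in>A. indicator {w. X w = x \<and> Z w = z} w)"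
    using assms by (simp add: integrable_measure_pmf_finite)
  also have "\<dots> = E_pmf p (\<lambda>w. indicator {w. Z w = z} w)"
  proof (rule E_pmf_cong)
    fix w assume "w \<in> set_pmf p"
    hence "X w \<in> A" using assms by auto
    have "(\<Sum>x\<in>A. indicator {w. X w = x \<and> Z w = z} w) = (\<Sum>x\<in>A. if x = X w then indicator {w. Z w = z} w else (0::real))"
      by (intro sum.cong) (auto simp: indicator_def)
    thus "(\<Sum>x\<in>A. indicator {w. X w = x \<and> Z w = z} w) = (indicator {w. Z w = z} w :: real)"
      using assms(2) \<open>X w \<in> A\<close> by simp
  qed
  finally show ?thesis by (simp add: pmf_map vimage_def)
qed

text \<open>The difference of the two sides is I(X; Y | Z). Gibbs' inequality is applied to the
  guess p(x, z) p(y, z) / p(z), under which \<open>X\<close> and \<open>Y\<close> are conditionally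
  independent given \<open>Z\<close>.\<close>

lemma H_submodular:
  assumes fin: "finite (set_pmf p)"
  shows "H p (\<lambda>w. (X w, Y w, Z w)) + H p Z \<le> H p (\<lambda>w. (X w, Z w)) + H p (\<lambda>w. (Y w, Z w))"
proof -
  define px where "px = pmf (map_pmf (\<lambda>w. (X w, Z w)) p)"
  define py where "py = pmf (map_pmf (\<lambda>w. (Y w, Z w)) p)"
  define pz where "pz = pmf (map_pmf Z p)"
  let ?q = "\<lambda>(x, y, z). px (x, z) * py (y, z) / pz z"
  let ?T = "\<lambda>w. (X w, Y w, Z w)"
  have pos: "0 < px (X w, Z w)" "0 < py (Y w, Z w)" "0 < pz (Z w)" if "w \<in> set_pmf p" for w
    unfolding px_def py_def pz_def
    using pmf_map_pos[OF that, of "\<lambda>w. (X w, Z w)"] pmf_map_pos[OF that, of "\<lambda>w. (Y w, Z w)"]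
      pmf_map_pos[OF that, of Z] by auto
  have "H p ?T \<le> E_pmf (map_pmf ?T p) (\<lambda>x. - log 2 (?q x))"
  proof (rule gibbs)
    show "finite (set_pmf (map_pmf ?T p))" using fin by simp
    show "0 < ?q t" if "t \<in> set_pmf (map_pmf ?T p)" for t
      using that pos by auto
    let ?A = "X ` set_pmf p" and ?B = "Y ` set_pmf p" and ?C = "Z ` set_pmf p"
    \<comment> \<open>Passing from the support to the product of the three ranges adds nonnegative
      terms and makes the sum factor for each fixed \<open>z\<close>.\<close>
    have "(\<Sum>t\<in>set_pmf (map_pmf ?T p). ?q t) \<le> (\<Sum>t\<in>?A \<times> ?B \<times> ?C. ?q t)"
      using fin by (intro sum_mono2) (auto simp: px_def py_def pz_def)
    also have "\<dots> = (\<Sum>x\<in>?A. \<Sum>y\<in>?B. \<Sum>z\<in>?C. px (x, z) * py (y, z) / pz z)"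
      by (simp add: sum.cartesian_product)
    also have "\<dots> = (\<Sum>z\<in>?C. (\<Sum>x\<in>?A. px (x, z)) * (\<Sum>y\<in>?B. py (y, z)) / pz z)"
    proof -
      have "(\<Sum>x\<in>?A. \<Sum>y\<in>?B. \<Sum>z\<in>?C. px (x, z) * py (y, z) / pz z)
          = (\<Sum>x\<in>?A. \<Sum>z\<in>?C. \<Sum>y\<in>?B. px (x, z) * py (y, z) / pz z)"
        by (rule sum.cong[OF refl], rule sum.swap)
      also have "\<dots> = (\<Sum>z\<in>?C. \<Sum>x\<in>?A. \<Sum>y\<in>?B. px (x, z) * py (y, z) / pz z)"
        by (rule sum.swap)
      finally show ?thesis by (simp only: sum_product sum_divide_distrib)
    qed
    also have "\<dots> = (\<Sum>z\<in>?C. pz z)"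
    proof (rule sum.cong[OF refl])
      fix z assume "z \<in> ?C"
      hence "0 < pz z" using pos by auto
      moreover have "(\<Sum>x\<in>?A. px (x, z)) = pz z" "(\<Sum>y\<in>?B. py (y, z)) = pz z"
        unfolding px_def py_def pz_def using fin by (auto intro!: sum_pmf_map_pair)
      ultimately show "(\<Sum>x\<in>?A. px (x, z)) * (\<Sum>y\<in>?B. py (y, z)) / pz z = pz z" by simp
    qed
    also have "\<dots> \<le> 1"
      unfolding pz_def using fin
      by (metis finite_imageI measure_measure_pmf_finite measure_pmf.prob_le_1)
    finally show "(\<Sum>t\<in>set_pmf (map_pmf ?T p). ?q t) \<le> 1" .
  qed
  also have "\<dots> = E_pmf p (\<lambda>w. - log 2 (px (X w, Z w)) + - log 2 (py (Y w, Z w)) - - log 2 (pz (Z w)))"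
    unfolding integral_map_pmf
  proof (rule E_pmf_cong)
    fix w assume "w \<in> set_pmf p"
    from pos[OF this] show "- log 2 (?q (?T w)) =
        - log 2 (px (X w, Z w)) + - log 2 (py (Y w, Z w)) - - log 2 (pz (Z w))"
      by (simp add: log_mult_pos log_divide_pos)
  qed
  also have "\<dots> = H p (\<lambda>w. (X w, Z w)) + H p (\<lambda>w. (Y w, Z w)) - H p Z"
    unfolding H_eq_E_pmf px_def py_def pz_def using fin by (simp add: E_pmf_diff E_pmf_add integrable_measure_pmf_finite)
  finally show ?thesis by simp
qed

text \<open>The chain rule H(X, Y) = H(X) + H(Y | X). Because \<open>x\<close> stays in the outcome,
  the joint probability is one product instead of a sum over inputs, and its logarithm
  splits.\<close>

lemma ent_bind_Pair:
  assumes "finite (set_pmf p)" "\<And>x. x \<in> set_pmf p \<Longrightarrow> finite (set_pmf (K x))"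
  shows "ent (bind_pmf p (\<lambda>x. map_pmf (Pair x) (K x))) = ent p + E_pmf p (\<lambda>x. ent (K x))"
proof -
  let ?J = "bind_pmf p (\<lambda>x. map_pmf (Pair x) (K x))"
  have J: "pmf ?J (x, y) = pmf p x * pmf (K x) y" for x y
  proof -
    have "pmf ?J (x, y) = E_pmf p (\<lambda>x'. if x' = x then pmf (K x) y else 0)"
      unfolding pmf_bind
      by (rule E_pmf_cong) (auto simp: pmf_map_inj' inj_def pmf_eq_0_set_pmf)
    also have "\<dots> = pmf p x * pmf (K x) y"
      by (subst integral_measure_pmf[of "{x}"]) (auto split: if_splits)
    finally show ?thesis .
  qed
  have "ent ?J = E_pmf p (\<lambda>x. E_pmf (K x) (\<lambda>y. - log 2 (pmf p x) + - log 2 (pmf (K x) y)))"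
  proof -
    have "ent ?J = E_pmf p (\<lambda>x. E_pmf (map_pmf (Pair x) (K x)) (\<lambda>z. - log 2 (pmf ?J z)))"
      unfolding ent_def[of ?J] using assms by (subst E_pmf_bind) auto
    also have "\<dots> = E_pmf p (\<lambda>x. E_pmf (K x) (\<lambda>y. - log 2 (pmf p x) + - log 2 (pmf (K x) y)))"
      unfolding integral_map_pmf J
      by (intro E_pmf_cong) (simp add: log_mult_pos pmf_positive)
    finally show ?thesis .
  qed
  also have "\<dots> = E_pmf p (\<lambda>x. - log 2 (pmf p x) + ent (K x))"
    unfolding ent_def using assms(2) by (intro E_pmf_cong) (simp add: integrable_measure_pmf_finite)
  finally show ?thesis unfolding ent_def[of p] using assms(1) by (simp add: E_pmf_add integrable_measure_pmf_finite)
qed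

lemma ent_pair:
  assumes "finite (set_pmf p)" "finite (set_pmf q)"
  shows "ent (pair_pmf p q) = ent p + ent q"
proof -
  have "pair_pmf p q = bind_pmf p (\<lambda>x. map_pmf (Pair x) q)"
    by (simp add: pair_pmf_def map_pmf_def)
  thus ?thesis using ent_bind_Pair[of p "\<lambda>_. q"] assms by simp
qed

lemma ent_map_inj: "finite (set_pmf p) \<Longrightarrow> inj_on f (set_pmf p) \<Longrightarrow> ent (map_pmf f p) = ent p"
  using H_cong[of p f "\<lambda>x. x"] by (auto simp: inj_on_def)

text \<open>Gibbs' inequality against the guess that gives weight \<open>1 - e\<close> to the estimate and
  spreads \<open>e\<close> over the \<open>N\<close> possible values.\<close>

lemma fano:
  fixes S T :: "'a \<Rightarrow> 'b"
  assumes fin: "finite (set_pmf p)" and e: "0 < e" "e < 1"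
    and N: "card (S ` set_pmf p) \<le> N"
  shows "H p (\<lambda>w. (S w, T w)) - H p T
    \<le> - log 2 (1 - e) + measure_pmf.prob p {w. T w \<noteq> S w} * (log 2 N - log 2 e)"
proof -
  define pt where "pt = pmf (map_pmf T p)"
  have Npos: "0 < N" using N fin set_pmf_not_empty[of p] by (metis card_gt_0_iff finite_imageI image_is_empty less_le_trans)
  let ?k = "\<lambda>s t. if s = t then 1 - e else e / N"
  let ?T = "\<lambda>w. (S w, T w)"
  let ?q = "\<lambda>(s, t). pt t * ?k s t"
  have pos: "0 < pt (T w)" if "w \<in> set_pmf p" for w
    unfolding pt_def using pmf_map_pos[OF that] .
  have kpos: "0 < ?k s t" for s t :: 'b using e Npos by auto
  have "H p ?T \<le> E_pmf (map_pmf ?T p) (\<lambda>x. - log 2 (?q x))"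
  proof (rule gibbs)
    show "finite (set_pmf (map_pmf ?T p))" using fin by simp
    show "0 < ?q t" if t: "t \<in> set_pmf (map_pmf ?T p)" for t
    proof -
      obtain w where "w \<in> set_pmf p" "t = (S w, T w)" using t by auto
      thus ?thesis using mult_pos_pos[OF pos kpos, of w "S w" "T w"] by simp
    qed
    let ?A = "S ` set_pmf p" and ?B = "T ` set_pmf p"
    have "(\<Sum>t\<in>set_pmf (map_pmf ?T p). ?q t) \<le> (\<Sum>t\<in>?A \<times> ?B. ?q t)"
      using fin e Npos by (intro sum_mono2) (auto simp: pt_def)
    also have "\<dots> = (\<Sum>s\<in>?A. \<Sum>t\<in>?B. pt t * ?k s t)"
      by (simp only: sum.cartesian_product)
    also have "\<dots> = (\<Sum>t\<in>?B. pt t * (\<Sum>s\<in>?A. ?k s t))"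
      by (subst sum.swap) (simp only: sum_distrib_left)
    also have "\<dots> \<le> (\<Sum>t\<in>?B. pt t * 1)"
    proof (intro sum_mono mult_left_mono)
      fix t
      have "(\<Sum>s\<in>?A. ?k s t) \<le> (\<Sum>s\<in>?A. (if s = t then 1 - e else 0) + e / N)"
        using e by (intro sum_mono) auto
      also have "\<dots> \<le> (1 - e) + card ?A * (e / N)"
        using fin e by (simp add: sum.distrib)
      also have "\<dots> \<le> (1 - e) + N * (e / N)"
        using N e by (intro add_left_mono mult_right_mono) auto
      finally show "(\<Sum>s\<in>?A. ?k s t) \<le> 1" using Npos by simp
    qed (simp add: pt_def)
    also have "\<dots> \<le> 1"
      unfolding pt_def using fin
      by (metis (no_types, lifting) finite_imageI measure_measure_pmf_finite measure_pmf.prob_le_1 mult.right_neutral sum.cong)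
    finally show "(\<Sum>t\<in>set_pmf (map_pmf ?T p). ?q t) \<le> 1" .
  qed
  also have "\<dots> \<le> E_pmf p (\<lambda>w. - log 2 (pt (T w)) +
      (- log 2 (1 - e) + indicator {w. T w \<noteq> S w} w * (log 2 N - log 2 e)))"
    unfolding integral_map_pmf
  proof (rule E_pmf_mono[OF fin])
    fix w assume w: "w \<in> set_pmf p"
    show "- log 2 (case (S w, T w) of (s, t) \<Rightarrow> pt t * ?k s t) \<le> - log 2 (pt (T w)) +
      (- log 2 (1 - e) + indicator {w. T w \<noteq> S w} w * (log 2 N - log 2 e))"
      using pos[OF w] e Npos by (auto simp: log_mult_pos log_divide_pos)
  qed
  also have "\<dots> = H p T + (- log 2 (1 - e) + measure_pmf.prob p {w. T w \<noteq> S w} * (log 2 N - log 2 e))"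
    unfolding H_eq_E_pmf pt_def prob_eq_E_pmf using fin by (simp add: E_pmf_add E_pmf_diff integrable_measure_pmf_finite)
  finally show ?thesis by simp
qed

section \<open>Agreement with the measure-theoretic entropy and information\<close>

lemma integral_count_space_pmf:
  "(\<integral>x. pmf p x * f x \<partial>count_space UNIV) = E_pmf p f"
  by (simp add: measure_pmf_eq_density integral_density)

lemma sigma_finite_count_space_countable:
  "sigma_finite_measure (count_space (UNIV :: 'a::countable set))"
  by (intro sigma_finite_measure_count_space_countable) simp

lemma count_space_pair_countable:
  "count_space (UNIV :: 'a::countable set) \<Otimes>\<^sub>M count_space (UNIV :: 'b::countable set) = count_space UNIV"
  by (subst pair_measure_countable) auto

text \<open>Countability makes the product sigma-algebra discrete, so that equality can be tested on
  singletons.\<close>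

lemma measure_pmf_pair:
  fixes p :: "'a::countable pmf" and q :: "'b::countable pmf"
  shows "measure_pmf p \<Otimes>\<^sub>M measure_pmf q = measure_pmf (pair_pmf p q)"
proof (rule measure_eqI_countable[where A = UNIV])
  have "sets (measure_pmf p \<Otimes>\<^sub>M measure_pmf q) = sets (count_space UNIV \<Otimes>\<^sub>M count_space UNIV)"
    by (intro sets_pair_measure_cong) auto
  thus "sets (measure_pmf p \<Otimes>\<^sub>M measure_pmf q) = Pow UNIV"
    unfolding count_space_pair_countable by simp
  fix a :: "'a \<times> 'b"
  obtain x y where a: "a = (x, y)" by (cases a)
  have "emeasure (measure_pmf p \<Otimes>\<^sub>M measure_pmf q) ({x} \<times> {y})
      = emeasure (measure_pmf p) {x} * emeasure (measure_pmf q) {y}"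
    by (rule measure_pmf.emeasure_pair_measure_Times) auto
  thus "emeasure (measure_pmf p \<Otimes>\<^sub>M measure_pmf q) {a} = emeasure (measure_pmf (pair_pmf p q)) {a}"
    by (simp add: a emeasure_pmf_single pmf_pair ennreal_mult)
qed auto

lemma distributed_map_pmf:
  "distributed (measure_pmf p) (count_space UNIV) X (\<lambda>x. ennreal (pmf (map_pmf X p) x))"
  by (simp add: distributed_def map_pmf_rep_eq[symmetric] measure_pmf_eq_density[symmetric])

lemma information_space_pmf: "information_space (measure_pmf p) 2"
  by (simp add: information_space_def information_space_axioms_def measure_pmf.prob_space_axioms)

lemma H_ent_eq:
  fixes X :: "'a \<Rightarrow> 'b::countable"
  shows "H_ent p X = H p X"
proof -
  interpret information_space "measure_pmf p" 2 by (rule information_space_pmf)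
  have "H_ent p X = - (\<integral>x. pmf (map_pmf X p) x * log 2 (pmf (map_pmf X p) x) \<partial>count_space UNIV)"
    by (rule entropy_distr[OF distributed_map_pmf]) simp
  also have "\<dots> = H p X"
    unfolding integral_count_space_pmf by (simp add: ent_def)
  finally show ?thesis .
qed

lemma H_cond_eq:
  fixes X :: "'a \<Rightarrow> 'b::countable" and Y :: "'a \<Rightarrow> 'c::countable"
  assumes fin: "finite (set_pmf p)"
  shows "H_cond p X Y = H p (\<lambda>w. (X w, Y w)) - H p Y"
proof -
  interpret information_space "measure_pmf p" 2 by (rule information_space_pmf)
  let ?XY = "\<lambda>w. (X w, Y w)"
  have "H_cond p X Y = - (\<integral>(x, y). pmf (map_pmf ?XY p) (x, y) *
      log 2 (pmf (map_pmf ?XY p) (x, y) / pmf (map_pmf Y p) y) \<partial>(count_space UNIV \<Otimes>\<^sub>M count_space UNIV))"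
    by (rule conditional_entropy_generic_eq)
       (auto simp: sigma_finite_count_space_countable count_space_pair_countable intro: distributed_map_pmf)
  also have "\<dots> = - E_pmf (map_pmf ?XY p) (\<lambda>(x, y). log 2 (pmf (map_pmf ?XY p) (x, y) / pmf (map_pmf Y p) y))"
    unfolding count_space_pair_countable integral_count_space_pmf[symmetric]
    by (simp add: case_prod_unfold)
  also have "\<dots> = - E_pmf p (\<lambda>w. - (- log 2 (pmf (map_pmf ?XY p) (?XY w))) + - log 2 (pmf (map_pmf Y p) (Y w)))"
    unfolding integral_map_pmf
  proof (intro arg_cong[where f = uminus] E_pmf_cong)
    fix w assume w: "w \<in> set_pmf p"
    show "(case ?XY w of (x, y) \<Rightarrow> log 2 (pmf (map_pmf ?XY p) (x, y) / pmf (map_pmf Y p) y)) =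
      - (- log 2 (pmf (map_pmf ?XY p) (?XY w))) + - log 2 (pmf (map_pmf Y p) (Y w))"
      using pmf_map_pos[OF w, of ?XY] pmf_map_pos[OF w, of Y] by (simp add: log_divide_pos)
  qed
  also have "\<dots> = H p ?XY - H p Y"
    unfolding H_eq_E_pmf using fin by (simp add: integrable_measure_pmf_finite)
  finally show ?thesis .
qed

lemma mutual_information_eq:
  fixes X :: "'a \<Rightarrow> 'b::countable" and Y :: "'a \<Rightarrow> 'c::countable"
  assumes fin: "finite (set_pmf p)"
  shows "prob_space.mutual_information (measure_pmf p) 2 (count_space UNIV) (count_space UNIV) X Y
    = H p X + H p Y - H p (\<lambda>w. (X w, Y w))"
proof -
  interpret information_space "measure_pmf p" 2 by (rule information_space_pmf)
  interpret C: sigma_finite_measure "count_space (UNIV :: ('b \<times> 'c) set)"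
    by (rule sigma_finite_count_space_countable)
  let ?XY = "\<lambda>w. (X w, Y w)"
  let ?q = "map_pmf ?XY p" and ?r = "pair_pmf (map_pmf X p) (map_pmf Y p)"
  \<comment> \<open>Absolute continuity of the joint law with respect to the product of its
    marginals, the condition for writing the divergence as an integral over densities.\<close>
  have ac: "pmf ?r z = 0 \<Longrightarrow> pmf ?q z = 0" for z
    by (cases z) (auto simp: pmf_eq_0_set_pmf)
  have "prob_space.mutual_information (measure_pmf p) 2 (count_space UNIV) (count_space UNIV) X Y
      = KL_divergence 2 (measure_pmf ?r) (measure_pmf ?q)"
    by (simp add: prob_space.mutual_information_def[OF measure_pmf.prob_space_axioms] map_pmf_rep_eq[symmetric] measure_pmf_pair count_space_pair_countable)
  also have "\<dots> = (\<integral>z. pmf ?q z * log 2 (pmf ?q z / pmf ?r z) \<partial>count_space UNIV)"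
    unfolding measure_pmf_eq_density using ac
    by (intro C.KL_density_density) auto
  also have "\<dots> = E_pmf p (\<lambda>w. - log 2 (pmf (map_pmf X p) (X w)) + - log 2 (pmf (map_pmf Y p) (Y w))
      - - log 2 (pmf ?q (?XY w)))"
    unfolding integral_count_space_pmf integral_map_pmf
  proof (rule E_pmf_cong)
    fix w assume w: "w \<in> set_pmf p"
    show "log 2 (pmf ?q (?XY w) / pmf ?r (?XY w)) = - log 2 (pmf (map_pmf X p) (X w)) +
        - log 2 (pmf (map_pmf Y p) (Y w)) - - log 2 (pmf ?q (?XY w))"
      using pmf_map_pos[OF w, of ?XY] pmf_map_pos[OF w, of Y] pmf_map_pos[OF w, of X]
      by (simp add: log_divide_pos log_mult_pos pmf_pair)
  qed
  also have "\<dots> = H p X + H p Y - H p ?XY"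
    unfolding H_eq_E_pmf using fin by (simp add: integrable_measure_pmf_finite)
  finally show ?thesis .
qed

text \<open>The library defines I(X; Y | Z) as I(X; (Y, Z)) - I(X; Z); the two copies of H(X)
  cancel.\<close>

lemma I_cond_eq:
  fixes X :: "'a \<Rightarrow> 'b::countable" and Y :: "'a \<Rightarrow> 'c::countable" and Z :: "'a \<Rightarrow> 'd::countable"
  assumes fin: "finite (set_pmf p)"
  shows "I_cond p X Y Z = H p (\<lambda>w. (X w, Z w)) + H p (\<lambda>w. (Y w, Z w))
    - H p (\<lambda>w. (X w, Y w, Z w)) - H p Z"
  unfolding prob_space.conditional_mutual_information_def[OF measure_pmf.prob_space_axioms] count_space_pair_countable
  by (simp add: mutual_information_eq[OF fin])

section \<open>Conditional information of channels\<close>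

text \<open>\<open>I(X; O | \<zeta> O)\<close> for the input distribution \<open>P\<close> and the channel \<open>K\<close> from \<open>X\<close> to \<open>O\<close>.\<close>

definition gain :: "('o \<Rightarrow> 'z) \<Rightarrow> 'x pmf \<Rightarrow> ('x \<Rightarrow> 'o pmf) \<Rightarrow> real" where
  "gain \<zeta> P K = (ent (bind_pmf P K) - H (bind_pmf P K) \<zeta>) - E_pmf P (\<lambda>x. ent (K x) - H (K x) \<zeta>)"

text \<open>By the chain rule \<open>ent P\<close> occurs in both H(X, Z) and H(X, Y, Z) and
  cancels. What remains mentions only output entropies, with and without knowledge of the
  input.\<close>

lemma channel_I_cond_eq_gain:
  fixes W :: "('x::finite, 'y::finite, 'z::finite) dmbc"
  shows "channel_I_cond P W = gain snd P W"
proof -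
  let ?J = "joint P W"
  have fin: "finite (set_pmf q)" for q :: "'i::finite pmf" by simp
  have "map_pmf (\<lambda>w. ((case w of (x, y, z) \<Rightarrow> x), (case w of (x, y, z) \<Rightarrow> z))) ?J
      = bind_pmf P (\<lambda>x. map_pmf (Pair x) (map_pmf snd (W x)))"
    by (simp add: joint_def map_bind_pmf pmf.map_comp o_def case_prod_unfold)
  hence 1: "H ?J (\<lambda>w. ((case w of (x, y, z) \<Rightarrow> x), (case w of (x, y, z) \<Rightarrow> z)))
      = ent P + E_pmf P (\<lambda>x. H (W x) snd)"
    using ent_bind_Pair[of P "\<lambda>x. map_pmf snd (W x)"] fin by simp
  have 2: "H ?J (\<lambda>w. ((case w of (x, y, z) \<Rightarrow> x), (case w of (x, y, z) \<Rightarrow> y), (case w of (x, y, z) \<Rightarrow> z)))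
      = ent P + E_pmf P (\<lambda>x. ent (W x))"
    using ent_bind_Pair[of P W] fin by (simp add: joint_def case_prod_unfold)
  have "map_pmf (\<lambda>w. ((case w of (x, y, z) \<Rightarrow> y), (case w of (x, y, z) \<Rightarrow> z))) ?J = bind_pmf P W"
    by (simp add: joint_def map_bind_pmf pmf.map_comp o_def case_prod_unfold)
  moreover have "map_pmf (\<lambda>w. case w of (x, y, z) \<Rightarrow> z) ?J = map_pmf snd (bind_pmf P W)"
    by (simp add: joint_def map_bind_pmf pmf.map_comp o_def case_prod_unfold)
  ultimately show ?thesis
    unfolding channel_I_cond_def I_cond_eq[OF fin] gain_def 1 2 by (simp add: integrable_measure_pmf_finite)
qed

text \<open>Given the input, the two output components are independent, so the conditional entropies
  add exactly. Only the unconditional term H(V | \<zeta> V) needs an inequality. The input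
  components \<open>f1 x\<close> and \<open>f2 x\<close> may be correlated. The abstract projections
  allow two uses: head and tail of a block, and the two subchannels.\<close>

lemma gain_product_le:
  fixes \<zeta> :: "'o \<Rightarrow> 'z"
  assumes finP: "finite (set_pmf P)"
    and finK: "\<And>x. x \<in> set_pmf P \<Longrightarrow> finite (set_pmf (K x))"
    and split: "\<And>x. x \<in> set_pmf P \<Longrightarrow>
      map_pmf (\<lambda>v. (\<pi> v, \<rho> v)) (K x) = pair_pmf (K1 (f1 x)) (K2 (f2 x))"
    and inj: "inj_on (\<lambda>v. (\<pi> v, \<rho> v)) (set_pmf (bind_pmf P K))"
    and \<zeta>: "\<And>v v'. v \<in> set_pmf (bind_pmf P K) \<Longrightarrow> v' \<in> set_pmf (bind_pmf P K) \<Longrightarrow>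
      \<zeta> v = \<zeta> v' \<longleftrightarrow> \<mu> (\<pi> v) = \<mu> (\<pi> v') \<and> \<nu> (\<rho> v) = \<nu> (\<rho> v')"
  shows "gain \<zeta> P K \<le> gain \<mu> (map_pmf f1 P) K1 + gain \<nu> (map_pmf f2 P) K2"
proof -
  let ?R = "bind_pmf P K"
  have finR: "finite (set_pmf ?R)" using finP finK by auto
  have m1: "map_pmf \<pi> (K x) = K1 (f1 x)" and m2: "map_pmf \<rho> (K x) = K2 (f2 x)" if "x \<in> set_pmf P" for x
    using arg_cong[OF split[OF that], of "map_pmf fst"] arg_cong[OF split[OF that], of "map_pmf snd"]
    by (simp_all add: pmf.map_comp o_def map_fst_pair_pmf map_snd_pair_pmf)
  have fin1: "finite (set_pmf (K1 (f1 x)))" and fin2: "finite (set_pmf (K2 (f2 x)))" if "x \<in> set_pmf P" for x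
    using m1[OF that] m2[OF that] finK[OF that] by (metis finite_imageI set_map_pmf)+
  have R1: "map_pmf \<pi> ?R = bind_pmf (map_pmf f1 P) K1"
    by (simp add: map_bind_pmf bind_map_pmf m1 cong: bind_pmf_cong)
  have R2: "map_pmf \<rho> ?R = bind_pmf (map_pmf f2 P) K2"
    by (simp add: map_bind_pmf bind_map_pmf m2 cong: bind_pmf_cong)
  have e1: "ent (K x) = ent (K1 (f1 x)) + ent (K2 (f2 x))"
    and e2: "H (K x) \<zeta> = H (K1 (f1 x)) \<mu> + H (K2 (f2 x)) \<nu>" if x: "x \<in> set_pmf P" for x
  proof -
    have sub: "set_pmf (K x) \<subseteq> set_pmf ?R" using x by auto
    have "ent (K x) = H (K x) (\<lambda>v. (\<pi> v, \<rho> v))"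
      using finK[OF x] inj_on_subset[OF inj sub] by (simp add: ent_map_inj)
    thus "ent (K x) = ent (K1 (f1 x)) + ent (K2 (f2 x))"
      using fin1[OF x] fin2[OF x] by (simp add: split[OF x] ent_pair)
    have "H (K x) \<zeta> = H (K x) (\<lambda>v. (\<mu> (\<pi> v), \<nu> (\<rho> v)))"
      by (rule H_cong[OF finK[OF x]]) (simp only: \<zeta>[OF subsetD[OF sub] subsetD[OF sub]] prod.inject)
    also have "\<dots> = H (map_pmf (\<lambda>v. (\<pi> v, \<rho> v)) (K x)) (\<lambda>(a, b). (\<mu> a, \<nu> b))"
      by (simp add: pmf.map_comp o_def)
    also have "\<dots> = ent (pair_pmf (map_pmf \<mu> (K1 (f1 x))) (map_pmf \<nu> (K2 (f2 x))))"
      by (simp add: split[OF x] map_pair)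
    also have "\<dots> = H (K1 (f1 x)) \<mu> + H (K2 (f2 x)) \<nu>"
      using fin1[OF x] fin2[OF x] by (simp add: ent_pair)
    finally show "H (K x) \<zeta> = H (K1 (f1 x)) \<mu> + H (K2 (f2 x)) \<nu>" .
  qed
  have E: "E_pmf P (\<lambda>x. ent (K x) - H (K x) \<zeta>) =
      E_pmf (map_pmf f1 P) (\<lambda>x. ent (K1 x) - H (K1 x) \<mu>) + E_pmf (map_pmf f2 P) (\<lambda>x. ent (K2 x) - H (K2 x) \<nu>)"
    unfolding integral_map_pmf E_pmf_add[OF finP, symmetric]
    by (rule E_pmf_cong) (simp add: e1 e2)
  let ?a = "\<lambda>v. \<mu> (\<pi> v)" and ?b = "\<lambda>v. \<nu> (\<rho> v)"
  have "ent ?R = H ?R (\<lambda>v. (\<pi> v, \<rho> v, ?b v))"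
    using H_cong[OF finR, of "\<lambda>v. v" "\<lambda>v. (\<pi> v, \<rho> v, ?b v)"] inj by (auto simp: inj_on_def)
  moreover have "H ?R (\<lambda>v. (\<rho> v, ?b v)) = H ?R \<rho>" by (rule H_cong[OF finR]) auto
  moreover have "H ?R (\<lambda>v. (\<pi> v, ?b v, ?a v)) = H ?R (\<lambda>v. (\<pi> v, ?b v))" by (rule H_cong[OF finR]) auto
  moreover have "H ?R (\<lambda>v. (\<pi> v, ?a v)) = H ?R \<pi>" by (rule H_cong[OF finR]) auto
  moreover have "H ?R (\<lambda>v. (?b v, ?a v)) = H ?R \<zeta>" by (rule H_cong[OF finR]) (auto simp: \<zeta>)
  \<comment> \<open>Added up, these give H(\<pi>, \<rho>) - H(a, b) \<le> (H(\<pi>) - H(a)) +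
    (H(\<rho>) - H(b)), where a and b are Eve's parts \<open>?a\<close> and \<open>?b\<close> of the
    two components.\<close>
  moreover note H_submodular[OF finR, of \<pi> \<rho> ?b] H_submodular[OF finR, of \<pi> ?b ?a]
  moreover have "H ?R ?a = H (map_pmf \<pi> ?R) \<mu>" "H ?R ?b = H (map_pmf \<rho> ?R) \<nu>"
    by (simp_all only: pmf.map_comp o_def)
  ultimately show ?thesis
    unfolding gain_def E R1[symmetric] R2[symmetric] by linarith
qed

section \<open>Blocks of channel uses\<close>

lemma set_transmit: "yzs \<in> set_pmf (transmit W xs) \<Longrightarrow> length yzs = length xs"
  by (induction xs arbitrary: yzs) auto

lemma finite_set_lists_length: "finite {xs :: 'a::finite list. length xs = n}"
  using finite_lists_length_eq[of "UNIV :: 'a set" n] by simp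

lemma finite_set_transmit:
  fixes W :: "('x, 'y::finite, 'z::finite) dmbc"
  shows "finite (set_pmf (transmit W xs))"
  by (rule finite_subset[OF _ finite_set_lists_length[of "length xs"]]) (auto dest: set_transmit)

lemma transmit_Cons: "transmit W (x # xs) = map_pmf (\<lambda>(a, l). a # l) (pair_pmf (W x) (transmit W xs))"
  by (simp add: pair_pmf_def map_bind_pmf)

lemma ent_return [simp]: "ent (return_pmf x) = 0"
  by (simp add: ent_def)

text \<open>The letters of the block may depend on each other arbitrarily: the outputs are still
  independent given the whole input block, which is what \<open>gain_product_le\<close> requires
  when the first letter is split off.\<close>

lemma gain_transmit_le:
  fixes W :: "('x::finite, 'y::finite, 'z::finite) dmbc"
  assumes C: "\<And>P. gain snd P W \<le> C"
    and len: "\<And>xs. xs \<in> set_pmf P \<Longrightarrow> length xs = n"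
  shows "gain (map snd) P (transmit W) \<le> n * C"
  using len
proof (induction n arbitrary: P)
  case 0
  hence "P = return_pmf []" by (metis length_0_conv set_pmf_subset_singleton subset_singletonD subsetI insertI1 singletonI)
  thus ?case by (simp add: gain_def bind_return_pmf)
next
  case (Suc n)
  have finP: "finite (set_pmf P)"
    by (rule finite_subset[OF _ finite_set_lists_length[of "Suc n"]]) (auto dest: Suc.prems)
  have len: "length v = Suc n" if "v \<in> set_pmf (bind_pmf P (transmit W))" for v
    using that Suc.prems by (auto dest: set_transmit)
  have "gain (map snd) P (transmit W)
      \<le> gain snd (map_pmf hd P) W + gain (map snd) (map_pmf tl P) (transmit W)"
  proof (rule gain_product_le[where \<pi> = hd and \<rho> = tl])
    show "map_pmf (\<lambda>v. (hd v, tl v)) (transmit W x) = pair_pmf (W (hd x)) (transmit W (tl x))"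
      if x: "x \<in> set_pmf P" for x
    proof -
      obtain a as where "x = a # as" using Suc.prems[OF x] by (cases x) auto
      thus ?thesis
        by (simp add: transmit_Cons pmf.map_comp o_def case_prod_unfold del: transmit.simps)
    qed
    show "inj_on (\<lambda>v. (hd v, tl v)) (set_pmf (bind_pmf P (transmit W)))"
      using len by (intro inj_onI) (metis list.collapse list.size(3) nat.distinct(1) prod.inject)
    show "map snd v = map snd v' \<longleftrightarrow> snd (hd v) = snd (hd v') \<and> map snd (tl v) = map snd (tl v')"
      if "v \<in> set_pmf (bind_pmf P (transmit W))" "v' \<in> set_pmf (bind_pmf P (transmit W))" for v v'
      using len[OF that(1)] len[OF that(2)] by (cases v; cases v') auto
  qed (auto simp: finP finite_set_transmit)
  also have "\<dots> \<le> C + n * C"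
    using Suc.prems by (intro add_mono C Suc.IH) force
  finally show ?case by (simp add: algebra_simps)
qed

text \<open>The conditional mutual information I(A; B | E) written with entropies, so that it is
  available for values of any type.\<close>

definition cmi :: "'a pmf \<Rightarrow> ('a \<Rightarrow> 'b) \<Rightarrow> ('a \<Rightarrow> 'c) \<Rightarrow> ('a \<Rightarrow> 'd) \<Rightarrow> real" where
  "cmi p A B E = H p (\<lambda>w. (A w, E w)) + H p (\<lambda>w. (B w, E w)) - H p (\<lambda>w. (A w, B w, E w)) - H p E"

lemma cmi_commute: "finite (set_pmf p) \<Longrightarrow> cmi p A B E = cmi p B A E"
  using H_cong[of p "\<lambda>w. (A w, B w, E w)" "\<lambda>w. (B w, A w, E w)"] by (auto simp: cmi_def)

lemma cmi_cong:
  assumes fin: "finite (set_pmf p)"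
    and A: "\<And>w w'. w \<in> set_pmf p \<Longrightarrow> w' \<in> set_pmf p \<Longrightarrow> A w = A w' \<longleftrightarrow> A' w = A' w'"
    and B: "\<And>w w'. w \<in> set_pmf p \<Longrightarrow> w' \<in> set_pmf p \<Longrightarrow> B w = B w' \<longleftrightarrow> B' w = B' w'"
    and E: "\<And>w w'. w \<in> set_pmf p \<Longrightarrow> w' \<in> set_pmf p \<Longrightarrow> E w = E w' \<longleftrightarrow> E' w = E' w'"
  shows "cmi p A B E = cmi p A' B' E'"
proof -
  have "H p (\<lambda>w. (A w, E w)) = H p (\<lambda>w. (A' w, E' w))"
    "H p (\<lambda>w. (B w, E w)) = H p (\<lambda>w. (B' w, E' w))"
    "H p (\<lambda>w. (A w, B w, E w)) = H p (\<lambda>w. (A' w, B' w, E' w))" "H p E = H p E'"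
    by (auto intro!: H_cong[OF fin] simp only: prod.inject A B E)
  thus ?thesis by (simp add: cmi_def)
qed

lemma cmi_map: "cmi (map_pmf f p) A B E = cmi p (\<lambda>w. A (f w)) (\<lambda>w. B (f w)) (\<lambda>w. E (f w))"
  by (simp add: cmi_def pmf.map_comp o_def)

text \<open>The sent word \<open>x\<close> depends on the transcript only through the sender's view
  \<open>\<alpha> (V t)\<close>, and the output only on \<open>x\<close>, so the chain rule applies
  twice. Whatever else \<open>V\<close> records affects the first summand alone; this lets the other
  two be compared between different choices of \<open>V\<close>.\<close>

lemma H_sent_received:
  assumes finp: "finite (set_pmf p)"
    and fine: "\<And>t. t \<in> set_pmf p \<Longrightarrow> finite (set_pmf (e (\<alpha> (V t))))"
    and finK: "\<And>x. finite (set_pmf (K x))"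
  shows "H (bind_pmf p (\<lambda>t. bind_pmf (e (\<alpha> (V t))) (\<lambda>x. map_pmf (\<lambda>v. (t, x, v)) (K x))))
      (\<lambda>(t, x, v). ((V t, x), \<xi> v))
    = H p V + E_pmf p (\<lambda>t. ent (e (\<alpha> (V t)))) + E_pmf (bind_pmf p (\<lambda>t. e (\<alpha> (V t)))) (\<lambda>x. H (K x) \<xi>)"
proof -
  let ?Q = "bind_pmf (map_pmf V p) (\<lambda>v. map_pmf (Pair v) (e (\<alpha> v)))"
  have finQ: "finite (set_pmf ?Q)" using finp fine by auto
  have "map_pmf (\<lambda>(t, x, v). ((V t, x), \<xi> v))
      (bind_pmf p (\<lambda>t. bind_pmf (e (\<alpha> (V t))) (\<lambda>x. map_pmf (\<lambda>v. (t, x, v)) (K x))))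
    = bind_pmf ?Q (\<lambda>u. map_pmf (Pair u) (map_pmf \<xi> (K (snd u))))"
    by (simp add: map_bind_pmf bind_map_pmf bind_assoc_pmf pmf.map_comp o_def)
  moreover have "ent (bind_pmf ?Q (\<lambda>u. map_pmf (Pair u) (map_pmf \<xi> (K (snd u)))))
      = ent ?Q + E_pmf ?Q (\<lambda>u. H (K (snd u)) \<xi>)"
    using finQ finK by (intro ent_bind_Pair) auto
  moreover have "ent ?Q = H p V + E_pmf p (\<lambda>t. ent (e (\<alpha> (V t))))"
    using finp fine by (subst ent_bind_Pair) auto
  moreover have "E_pmf ?Q (\<lambda>u. H (K (snd u)) \<xi>) = E_pmf (map_pmf snd ?Q) (\<lambda>x. H (K x) \<xi>)"
    by (simp only: integral_map_pmf)
  moreover have "map_pmf snd ?Q = bind_pmf p (\<lambda>t. e (\<alpha> (V t)))"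
    by (simp add: map_bind_pmf bind_map_pmf pmf.map_comp o_def)
  ultimately show ?thesis by simp
qed

text \<open>The first and third entropies of the new \<open>cmi\<close> contain the sender's view.
  By \<open>H_sent_received\<close> both contain the same term for the sender's randomness, which
  cancels. The receiver's entropy is bounded by submodularity.\<close>

lemma cmi_round_le:
  fixes A :: "'t \<Rightarrow> 'a" and B :: "'t \<Rightarrow> 'b" and E :: "'t \<Rightarrow> 'e"
  defines "N \<equiv> \<lambda>p e K. bind_pmf p (\<lambda>t. bind_pmf (e (A t)) (\<lambda>x. map_pmf (\<lambda>v. (t, x, v)) (K x)))"
  assumes finp: "finite (set_pmf p)"
    and fine: "\<And>t. t \<in> set_pmf p \<Longrightarrow> finite (set_pmf (e (A t)))"
    and finK: "\<And>x. finite (set_pmf (K x))"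
    and inj: "\<And>v v'. \<eta> v = \<eta> v' \<Longrightarrow> \<zeta> v = \<zeta> v' \<Longrightarrow> v = v'"
  shows "cmi (N p e K) (\<lambda>(t, x, v). (A t, x)) (\<lambda>(t, x, v). (B t, \<eta> v)) (\<lambda>(t, x, v). (E t, \<zeta> v))
    \<le> cmi p A B E + gain \<zeta> (bind_pmf p (\<lambda>t. e (A t))) K"
proof -
  let ?N = "N p e K" and ?P = "bind_pmf p (\<lambda>t. e (A t))"
  have finN: "finite (set_pmf ?N)" unfolding N_def using finp fine finK by auto
  have finP: "finite (set_pmf ?P)" using finp fine by auto
  have t: "map_pmf (\<lambda>(t, x, v). h t) ?N = map_pmf h p" for h :: "'t \<Rightarrow> 'h"
    unfolding N_def by (simp add: map_bind_pmf pmf.map_comp o_def map_pmf_def[symmetric])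
  have tE: "H ?N (\<lambda>(t, x, v). E t) = H p E" by (simp only: t)
  have tBE: "H ?N (\<lambda>(t, x, v). (B t, E t)) = H p (\<lambda>t. (B t, E t))" by (simp only: t)
  have v: "map_pmf (\<lambda>(t, x, v). v) ?N = bind_pmf ?P K"
    unfolding N_def by (simp add: map_bind_pmf pmf.map_comp o_def bind_assoc_pmf)
  have vH: "H ?N (\<lambda>(t, x, v). v) = ent (bind_pmf ?P K)" by (simp only: v)
  have v\<zeta>: "H ?N (\<lambda>(t, x, v). \<zeta> v) = H (bind_pmf ?P K) \<zeta>"
    unfolding v[symmetric] by (simp add: pmf.map_comp o_def case_prod_unfold)
  have 1: "H ?N (\<lambda>w. ((\<lambda>(t, x, v). (A t, x)) w, (\<lambda>(t, x, v). (E t, \<zeta> v)) w))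
      = H p (\<lambda>t. (A t, E t)) + E_pmf p (\<lambda>t. ent (e (A t))) + E_pmf ?P (\<lambda>x. H (K x) \<zeta>)"
  proof -
    have "H ?N (\<lambda>w. ((\<lambda>(t, x, v). (A t, x)) w, (\<lambda>(t, x, v). (E t, \<zeta> v)) w))
        = H ?N (\<lambda>(t, x, v). (((A t, E t), x), \<zeta> v))"
      by (rule H_cong[OF finN]) auto
    also have "\<dots> = H p (\<lambda>t. (A t, E t)) + E_pmf p (\<lambda>t. ent (e (A t))) + E_pmf ?P (\<lambda>x. H (K x) \<zeta>)"
      unfolding N_def using H_sent_received[of p e fst "\<lambda>t. (A t, E t)" K \<zeta>] finp fine finK by simp
    finally show ?thesis .
  qed
  have 2: "H ?N (\<lambda>w. ((\<lambda>(t, x, v). (A t, x)) w, (\<lambda>(t, x, v). (B t, \<eta> v)) w, (\<lambda>(t, x, v). (E t, \<zeta> v)) w))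
      = H p (\<lambda>t. (A t, B t, E t)) + E_pmf p (\<lambda>t. ent (e (A t))) + E_pmf ?P (\<lambda>x. ent (K x))"
  proof -
    have "H ?N (\<lambda>w. ((\<lambda>(t, x, v). (A t, x)) w, (\<lambda>(t, x, v). (B t, \<eta> v)) w, (\<lambda>(t, x, v). (E t, \<zeta> v)) w))
        = H ?N (\<lambda>(t, x, v). (((A t, B t, E t), x), v))"
      by (rule H_cong[OF finN]) (auto dest: inj)
    also have "\<dots> = H p (\<lambda>t. (A t, B t, E t)) + E_pmf p (\<lambda>t. ent (e (A t))) + E_pmf ?P (\<lambda>x. ent (K x))"
      unfolding N_def using H_sent_received[of p e fst "\<lambda>t. (A t, B t, E t)" K "\<lambda>v. v"] finp fine finK by simp
    finally show ?thesis .
  qed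
  have 3: "H ?N (\<lambda>w. ((\<lambda>(t, x, v). (B t, \<eta> v)) w, (\<lambda>(t, x, v). (E t, \<zeta> v)) w))
      = H ?N (\<lambda>w. ((\<lambda>(t, x, v). (B t, E t)) w, (\<lambda>(t, x, v). v) w, (\<lambda>(t, x, v). \<zeta> v) w))"
    by (rule H_cong[OF finN]) (auto dest: inj)
  have 4: "H ?N (\<lambda>w. ((\<lambda>(t, x, v). v) w, (\<lambda>(t, x, v). \<zeta> v) w)) = H ?N (\<lambda>(t, x, v). v)"
    by (rule H_cong[OF finN]) auto
  have 5: "H ?N (\<lambda>w. ((\<lambda>(t, x, v). (B t, E t)) w, (\<lambda>(t, x, v). \<zeta> v) w))
      = H ?N (\<lambda>w. ((\<lambda>(t, x, v). B t) w, (\<lambda>(t, x, v). \<zeta> v) w, (\<lambda>(t, x, v). E t) w))"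
    by (rule H_cong[OF finN]) auto
  have 6: "H ?N (\<lambda>w. ((\<lambda>(t, x, v). B t) w, (\<lambda>(t, x, v). E t) w)) = H ?N (\<lambda>(t, x, v). (B t, E t))"
    by (rule H_cong[OF finN]) auto
  have 7: "H ?N (\<lambda>w. ((\<lambda>(t, x, v). \<zeta> v) w, (\<lambda>(t, x, v). E t) w)) = H ?N (\<lambda>(t, x, v). (E t, \<zeta> v))"
    by (rule H_cong[OF finN]) auto
  \<comment> \<open>In conditional form: H(v | B, E, \<zeta>) \<le> H(v | \<zeta>), and H(\<zeta>, B
    | E) \<le> H(\<zeta> | E) + H(B | E). They detach the new output from the receiver's and Eve's
    past.\<close>
  note H_submodular[OF finN, of "\<lambda>(t, x, v). (B t, E t)" "\<lambda>(t, x, v). v" "\<lambda>(t, x, v). \<zeta> v"]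
    H_submodular[OF finN, of "\<lambda>(t, x, v). B t" "\<lambda>(t, x, v). \<zeta> v" "\<lambda>(t, x, v). E t"]
  moreover have "gain \<zeta> ?P K = ent (bind_pmf ?P K) - H (bind_pmf ?P K) \<zeta>
      - (E_pmf ?P (\<lambda>x. ent (K x)) - E_pmf ?P (\<lambda>x. H (K x) \<zeta>))"
    unfolding gain_def by (simp only: E_pmf_diff[OF finP])
  ultimately show ?thesis
    unfolding cmi_def 1 2 using 3 4 5 6 7 tE tBE vH v\<zeta> by linarith
qed

text \<open>As \<open>S\<close> is a function of \<open>A\<close>, I(A; B | E) = I(S; B | E) + I(A;
  B | S, E), and the last term is nonnegative. What is then left of H(S | E) is H(S | B, E), at most
  H(S | T) because \<open>T\<close> is a function of \<open>B\<close>.\<close>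

lemma H_key_le_cmi:
  assumes fin: "finite (set_pmf p)"
    and S: "\<And>w. S w = f (A w)" and T: "\<And>w. T w = g (B w)"
  shows "H p (\<lambda>w. (S w, E w)) - H p E \<le> cmi p A B E + (H p (\<lambda>w. (S w, T w)) - H p T)"
proof -
  have 1: "H p (\<lambda>w. (S w, (B w, E w), T w)) = H p (\<lambda>w. (S w, B w, E w))"
    "H p (\<lambda>w. ((B w, E w), T w)) = H p (\<lambda>w. (B w, E w))"
    "H p (\<lambda>w. (A w, B w, S w, E w)) = H p (\<lambda>w. (A w, B w, E w))"
    "H p (\<lambda>w. (A w, S w, E w)) = H p (\<lambda>w. (A w, E w))"
    "H p (\<lambda>w. (B w, S w, E w)) = H p (\<lambda>w. (S w, B w, E w))"
    by (rule H_cong[OF fin], auto simp: S T)+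
  show ?thesis
    using H_submodular[OF fin, of S "\<lambda>w. (B w, E w)" T] H_submodular[OF fin, of A B "\<lambda>w. (S w, E w)"]
    unfolding cmi_def 1 by linarith
qed

section \<open>The converse bound\<close>

lemma enc_A_length:
  assumes "valid_protocol \<pi>" "length v = i" "i < length (lens \<pi>)" "sender \<pi> i = Alice" "xs \<in> set_pmf (enc_A \<pi> v)"
  shows "length xs = lens \<pi> ! i"
  using assms by (auto simp: valid_protocol_def)

lemma enc_B_length:
  assumes "valid_protocol \<pi>" "length v = i" "i < length (lens \<pi>)" "sender \<pi> i = Bob" "xs \<in> set_pmf (enc_B \<pi> v)"
  shows "length xs = lens \<pi> ! i"
  using assms by (auto simp: valid_protocol_def)

lemma card_transcripts_step:
  fixes F :: "'x::finite list \<Rightarrow> ('y::finite \<times> 'z::finite) list \<Rightarrow> 'r"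
  assumes "finite T"
  shows "finite ((\<lambda>(t, x, v). t @ [F x v]) ` (T \<times> {x. length x = k} \<times>
            {v. length v = k}))" (is "finite (?f ` ?D)")
    and "card ((\<lambda>(t, x, v). t @ [F x v]) ` (T \<times> {x. length x = k} \<times> {v. length v = k}))
        \<le> card T * (CARD('x) * CARD('y \<times> 'z)) ^ k"
proof -
  have fin: "finite ?D" using assms by (intro finite_cartesian_product finite_set_lists_length)
  thus "finite (?f ` ?D)" by simp
  have "card (?f ` ?D) \<le> card ?D" using fin by (rule card_image_le)
  also have "\<dots> = card T * (CARD('x) ^ k * CARD('y \<times> 'z) ^ k)"
    using card_lists_length_eq[of "UNIV :: 'x set" k] card_lists_length_eq[of "UNIV :: ('y \<times> 'z) set" k]
    by (simp add: card_cartesian_product del: card_prod)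
  finally show "card (?f ` ?D) \<le> card T * (CARD('x) * CARD('y \<times> 'z)) ^ k"
    by (simp only: power_mult_distrib)
qed

context
  fixes Wf :: "('xf::finite, 'yf::finite, 'zf::finite) dmbc"
    and Wb :: "('xb::finite, 'yb::finite, 'zb::finite) dmbc"
    and \<pi> :: "('xf, 'yf, 'xb, 'yb) ske_protocol"
  assumes valid: "valid_protocol \<pi>"
begin

text \<open>The cardinality bound is there for Fano's inequality: a key is a function of the
  transcript and so takes at most as many values. Fixed round lengths and finite alphabets make the
  logarithm of that number linear in the channel uses.\<close>

lemma run_rounds_support:
  assumes "i \<le> length (lens \<pi>)"
  shows "finite (set_pmf (run_rounds Wf Wb \<pi> i)) \<and> (\<forall>t\<in>set_pmf (run_rounds Wf Wb \<pi> i). length t = i) \<and>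
    card (set_pmf (run_rounds Wf Wb \<pi> i))
      \<le> (CARD('xf) * CARD('yf \<times> 'zf) * (CARD('xb) * CARD('yb \<times> 'zb))) ^ (\<Sum>j<i. lens \<pi> ! j)"
  using assms
proof (induction i)
  case 0
  show ?case by simp
next
  case (Suc i)
  let ?T = "set_pmf (run_rounds Wf Wb \<pi> i)" and ?T' = "set_pmf (run_rounds Wf Wb \<pi> (Suc i))"
  let ?k = "lens \<pi> ! i"
  let ?Lf = "CARD('xf) * CARD('yf \<times> 'zf)" and ?Lb = "CARD('xb) * CARD('yb \<times> 'zb)"
  have i: "i < length (lens \<pi>)" and fin: "finite ?T" and len: "\<And>t. t \<in> ?T \<Longrightarrow> length t = i"
    and card: "card ?T \<le> (?Lf * ?Lb) ^ (\<Sum>j<i. lens \<pi> ! j)"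
    using Suc by auto
  \<comment> \<open>A round uses one channel only; including the factor for the other one gives a
    base common to both directions.\<close>
  have pow: "?Lf ^ ?k \<le> (?Lf * ?Lb) ^ ?k" "?Lb ^ ?k \<le> (?Lf * ?Lb) ^ ?k"
    by (rule power_mono, simp, simp)+
  have "\<exists>U. ?T' \<subseteq> U \<and> finite U \<and> (\<forall>t\<in>U. length t = Suc i) \<and> card U \<le> card ?T * (?Lf * ?Lb) ^ ?k"
  proof (cases "sender \<pi> i")
    case Alice
    let ?U = "(\<lambda>(t, x, v). t @ [Forward x v]) ` (?T \<times> {x. length x = ?k} \<times> {v. length v = ?k})"
    have "?T' \<subseteq> ?U"
    proof
      fix t' assume "t' \<in> ?T'"
      then obtain t x v where t: "t \<in> ?T" and x: "x \<in> set_pmf (enc_A \<pi> (View_A t))"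
        and v: "v \<in> set_pmf (transmit Wf x)" and t': "t' = t @ [Forward x v]"
        using Alice by auto
      have "length x = ?k" using enc_A_length[OF valid _ i Alice x] len[OF t] by simp
      moreover from this have "length v = ?k" using set_transmit[OF v] by simp
      ultimately show "t' \<in> ?U" using t t' by force
    qed
    moreover have "card ?U \<le> card ?T * (?Lf * ?Lb) ^ ?k"
      by (rule order_trans[OF card_transcripts_step(2)[OF fin] mult_le_mono2[OF pow(1)]])
    moreover have "finite ?U" by (rule card_transcripts_step(1)[OF fin])
    moreover have "\<forall>t\<in>?U. length t = Suc i" using len by auto
    ultimately show ?thesis by blast
  next
    case Bob
    let ?U = "(\<lambda>(t, x, v). t @ [Backward x v]) ` (?T \<times> {x. length x = ?k} \<times> {v. length v = ?k})"
    have "?T' \<subseteq> ?U"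
    proof
      fix t' assume "t' \<in> ?T'"
      then obtain t x v where t: "t \<in> ?T" and x: "x \<in> set_pmf (enc_B \<pi> (View_B t))"
        and v: "v \<in> set_pmf (transmit Wb x)" and t': "t' = t @ [Backward x v]"
        using Bob by auto
      have "length x = ?k" using enc_B_length[OF valid _ i Bob x] len[OF t] by simp
      moreover from this have "length v = ?k" using set_transmit[OF v] by simp
      ultimately show "t' \<in> ?U" using t t' by force
    qed
    moreover have "card ?U \<le> card ?T * (?Lf * ?Lb) ^ ?k"
      by (rule order_trans[OF card_transcripts_step(2)[OF fin] mult_le_mono2[OF pow(2)]])
    moreover have "finite ?U" by (rule card_transcripts_step(1)[OF fin])
    moreover have "\<forall>t\<in>?U. length t = Suc i" using len by auto
    ultimately show ?thesis by blast
  qed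
  then obtain U where U: "?T' \<subseteq> U" "finite U" "\<forall>t\<in>U. length t = Suc i" "card U \<le> card ?T * (?Lf * ?Lb) ^ ?k"
    by blast
  have "card ?T' \<le> card U" using U by (intro card_mono)
  also have "\<dots> \<le> (?Lf * ?Lb) ^ (\<Sum>j<i. lens \<pi> ! j) * (?Lf * ?Lb) ^ ?k"
    using U(4) card by (meson mult_le_mono1 order_trans)
  also have "\<dots> = (?Lf * ?Lb) ^ (\<Sum>j<Suc i. lens \<pi> ! j)"
    by (simp only: power_add sum.lessThan_Suc)
  finally show ?case using U finite_subset by blast
qed

lemma cmi_run_rounds_le:
  assumes Cf: "\<And>P. gain snd P Wf \<le> C" and Cb: "\<And>P. gain snd P Wb \<le> C"
    and "i \<le> length (lens \<pi>)"
  shows "cmi (run_rounds Wf Wb \<pi> i) View_A View_B View_E \<le> real (\<Sum>j<i. lens \<pi> ! j) * C"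
  using assms(3)
proof (induction i)
  case 0
  show ?case by (simp add: cmi_def)
next
  case (Suc i)
  let ?p = "run_rounds Wf Wb \<pi> i"
  have i: "i < length (lens \<pi>)" "i \<le> length (lens \<pi>)" using Suc by auto
  have fin: "finite (set_pmf ?p)" and len: "\<And>t. t \<in> set_pmf ?p \<Longrightarrow> length t = i"
    using run_rounds_support[OF i(2)] by auto
  have pair: "map fst v = map fst v' \<Longrightarrow> map snd v = map snd v' \<Longrightarrow> v = v'" for v v' :: "('i \<times> 'j) list"
    by (metis zip_map_fst_snd)
  have "cmi (run_rounds Wf Wb \<pi> (Suc i)) View_A View_B View_E
    \<le> cmi ?p View_A View_B View_E + real (lens \<pi> ! i) * C"
  proof (cases "sender \<pi> i")
    case Alice
    let ?N = "bind_pmf ?p (\<lambda>t. bind_pmf (enc_A \<pi> (View_A t)) (\<lambda>x. map_pmf (\<lambda>v. (t, x, v)) (transmit Wf x)))"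
    have lenx: "length x = lens \<pi> ! i" if "t \<in> set_pmf ?p" "x \<in> set_pmf (enc_A \<pi> (View_A t))" for t x
      using enc_A_length[OF valid _ i(1) Alice that(2)] len[OF that(1)] by simp
    have fine: "finite (set_pmf (enc_A \<pi> (View_A t)))" if "t \<in> set_pmf ?p" for t
      by (rule finite_subset[OF _ finite_set_lists_length]) (use lenx[OF that] in auto)
    have finN: "finite (set_pmf ?N)"
      using fin fine finite_set_transmit by auto
    have run: "run_rounds Wf Wb \<pi> (Suc i) = map_pmf (\<lambda>(t, x, v). t @ [Forward x v]) ?N"
      using Alice by (simp add: map_bind_pmf pmf.map_comp o_def map_pmf_def bind_assoc_pmf bind_return_pmf)
    \<comment> \<open>Each extended view carries the same information as the old view paired with
      the new sequence, because appending a tagged round is injective.\<close>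
    have "cmi (run_rounds Wf Wb \<pi> (Suc i)) View_A View_B View_E
      = cmi ?N (\<lambda>(t, x, v). (View_A t, x)) (\<lambda>(t, x, v). (View_B t, map fst v)) (\<lambda>(t, x, v). (View_E t, map snd v))"
      unfolding run cmi_map by (rule cmi_cong[OF finN]) (auto simp: case_prod_unfold)
    also have "\<dots> \<le> cmi ?p View_A View_B View_E
        + gain (map snd) (bind_pmf ?p (\<lambda>t. enc_A \<pi> (View_A t))) (transmit Wf)"
      using pair by (intro cmi_round_le fin fine finite_set_transmit) auto
    also have "gain (map snd) (bind_pmf ?p (\<lambda>t. enc_A \<pi> (View_A t))) (transmit Wf) \<le> real (lens \<pi> ! i) * C"
      using lenx by (intro gain_transmit_le Cf) auto
    finally show ?thesis by simp
  next
    case Bob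
    let ?N = "bind_pmf ?p (\<lambda>t. bind_pmf (enc_B \<pi> (View_B t)) (\<lambda>x. map_pmf (\<lambda>v. (t, x, v)) (transmit Wb x)))"
    have lenx: "length x = lens \<pi> ! i" if "t \<in> set_pmf ?p" "x \<in> set_pmf (enc_B \<pi> (View_B t))" for t x
      using enc_B_length[OF valid _ i(1) Bob that(2)] len[OF that(1)] by simp
    have fine: "finite (set_pmf (enc_B \<pi> (View_B t)))" if "t \<in> set_pmf ?p" for t
      by (rule finite_subset[OF _ finite_set_lists_length]) (use lenx[OF that] in auto)
    have finN: "finite (set_pmf ?N)"
      using fin fine finite_set_transmit by auto
    have run: "run_rounds Wf Wb \<pi> (Suc i) = map_pmf (\<lambda>(t, x, v). t @ [Backward x v]) ?N"
      using Bob by (simp add: map_bind_pmf pmf.map_comp o_def map_pmf_def bind_assoc_pmf bind_return_pmf)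
    \<comment> \<open>Symmetry of \<open>cmi\<close> puts Bob into the position of the
      sender.\<close>
    have "cmi (run_rounds Wf Wb \<pi> (Suc i)) View_A View_B View_E = cmi (run_rounds Wf Wb \<pi> (Suc i)) View_B View_A View_E"
      unfolding run using finN by (intro cmi_commute) simp
    also have "\<dots>
      = cmi ?N (\<lambda>(t, x, v). (View_B t, x)) (\<lambda>(t, x, v). (View_A t, map fst v)) (\<lambda>(t, x, v). (View_E t, map snd v))"
      unfolding run cmi_map by (rule cmi_cong[OF finN]) (auto simp: case_prod_unfold)
    also have "\<dots> \<le> cmi ?p View_B View_A View_E
        + gain (map snd) (bind_pmf ?p (\<lambda>t. enc_B \<pi> (View_B t))) (transmit Wb)"
      using pair by (intro cmi_round_le fin fine finite_set_transmit) auto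
    also have "gain (map snd) (bind_pmf ?p (\<lambda>t. enc_B \<pi> (View_B t))) (transmit Wb) \<le> real (lens \<pi> ! i) * C"
      using lenx by (intro gain_transmit_le Cb) auto
    also have "cmi ?p View_B View_A View_E = cmi ?p View_A View_B View_E"
      using fin by (rule cmi_commute)
    finally show ?thesis by simp
  qed
  with Suc.IH[OF i(2)] show ?case by (simp add: algebra_simps)
qed

lemma total_uses: "n_f \<pi> + n_b \<pi> = (\<Sum>j<length (lens \<pi>). lens \<pi> ! j)"
proof -
  have U: "{..<length (lens \<pi>)} = {i. i < length (lens \<pi>) \<and> sender \<pi> i = Alice} \<union> {i. i < length (lens \<pi>) \<and> sender \<pi> i = Bob}"
    (is "_ = ?A \<union> ?B")
    using party.exhaust by blast
  have "(\<Sum>j\<in>?A \<union> ?B. lens \<pi> ! j) = (\<Sum>j\<in>?A. lens \<pi> ! j) + (\<Sum>j\<in>?B. lens \<pi> ! j)"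
    by (rule sum.union_disjoint) auto
  thus ?thesis unfolding channel_uses_def U by simp
qed

end

text \<open>Combines H(S | E) \<le> I(A; B | E) + H(S | S') with the leakage condition H(S | E)
  \<ge> (1 - \<delta>) H(S). The result no longer contains the number of channel uses, over which
  nothing is known.\<close>

lemma secure_rate_le:
  fixes Wf :: "('xf::finite, 'yf::finite, 'zf::finite) dmbc"
    and Wb :: "('xb::finite, 'yb::finite, 'zb::finite) dmbc"
  defines "L \<equiv> real (CARD('xf) * CARD('yf \<times> 'zf) * (CARD('xb) * CARD('yb \<times> 'zb)))"
  assumes Cf: "\<And>P. gain snd P Wf \<le> C" and Cb: "\<And>P. gain snd P Wb \<le> C"
    and sec: "secure_protocol Wf Wb R \<delta> \<pi>" and \<delta>: "0 < \<delta>" "\<delta> < 1"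
  shows "(R - \<delta>) * (1 - \<delta>) \<le> C - log 2 (1 - \<delta>) + \<delta> * (log 2 L - log 2 \<delta>)"
proof -
  let ?T = "run Wf Wb \<pi>" and ?n = "n_f \<pi> + n_b \<pi>"
  have valid: "valid_protocol \<pi>" and n: "0 < ?n"
    and rate: "H_ent ?T (key \<pi>) / real ?n > R - \<delta>"
    and err: "measure_pmf.prob ?T {t. key_estimate \<pi> t \<noteq> key \<pi> t} < \<delta>"
    and leak: "H_ent ?T (key \<pi>) = 0 \<or> H_cond ?T (key \<pi>) View_E / H_ent ?T (key \<pi>) > 1 - \<delta>"
    using sec unfolding secure_protocol_def Let_def by auto
  have n': "?n = (\<Sum>j<length (lens \<pi>). lens \<pi> ! j)" by (rule total_uses[OF valid])
  have fin: "finite (set_pmf ?T)" and card: "real (card (set_pmf ?T)) \<le> L ^ ?n"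
    using run_rounds_support[OF valid order_refl, of Wf Wb] unfolding run_def n' L_def
    by (auto simp del: of_nat_mult of_nat_power simp flip: of_nat_power)
  have cmi: "cmi ?T View_A View_B View_E \<le> ?n * C"
    using cmi_run_rounds_le[OF valid Cf Cb order_refl] unfolding run_def n' .
  define S where "S = (key \<pi> :: ('xf, 'yf, 'zf, 'xb, 'yb, 'zb) round_record list \<Rightarrow> nat)"
  define S' where "S' = (key_estimate \<pi> :: ('xf, 'yf, 'zf, 'xb, 'yb, 'zb) round_record list \<Rightarrow> nat)"
  have key: "H ?T (\<lambda>t. (S t, View_E t)) - H ?T View_E
      \<le> cmi ?T View_A View_B View_E + (H ?T (\<lambda>t. (S t, S' t)) - H ?T S')"
  proof (cases "key_party \<pi>")
    case Alice
    thus ?thesis by (intro H_key_le_cmi[OF fin, of _ "key_A \<pi>" _ _ "key_B \<pi>"])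
        (simp_all add: S_def S'_def key_def key_estimate_def party_key_def)
  next
    case Bob
    have "H ?T (\<lambda>t. (S t, View_E t)) - H ?T View_E
      \<le> cmi ?T View_B View_A View_E + (H ?T (\<lambda>t. (S t, S' t)) - H ?T S')"
      using Bob by (intro H_key_le_cmi[OF fin, of _ "key_B \<pi>" _ _ "key_A \<pi>"])
        (simp_all add: S_def S'_def key_def key_estimate_def party_key_def)
    thus ?thesis using cmi_commute[OF fin] by metis
  qed
  have L1: "1 \<le> L" unfolding L_def by (simp add: Suc_le_eq del: card_prod of_nat_mult)
  \<comment> \<open>The free weight in Fano's inequality is chosen as \<delta>, the bound on the
    error probability.\<close>
  have "H ?T (\<lambda>t. (S t, S' t)) - H ?T S'
    \<le> - log 2 (1 - \<delta>) + measure_pmf.prob ?T {t. S' t \<noteq> S t} * (log 2 (card (set_pmf ?T)) - log 2 \<delta>)"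
    using fin \<delta> by (intro fano) (auto intro: card_image_le)
  also have "\<dots> \<le> - log 2 (1 - \<delta>) + \<delta> * (?n * log 2 L - log 2 \<delta>)"
  proof (intro add_left_mono mult_mono)
    show "measure_pmf.prob ?T {t. S' t \<noteq> S t} \<le> \<delta>" using err by (simp add: S_def S'_def)
    have "0 < card (set_pmf ?T)" using fin by (simp add: card_gt_0_iff set_pmf_not_empty)
    hence "log 2 (card (set_pmf ?T)) \<le> log 2 (L ^ ?n)" using card by simp
    thus "log 2 (card (set_pmf ?T)) - log 2 \<delta> \<le> ?n * log 2 L - log 2 \<delta>"
      using L1 by (simp add: log_nat_power)
    have "0 \<le> log 2 (card (set_pmf ?T))" using \<open>0 < card (set_pmf ?T)\<close> by simp
    moreover have "log 2 \<delta> \<le> 0" using \<delta> by simp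
    ultimately show "0 \<le> log 2 (card (set_pmf ?T)) - log 2 \<delta>" by simp
  qed (use \<delta> in auto)
  \<comment> \<open>The constants \<open>- log 2 (1 - \<delta>)\<close> and
    \<open>- \<delta> * log 2 \<delta>\<close> are nonnegative and there is at least one channel
    use, so they may be multiplied by \<open>?n\<close>; afterwards \<open>?n\<close> is a common
    factor.\<close>
  also have "\<dots> \<le> ?n * (- log 2 (1 - \<delta>)) + ?n * (\<delta> * (log 2 L - log 2 \<delta>))"
  proof -
    have n1: "1 \<le> real ?n" using n by linarith
    have l: "0 \<le> - log 2 (1 - \<delta>)" "0 \<le> - log 2 \<delta>" using \<delta> by simp_all
    have "1 * (- log 2 (1 - \<delta>)) \<le> ?n * (- log 2 (1 - \<delta>))"
      by (rule mult_right_mono[OF n1 l(1)])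
    moreover have "1 * (\<delta> * (- log 2 \<delta>)) \<le> ?n * (\<delta> * (- log 2 \<delta>))"
      using \<delta> l by (intro mult_right_mono[OF n1] mult_nonneg_nonneg) auto
    ultimately show ?thesis by (simp add: algebra_simps)
  qed
  finally have fano: "H ?T (\<lambda>t. (S t, S' t)) - H ?T S' \<le> ?n * (- log 2 (1 - \<delta>) + \<delta> * (log 2 L - log 2 \<delta>))"
    by (simp add: algebra_simps)
  have Scond: "H_cond ?T S View_E = H ?T (\<lambda>t. (S t, View_E t)) - H ?T View_E"
    by (rule H_cond_eq[OF fin])
  have "H_ent ?T S * (1 - \<delta>) \<le> H_cond ?T S View_E"
  proof (cases "H_ent ?T S = 0")
    case True
    thus ?thesis unfolding Scond using H_mono[OF fin, of "\<lambda>t. (S t, View_E t)" View_E] by simp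
  next
    case False
    hence "0 < H_ent ?T S" using ent_nonneg[of "map_pmf S ?T"] unfolding H_ent_eq by simp
    thus ?thesis using leak False unfolding S_def by (simp add: field_simps)
  qed
  also have "\<dots> \<le> ?n * C + ?n * (- log 2 (1 - \<delta>) + \<delta> * (log 2 L - log 2 \<delta>))"
    unfolding Scond using key cmi fano by linarith
  finally have 1: "H_ent ?T S * (1 - \<delta>) \<le> ?n * (C - log 2 (1 - \<delta>) + \<delta> * (log 2 L - log 2 \<delta>))"
    by (simp add: algebra_simps)
  have "?n * ((R - \<delta>) * (1 - \<delta>)) \<le> H_ent ?T S * (1 - \<delta>)"
  proof -
    have "real ?n * (R - \<delta>) \<le> H_ent ?T S"
      using rate n unfolding S_def by (simp add: pos_less_divide_eq mult.commute del: of_nat_add)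
    thus ?thesis using \<delta> mult_right_mono[of "real ?n * (R - \<delta>)" "H_ent ?T S" "1 - \<delta>"]
      by (simp only: mult.assoc)
  qed
  also note 1
  finally show ?thesis using n by (simp only: of_nat_0_less_iff mult_le_cancel_left_pos)
qed

text \<open>Each \<delta> comes with its own protocol, but the bound depends on \<delta> alone. In
  the limit \<delta> to 0 from the right, \<open>\<delta> * log 2 \<delta>\<close> vanishes and R
  \<le> C remains.\<close>

lemma achievable_rate_le:
  fixes Wf :: "('xf::finite, 'yf::finite, 'zf::finite) dmbc"
    and Wb :: "('xb::finite, 'yb::finite, 'zb::finite) dmbc"
  assumes Cf: "\<And>P. gain snd P Wf \<le> C" and Cb: "\<And>P. gain snd P Wb \<le> C"
    and "achievable_rate Wf Wb R"
  shows "R \<le> C"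
proof -
  define L where "L = real (CARD('xf) * CARD('yf \<times> 'zf) * (CARD('xb) * CARD('yb \<times> 'zb)))"
  have "(R - \<delta>) * (1 - \<delta>) \<le> C - log 2 (1 - \<delta>) + \<delta> * (log 2 L - log 2 \<delta>)" if \<delta>: "0 < \<delta>" "\<delta> < 1" for \<delta>
  proof -
    obtain \<pi> where "secure_protocol Wf Wb R \<delta> \<pi>"
      using assms(3) \<delta> unfolding achievable_rate_def by (meson less_imp_le)
    from secure_rate_le[OF Cf Cb this \<delta>] show ?thesis unfolding L_def .
  qed
  hence "eventually (\<lambda>\<delta>. (R - \<delta>) * (1 - \<delta>) \<le> C - log 2 (1 - \<delta>) + \<delta> * (log 2 L - log 2 \<delta>)) (at_right 0)"
    unfolding eventually_at_right_field by (intro exI[of _ 1]) auto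
  moreover have "((\<lambda>\<delta>. (R - \<delta>) * (1 - \<delta>)) \<longlongrightarrow> R) (at_right 0)" by real_asymp
  moreover have "((\<lambda>\<delta>. C - log 2 (1 - \<delta>) + \<delta> * (log 2 L - log 2 \<delta>)) \<longlongrightarrow> C) (at_right 0)"
    unfolding log_def by real_asymp
  ultimately show ?thesis by (intro tendsto_le[of "at_right 0"]) auto
qed

section \<open>Degraded channels\<close>

lemma markov_chainD:
  assumes "markov_chain p X Y Z" and w: "w \<in> set_pmf p"
  shows "pmf (map_pmf (\<lambda>w. (X w, Z w, Y w)) p) (X w, Z w, Y w) * pmf (map_pmf Y p) (Y w) =
    pmf (map_pmf (\<lambda>w. (X w, Y w)) p) (X w, Y w) * pmf (map_pmf (\<lambda>w. (Z w, Y w)) p) (Z w, Y w)"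
proof -
  have pos: "0 < measure_pmf.prob p {w'. Y w' = Y w}"
    using pmf_map_pos[OF w, of Y] by (simp only: pmf_map_fiber)
  have "\<P>(w' in measure_pmf p. X w' = X w \<and> Z w' = Z w \<bar> Y w' = Y w) =
       \<P>(w' in measure_pmf p. X w' = X w \<bar> Y w' = Y w) * \<P>(w' in measure_pmf p. Z w' = Z w \<bar> Y w' = Y w)"
    using assms(1) unfolding markov_chain_def by blast
  thus ?thesis using pos unfolding cond_prob_def pmf_map vimage_def
    by (simp add: field_simps)
qed

text \<open>On the support all probabilities are positive, so the factorisation of
  \<open>markov_chainD\<close> may be turned into a sum of logarithms and averaged.\<close>

lemma cmi_markov_chain:
  assumes fin: "finite (set_pmf p)" and mc: "markov_chain p X Y Z"
  shows "cmi p X Z Y = 0"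
proof -
  have "E_pmf p (\<lambda>w. - log 2 (pmf (map_pmf (\<lambda>w. (X w, Z w, Y w)) p) (X w, Z w, Y w)) + - log 2 (pmf (map_pmf Y p) (Y w)))
      = E_pmf p (\<lambda>w. - log 2 (pmf (map_pmf (\<lambda>w. (X w, Y w)) p) (X w, Y w)) + - log 2 (pmf (map_pmf (\<lambda>w. (Z w, Y w)) p) (Z w, Y w)))"
  proof (rule E_pmf_cong)
    fix w assume w: "w \<in> set_pmf p"
    show "- log 2 (pmf (map_pmf (\<lambda>w. (X w, Z w, Y w)) p) (X w, Z w, Y w)) + - log 2 (pmf (map_pmf Y p) (Y w))
      = - log 2 (pmf (map_pmf (\<lambda>w. (X w, Y w)) p) (X w, Y w)) + - log 2 (pmf (map_pmf (\<lambda>w. (Z w, Y w)) p) (Z w, Y w))"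
      using arg_cong[OF markov_chainD[OF mc w], of "log 2"]
        pmf_map_pos[OF w, of "\<lambda>w. (X w, Z w, Y w)"] pmf_map_pos[OF w, of Y]
        pmf_map_pos[OF w, of "\<lambda>w. (X w, Y w)"] pmf_map_pos[OF w, of "\<lambda>w. (Z w, Y w)"]
      by (simp add: log_mult_pos)
  qed
  hence "H p (\<lambda>w. (X w, Z w, Y w)) + H p Y = H p (\<lambda>w. (X w, Y w)) + H p (\<lambda>w. (Z w, Y w))"
    unfolding H_eq_E_pmf using fin by (simp add: integrable_measure_pmf_finite)
  thus ?thesis by (simp add: cmi_def)
qed

lemma gain_reversely_degraded:
  fixes W :: "('x::finite, 'y::finite, 'z::finite) dmbc"
  assumes "reversely_degraded W"
  shows "gain snd P W = 0"
proof -
  have "cmi (joint P W) (\<lambda>(x, y, z). x) (\<lambda>(x, y, z). y) (\<lambda>(x, y, z). z) = 0"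
    using assms by (intro cmi_markov_chain) (simp_all add: reversely_degraded_def)
  thus ?thesis
    unfolding channel_I_cond_eq_gain[symmetric] channel_I_cond_def cmi_def by (simp add: I_cond_eq)
qed

text \<open>For a point mass at \<open>(xo, xr)\<close> the conditioning in the Markov chain is on
  an event of probability 1, so the chain says that the two outputs are independent for this very
  input.\<close>

lemma independent_subchannels_pair:
  assumes "independent_subchannels W WO WR"
  shows "map_pmf (\<lambda>((yo, yr), (zo, zr)). ((yo, zo), (yr, zr))) (W (xo, xr)) = pair_pmf (WO xo) (WR xr)"
proof (rule pmf_eqI)
  fix i :: "('c \<times> 'e) \<times> ('d \<times> 'f)"
  obtain a d where i: "i = (a, d)" by (cases i)
  let ?V = "W (xo, xr)"
  let ?\<pi> = "\<lambda>((yo, yr), (zo, zr)). (yo, zo)" and ?\<rho> = "\<lambda>((yo, yr), (zo, zr)). (yr, zr)"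
  have m: "map_pmf ?\<pi> ?V = WO xo" "map_pmf ?\<rho> ?V = WR xr"
    using assms unfolding independent_subchannels_def by auto
  have "markov_chain (joint (return_pmf (xo, xr)) W)
      (\<lambda>((xo, xr), (yo, yr), (zo, zr)). (yo, zo)) (\<lambda>((xo, xr), (yo, yr), (zo, zr)). xo)
      (\<lambda>w. ((\<lambda>((xo, xr), (yo, yr), (zo, zr)). xr) w, (\<lambda>((xo, xr), (yo, yr), (zo, zr)). (yr, zr)) w))"
    using assms unfolding independent_subchannels_def markov_chain4_def by blast
  moreover have "joint (return_pmf (xo, xr)) W = map_pmf (Pair (xo, xr)) ?V"
    by (simp add: joint_def bind_return_pmf)
  ultimately have "measure_pmf.prob ?V {v. ?\<pi> v = a \<and> ?\<rho> v = d}
      = measure_pmf.prob ?V {v. ?\<pi> v = a} * measure_pmf.prob ?V {v. ?\<rho> v = d}"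
    unfolding markov_chain_def cond_prob_def
    by (cases a; cases d) (auto simp: vimage_def case_prod_unfold dest!: spec[of _ "fst a"] spec[of _ "snd a"]
      spec[of _ xo] spec[of _ xr] spec[of _ "fst d"] spec[of _ "snd d"])
  moreover have "{v. ?\<pi> v = a \<and> ?\<rho> v = d} = (\<lambda>((yo, yr), (zo, zr)). ((yo, zo), (yr, zr))) -` {(a, d)}"
    by auto
  ultimately show "pmf (map_pmf (\<lambda>((yo, yr), (zo, zr)). ((yo, zo), (yr, zr))) ?V) i = pmf (pair_pmf (WO xo) (WR xr)) i"
    by (simp add: i pmf_pair pmf_map m[symmetric] vimage_def)
qed

lemma gain_degraded_le:
  fixes W :: "('xo::finite \<times> 'xr::finite, 'yo::finite \<times> 'yr::finite, 'zo::finite \<times> 'zr::finite) dmbc"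
  assumes "degraded_dmbc W WO WR"
  shows "gain snd P W \<le> gain snd (map_pmf fst P) WO"
proof -
  have ind: "independent_subchannels W WO WR" and rev: "reversely_degraded WR"
    using assms by (auto simp: degraded_dmbc_def)
  have "gain snd P W \<le> gain snd (map_pmf fst P) WO + gain snd (map_pmf snd P) WR"
  proof (rule gain_product_le)
    show "map_pmf (\<lambda>v. ((\<lambda>((yo, yr), (zo, zr)). (yo, zo)) v, (\<lambda>((yo, yr), (zo, zr)). (yr, zr)) v)) (W x)
        = pair_pmf (WO (fst x)) (WR (snd x))" for x
      using independent_subchannels_pair[OF ind, of "fst x" "snd x"] by (simp add: case_prod_unfold)
  qed (auto simp: inj_on_def)
  thus ?thesis by (simp add: gain_reversely_degraded[OF rev])
qed

section \<open>Existence of an optimal input distribution\<close>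

lemma continuous_on_entropy_term: "continuous_on {0..} (\<lambda>t::real. - (t * log 2 t))"
  unfolding continuous_on_eq_continuous_within
proof
  fix x :: real assume x: "x \<in> {0..}"
  show "continuous (at x within {0..}) (\<lambda>t. - (t * log 2 t))"
  proof (cases "x = 0")
    case True
    have "((\<lambda>t::real. - (t * log 2 t)) \<longlongrightarrow> 0) (at_right 0)"
      unfolding log_def by real_asymp
    thus ?thesis unfolding True continuous_within at_within_Ici_at_right by simp
  next
    case False
    hence "isCont (\<lambda>t. - (t * log 2 t)) x" using x by (intro continuous_intros) auto
    thus ?thesis by (rule continuous_at_imp_continuous_at_within)
  qed
qed

lemma ent_eq_sum_UNIV: "ent (q :: 'a::finite pmf) = (\<Sum>x\<in>UNIV. - (pmf q x * log 2 (pmf q x)))"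
proof -
  have "ent q = (\<Sum>x\<in>set_pmf q. - (pmf q x * log 2 (pmf q x)))"
    unfolding ent_def by (simp add: E_pmf_eq_sum sum_negf)
  also have "\<dots> = (\<Sum>x\<in>UNIV. - (pmf q x * log 2 (pmf q x)))"
    by (intro sum.mono_neutral_left) (auto simp: set_pmf_iff)
  finally show ?thesis .
qed

text \<open>Output probabilities are linear in the input weights, the entropy term is continuous on
  [0, \<infinity>) including 0, where outputs without mass end up, and the remaining term of
  \<open>gain\<close> is linear. So \<open>gain\<close> is continuous on the compact probability
  simplex.\<close>

lemma gain_attains_max:
  fixes W :: "('x::finite, 'y::finite, 'z::finite) dmbc"
  shows "\<exists>P. \<forall>Q. gain snd Q W \<le> gain snd P W"
proof -
  define \<phi> :: "real \<Rightarrow> real" where "\<phi> = (\<lambda>t. - (t * log 2 t))"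
  define WZ where "WZ = (\<lambda>x. map_pmf snd (W x))"
  define F :: "real ^ 'x \<Rightarrow> real" where "F = (\<lambda>v. (\<Sum>u\<in>UNIV. \<phi> (\<Sum>x\<in>UNIV. v $ x * pmf (W x) u))
    - (\<Sum>z\<in>UNIV. \<phi> (\<Sum>x\<in>UNIV. v $ x * pmf (WZ x) z))
    - (\<Sum>x\<in>UNIV. v $ x * (ent (W x) - H (W x) snd)))"
  define \<Delta> :: "(real ^ 'x) set" where "\<Delta> = {v. (\<forall>x. 0 \<le> v $ x) \<and> (\<Sum>x\<in>UNIV. v $ x) = 1}"
  have gain: "gain snd P W = F (\<chi> x. pmf P x)" for P
  proof -
    have E: "E_pmf P f = (\<Sum>x\<in>UNIV. pmf P x * f x)" for f
      by (subst integral_measure_pmf[of UNIV]) auto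
    have "map_pmf snd (bind_pmf P W) = bind_pmf P WZ" by (simp add: WZ_def map_bind_pmf)
    thus ?thesis unfolding gain_def F_def \<phi>_def ent_eq_sum_UNIV[of "bind_pmf P _"] E
      by (simp add: ent_eq_sum_UNIV[of "bind_pmf P WZ"] pmf_bind E)
  qed
  have "closed \<Delta>"
  proof -
    have "\<Delta> = (\<Inter>x. {v. 0 \<le> v $ x}) \<inter> {v. (\<Sum>x\<in>UNIV. v $ x) = 1}" by (auto simp: \<Delta>_def)
    moreover have "closed {v :: real ^ 'x. 0 \<le> v $ x}" for x
      by (intro closed_Collect_le continuous_intros)
    moreover have "closed {v :: real ^ 'x. (\<Sum>x\<in>UNIV. v $ x) = 1}"
      by (intro closed_Collect_eq continuous_intros)
    ultimately show ?thesis by (simp add: closed_INT closed_Int)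
  qed
  moreover have "bounded \<Delta>"
    unfolding bounded_iff
  proof (intro exI[of _ 1] ballI)
    fix v assume "v \<in> \<Delta>"
    thus "norm v \<le> 1" using norm_le_l1_cart[of v] by (simp add: \<Delta>_def)
  qed
  ultimately have "compact \<Delta>" by (simp add: compact_eq_bounded_closed)
  \<comment> \<open>Any distribution at all shows that the simplex is nonempty.\<close>
  moreover have "(\<chi> x. pmf undefined x) \<in> \<Delta>"
    by (auto simp: \<Delta>_def intro: sum_pmf_eq_1)
  moreover have "continuous_on \<Delta> F"
    unfolding F_def \<phi>_def
    by (intro continuous_intros continuous_on_compose2[OF continuous_on_entropy_term])
       (auto simp: \<Delta>_def intro!: sum_nonneg mult_nonneg_nonneg)
  ultimately obtain v where v: "v \<in> \<Delta>" "\<And>w. w \<in> \<Delta> \<Longrightarrow> F w \<le> F v"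
    using continuous_attains_sup[of \<Delta> F] by auto
  define P where "P = embed_pmf (\<lambda>x. v $ x)"
  have "pmf P x = v $ x" for x
    unfolding P_def using v(1)
    by (intro pmf_embed_pmf) (auto simp: \<Delta>_def nn_integral_count_space_finite)
  hence "(\<chi> x. pmf P x) = v" by (simp add: vec_eq_iff)
  moreover have "(\<chi> x. pmf Q x) \<in> \<Delta>" for Q
    by (auto simp: \<Delta>_def intro: sum_pmf_eq_1)
  ultimately show ?thesis unfolding gain using v(2) by metis
qed

section \<open>Random wiretap codes\<close>

lemma E_pmf_of_set: "finite A \<Longrightarrow> A \<noteq> {} \<Longrightarrow> E_pmf (pmf_of_set A) f = (\<Sum>x\<in>A. f x) / card A"
  by (rule integral_pmf_of_set)

lemma E_pmf_attained:
  assumes "finite (set_pmf p)" "E_pmf p f \<le> r"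
  shows "\<exists>x\<in>set_pmf p. f x \<le> r"
proof (rule ccontr)
  assume neg: "\<not> ?thesis"
  define m where "m = Min (f ` set_pmf p)"
  have "m \<in> f ` set_pmf p" unfolding m_def using assms(1) set_pmf_not_empty by (intro Min_in) auto
  hence "r < m" using neg by auto
  also have "m = E_pmf p (\<lambda>_. m)" by simp
  also have "\<dots> \<le> E_pmf p f" unfolding m_def using assms(1) by (intro E_pmf_mono) auto
  finally show False using assms(2) by simp
qed

lemma finite_set_Pi_pmf:
  assumes "finite I" "finite (set_pmf P)"
  shows "finite (set_pmf (Pi_pmf I d (\<lambda>_. P)))"
  using assms by (intro finite_subset[OF set_Pi_pmf_subset'] finite_PiE_dflt) auto

text \<open>The random coding averages involve at most two codewords at a time, so pairwise
  independence is what has to be extracted from the product law.\<close>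

lemma Pi_pmf_component2:
  assumes "finite I" "m \<in> I" "m' \<in> I" "m \<noteq> m'"
  shows "map_pmf (\<lambda>c. (c m, c m')) (Pi_pmf I d (\<lambda>_. P)) = pair_pmf P P"
proof -
  let ?J = "I - {m}"
  have "Pi_pmf I d (\<lambda>_. P) = Pi_pmf (insert m ?J) d (\<lambda>_. P)" using assms by (simp add: insert_absorb)
  also have "\<dots> = map_pmf (\<lambda>(y, f). f(m := y)) (pair_pmf P (Pi_pmf ?J d (\<lambda>_. P)))"
    using assms by (intro Pi_pmf_insert) auto
  finally have "map_pmf (\<lambda>c. (c m, c m')) (Pi_pmf I d (\<lambda>_. P))
      = map_pmf (\<lambda>(y, f). (y, f m')) (pair_pmf P (Pi_pmf ?J d (\<lambda>_. P)))"
    using assms(4) by (simp add: pmf.map_comp o_def case_prod_unfold)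
  also have "\<dots> = pair_pmf (map_pmf (\<lambda>y. y) P) (map_pmf (\<lambda>f. f m') (Pi_pmf ?J d (\<lambda>_. P)))"
    by (simp only: map_pair)
  also have "\<dots> = pair_pmf P P" using assms by (simp add: Pi_pmf_component)
  finally show ?thesis .
qed

text \<open>The common form of both averages: \<open>A\<close> is the cost of the chosen codeword
  alone and \<open>B\<close> its interaction with another one. It serves the union bound for the
  decoder and the tangent bound for the leakage.\<close>

lemma E_random_code:
  assumes I: "finite I" "m \<in> I" "U \<subseteq> I" and P: "finite (set_pmf P)"
  shows "E_pmf (Pi_pmf I d (\<lambda>_. P)) (\<lambda>c. A (c m) + (\<Sum>m'\<in>U - {m}. B (c m) (c m')))
    = E_pmf P A + card (U - {m}) * E_pmf P (\<lambda>x. E_pmf P (B x))"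
proof -
  let ?C = "Pi_pmf I d (\<lambda>_. P)"
  have fin: "finite (set_pmf ?C)" using I P by (intro finite_set_Pi_pmf)
  have "E_pmf ?C (\<lambda>c. A (c m)) = E_pmf (map_pmf (\<lambda>c. c m) ?C) A" by simp
  also have "\<dots> = E_pmf P A" using I by (simp add: Pi_pmf_component del: integral_map_pmf)
  finally have 1: "E_pmf ?C (\<lambda>c. A (c m)) = E_pmf P A" .
  have 2: "E_pmf ?C (\<lambda>c. B (c m) (c m')) = E_pmf P (\<lambda>x. E_pmf P (B x))" if "m' \<in> U - {m}" for m'
  proof -
    have "E_pmf ?C (\<lambda>c. B (c m) (c m')) = E_pmf (map_pmf (\<lambda>c. (c m, c m')) ?C) (\<lambda>(x, x'). B x x')" by simp
    also have "\<dots> = E_pmf (pair_pmf P P) (\<lambda>(x, x'). B x x')"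
      using that I by (subst Pi_pmf_component2) auto
    finally show ?thesis using P by (simp add: E_pmf_pair)
  qed
  show ?thesis
    unfolding E_pmf_add[OF fin] E_pmf_sum[OF fin] 1 using 2 by simp
qed

text \<open>Change of measure: on \<open>A\<close> the law \<open>q\<close> is at most
  \<open>w / \<theta>\<close>, and \<open>w\<close> has total mass at most 1.\<close>

lemma prob_ratio_le:
  assumes fin: "finite (set_pmf q)" and \<theta>: "0 < \<theta>" and le: "\<And>y. y \<in> A \<Longrightarrow> \<theta> * pmf q y \<le> pmf w y"
  shows "measure_pmf.prob q A \<le> 1 / \<theta>"
proof -
  have "\<theta> * measure_pmf.prob q A = \<theta> * (\<Sum>y\<in>A \<inter> set_pmf q. pmf q y)"
    using fin by (simp add: measure_measure_pmf_finite[symmetric] measure_Int_set_pmf)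
  also have "\<dots> \<le> (\<Sum>y\<in>A \<inter> set_pmf q. pmf w y)"
    unfolding sum_distrib_left using le by (intro sum_mono) auto
  also have "\<dots> \<le> 1"
    using fin by (metis finite_Int measure_measure_pmf_finite measure_pmf.prob_le_1)
  finally show ?thesis using \<theta> by (simp add: field_simps)
qed

text \<open>If no message or more than one passes the test, \<open>THE\<close> yields an unspecified
  value; the error bound below includes all such outputs.\<close>

definition threshold_decoder :: "('x \<Rightarrow> 'y \<Rightarrow> bool) \<Rightarrow> 'm set \<Rightarrow> ('m \<Rightarrow> 'x) \<Rightarrow> 'y \<Rightarrow> 'm" where
  "threshold_decoder g I c y = (THE m. m \<in> I \<and> g (c m) y)"

lemma threshold_decoder_error:
  assumes "finite I" "m \<in> I"
  shows "measure_pmf.prob (W (c m)) {y. threshold_decoder g I c y \<noteq> m}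
    \<le> measure_pmf.prob (W (c m)) {y. \<not> g (c m) y}
      + (\<Sum>m'\<in>I - {m}. measure_pmf.prob (W (c m)) {y. g (c m') y})"
proof -
  have "{y. threshold_decoder g I c y \<noteq> m} \<subseteq> {y. \<not> g (c m) y} \<union> (\<Union>m'\<in>I - {m}. {y. g (c m') y})"
  proof
    fix y assume y: "y \<in> {y. threshold_decoder g I c y \<noteq> m}"
    show "y \<in> {y. \<not> g (c m) y} \<union> (\<Union>m'\<in>I - {m}. {y. g (c m') y})"
    proof (rule ccontr)
      assume "\<not> ?thesis"
      hence "threshold_decoder g I c y = m"
        unfolding threshold_decoder_def using assms by (intro the_equality) auto
      thus False using y by simp
    qed
  qed
  hence "measure_pmf.prob (W (c m)) {y. threshold_decoder g I c y \<noteq> m}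
    \<le> measure_pmf.prob (W (c m)) ({y. \<not> g (c m) y} \<union> (\<Union>m'\<in>I - {m}. {y. g (c m') y}))"
    by (intro measure_pmf.finite_measure_mono) auto
  also have "\<dots> \<le> measure_pmf.prob (W (c m)) {y. \<not> g (c m) y}
      + measure_pmf.prob (W (c m)) (\<Union>m'\<in>I - {m}. {y. g (c m') y})"
    by (intro measure_Un_le) auto
  also have "measure_pmf.prob (W (c m)) (\<Union>m'\<in>I - {m}. {y. g (c m') y})
      \<le> (\<Sum>m'\<in>I - {m}. measure_pmf.prob (W (c m)) {y. g (c m') y})"
    using assms by (intro measure_UNION_le) auto
  finally show ?thesis by simp
qed

text \<open>The two error events are that the sent codeword fails the test and that some other one
  passes. A wrong codeword is independent of the output and passes with probability at most
  \<open>1 / \<theta>\<close>.\<close>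

lemma random_code_error:
  fixes W :: "'x \<Rightarrow> 'y pmf"
  assumes I: "finite I" "I \<noteq> {}" and P: "finite (set_pmf P)"
    and W: "\<And>x. x \<in> set_pmf P \<Longrightarrow> finite (set_pmf (W x))" and \<theta>: "0 < \<theta>"
  defines "g \<equiv> \<lambda>x y. \<theta> * pmf (bind_pmf P W) y < pmf (W x) y"
  shows "E_pmf (Pi_pmf I d (\<lambda>_. P)) (\<lambda>c. E_pmf (pmf_of_set I)
      (\<lambda>m. measure_pmf.prob (W (c m)) {y. threshold_decoder g I c y \<noteq> m}))
    \<le> E_pmf P (\<lambda>x. measure_pmf.prob (W x) {y. \<not> g x y}) + card I / \<theta>"
proof -
  let ?C = "Pi_pmf I d (\<lambda>_. P)" and ?Q = "bind_pmf P W"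
  let ?e = "\<lambda>c m. measure_pmf.prob (W (c m)) {y. threshold_decoder g I c y \<noteq> m}"
  let ?a = "E_pmf P (\<lambda>x. measure_pmf.prob (W x) {y. \<not> g x y})"
  have finC: "finite (set_pmf ?C)" using I P by (intro finite_set_Pi_pmf)
  have finQ: "finite (set_pmf ?Q)" using P W by auto
  have finI: "finite (set_pmf (pmf_of_set I))" using I by simp
  have m: "E_pmf ?C (\<lambda>c. ?e c m) \<le> ?a + card I / \<theta>" if m: "m \<in> I" for m
  proof -
    have "E_pmf ?C (\<lambda>c. ?e c m) \<le> E_pmf ?C (\<lambda>c. measure_pmf.prob (W (c m)) {y. \<not> g (c m) y}
        + (\<Sum>m'\<in>I - {m}. measure_pmf.prob (W (c m)) {y. g (c m') y}))"
      by (rule E_pmf_mono[OF finC threshold_decoder_error[OF I(1) m]])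
    also have "\<dots> = ?a + card (I - {m}) * E_pmf P (\<lambda>x. E_pmf P (\<lambda>x'. measure_pmf.prob (W x) {y. g x' y}))"
      by (rule E_random_code[OF I(1) m subset_refl P])
    also have "E_pmf P (\<lambda>x. E_pmf P (\<lambda>x'. measure_pmf.prob (W x) {y. g x' y})) \<le> 1 / \<theta>"
    proof -
      \<comment> \<open>Averaging over the sent codeword first replaces its output law by
        \<open>?Q\<close>, to which the change of measure applies for every fixed
        \<open>x'\<close>.\<close>
      have "E_pmf P (\<lambda>x. E_pmf P (\<lambda>x'. measure_pmf.prob (W x) {y. g x' y}))
          = E_pmf P (\<lambda>x'. E_pmf P (\<lambda>x. measure_pmf.prob (W x) {y. g x' y}))"
        by (rule E_pmf_swap[OF P P])
      also have "\<dots> = E_pmf P (\<lambda>x'. measure_pmf.prob ?Q {y. g x' y})"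
        by (intro E_pmf_cong) (simp only: prob_eq_E_pmf E_pmf_bind[OF P W])
      also have "\<dots> \<le> E_pmf P (\<lambda>_. 1 / \<theta>)"
      proof (rule E_pmf_mono[OF P])
        fix x'
        show "measure_pmf.prob ?Q {y. g x' y} \<le> 1 / \<theta>"
          by (rule prob_ratio_le[OF finQ \<theta>, of _ "W x'"]) (simp add: g_def)
      qed
      finally show ?thesis by simp
    qed
    also have "card (I - {m}) * (1 / \<theta>) \<le> card I / \<theta>"
      using \<theta> I card_mono[of I "I - {m}"] by (auto simp: divide_right_mono)
    finally show ?thesis using \<theta> by (simp add: mult_left_mono)
  qed
  have "E_pmf ?C (\<lambda>c. E_pmf (pmf_of_set I) (?e c)) = E_pmf (pmf_of_set I) (\<lambda>m. E_pmf ?C (\<lambda>c. ?e c m))"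
    by (rule E_pmf_swap[OF finC finI])
  also have "\<dots> \<le> E_pmf (pmf_of_set I) (\<lambda>_. ?a + card I / \<theta>)"
    using I m by (intro E_pmf_mono[OF finI]) auto
  finally show ?thesis by simp
qed

section \<open>Leakage to the eavesdropper\<close>

definition rel_ent :: "'z pmf \<Rightarrow> 'z pmf \<Rightarrow> real" where
  "rel_ent p q = E_pmf p (\<lambda>z. log 2 (pmf p z / pmf q z))"

lemma rel_ent_eq:
  assumes "finite (set_pmf p)" "set_pmf p \<subseteq> set_pmf q"
  shows "rel_ent p q = E_pmf p (\<lambda>z. - log 2 (pmf q z)) - ent p"
  unfolding rel_ent_def ent_def E_pmf_diff[OF assms(1), symmetric]
  by (rule E_pmf_cong) (use assms in \<open>auto simp: log_divide_pos pmf_positive subset_iff\<close>)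

lemma rel_ent_nonneg:
  assumes "finite (set_pmf p)" "set_pmf p \<subseteq> set_pmf q"
  shows "0 \<le> rel_ent p q"
  using gibbs_pmf[OF assms] by (simp add: rel_ent_eq[OF assms])

lemma log2_tangent_le:
  assumes "0 < t" "0 < a"
  shows "log 2 t \<le> log 2 a + (t - a) / (a * ln 2)"
proof -
  have "log 2 t = log 2 a + log 2 (t / a)" using assms by (simp add: log_divide_pos)
  also have "log 2 (t / a) \<le> (t / a - 1) / ln 2" using assms by (intro log2_le) simp
  also have "\<dots> = (t - a) / (a * ln 2)" using assms by (simp add: field_simps)
  finally show ?thesis by simp
qed

text \<open>Eve's output law when the message is uniform on \<open>U\<close>; for
  \<open>U = {s} \<times> {..<Mu}\<close> it is her law given the secret \<open>s\<close>.\<close>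

definition subcode_output :: "('x \<Rightarrow> 'z pmf) \<Rightarrow> 'm set \<Rightarrow> ('m \<Rightarrow> 'x) \<Rightarrow> 'z pmf" where
  "subcode_output W U c = bind_pmf (pmf_of_set U) (\<lambda>m. W (c m))"

text \<open>Soft covering. The tangent of the logarithm at \<open>a\<close>, the conditional expectation bound
  given the codeword \<open>c m\<close>, makes the expectation linear in the other codewords.\<close>

lemma random_code_leakage:
  fixes W :: "'x \<Rightarrow> 'z pmf"
  assumes I: "finite I" "U \<subseteq> I" "U \<noteq> {}" and P: "finite (set_pmf P)"
    and W: "\<And>x. x \<in> set_pmf P \<Longrightarrow> finite (set_pmf (W x))"
  defines "Q \<equiv> bind_pmf P W"
  shows "E_pmf (Pi_pmf I d (\<lambda>_. P)) (\<lambda>c. rel_ent (subcode_output W U c) Q)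
    \<le> E_pmf P (\<lambda>x. E_pmf (W x) (\<lambda>z. log 2 (1 + pmf (W x) z / (card U * pmf Q z))))"
proof -
  let ?C = "Pi_pmf I d (\<lambda>_. P)"
  \<comment> \<open>Given that codeword \<open>m\<close> is \<open>x\<close>, the mean ratio of the
    subcode's output law to \<open>Q\<close> at \<open>z\<close> is the displayed fraction, from
    \<open>m\<close> itself, plus \<open>(card U - 1) / card U\<close> from the others;
    \<open>a\<close> rounds the latter up to 1. \<open>A\<close> and \<open>B\<close> are the
    constant and the linear part of the tangent bound at \<open>a\<close>.\<close>
  define a where "a = (\<lambda>x z. 1 + pmf (W x) z / (card U * pmf Q z))"
  define A where "A = (\<lambda>x. E_pmf (W x) (\<lambda>z. log 2 (a x z) - 1 / (a x z * ln 2)))"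
  define B where "B = (\<lambda>x x'. E_pmf (W x) (\<lambda>z. pmf (W x') z / (card U * pmf Q z) / (a x z * ln 2)))"
  have U: "finite U" "0 < card U" using I finite_subset by (auto simp: card_gt_0_iff)
  have finC: "finite (set_pmf ?C)" using I P by (intro finite_set_Pi_pmf)
  have a1: "1 \<le> a x z" for x z by (simp add: a_def)
  have inP: "c m \<in> set_pmf P" if "c \<in> set_pmf ?C" "m \<in> U" for c m
    using set_Pi_pmf_subset'[OF I(1), of d "\<lambda>_. P"] that I by (auto simp: PiE_dflt_def)
  have Qpos: "0 < pmf Q z" if "x \<in> set_pmf P" "z \<in> set_pmf (W x)" for x z
    using that by (auto simp: Q_def intro!: pmf_positive)
  have bound: "rel_ent (subcode_output W U c) Q
      \<le> E_pmf (pmf_of_set U) (\<lambda>m. A (c m) + (\<Sum>m'\<in>U - {m}. B (c m) (c m')))" if c: "c \<in> set_pmf ?C" for c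
  proof -
    let ?p = "subcode_output W U c"
    have p: "pmf ?p z = (\<Sum>m\<in>U. pmf (W (c m)) z) / card U" for z
      unfolding subcode_output_def using I U by (intro pmf_bind_pmf_of_set) auto
    have "rel_ent ?p Q = E_pmf (pmf_of_set U) (\<lambda>m. E_pmf (W (c m)) (\<lambda>z. log 2 (pmf ?p z / pmf Q z)))"
      unfolding rel_ent_def subcode_output_def using I U W inP[OF c] by (intro E_pmf_bind) auto
    also have "\<dots> \<le> E_pmf (pmf_of_set U) (\<lambda>m. A (c m) + (\<Sum>m'\<in>U - {m}. B (c m) (c m')))"
    proof (rule E_pmf_mono)
      fix m assume "m \<in> set_pmf (pmf_of_set U)"
      hence m: "m \<in> U" using I U by simp
      note fW = W[OF inP[OF c m]]
      let ?x = "c m"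
      have "E_pmf (W ?x) (\<lambda>z. log 2 (pmf ?p z / pmf Q z)) \<le> E_pmf (W ?x) (\<lambda>z.
          (log 2 (a ?x z) - 1 / (a ?x z * ln 2)) + (\<Sum>m'\<in>U - {m}. pmf (W (c m')) z / (card U * pmf Q z) / (a ?x z * ln 2)))"
      proof (rule E_pmf_mono[OF fW])
        fix z assume z: "z \<in> set_pmf (W ?x)"
        let ?t = "pmf ?p z / pmf Q z" and ?s = "\<Sum>m'\<in>U - {m}. pmf (W (c m')) z"
        have q: "0 < pmf Q z" by (rule Qpos[OF inP[OF c m] z])
        have sum: "(\<Sum>m\<in>U. pmf (W (c m)) z) = pmf (W ?x) z + ?s"
          using U m by (simp add: sum.remove)
        have t: "?t = a ?x z + (?s / (card U * pmf Q z) - 1)"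
          unfolding p sum a_def by (simp add: add_divide_distrib)
        have "0 < pmf (W ?x) z + ?s"
          using z by (intro add_pos_nonneg sum_nonneg) (auto intro: pmf_positive)
        hence "0 < ?t" unfolding p sum using U q by simp
        hence "log 2 ?t \<le> log 2 (a ?x z) + (?t - a ?x z) / (a ?x z * ln 2)"
          using a1[of ?x z] by (intro log2_tangent_le) auto
        also have "(?t - a ?x z) / (a ?x z * ln 2) = ?s / (card U * pmf Q z) / (a ?x z * ln 2) - 1 / (a ?x z * ln 2)"
          unfolding t by (simp add: diff_divide_distrib)
        finally show "log 2 ?t \<le> (log 2 (a ?x z) - 1 / (a ?x z * ln 2))
            + (\<Sum>m'\<in>U - {m}. pmf (W (c m')) z / (card U * pmf Q z) / (a ?x z * ln 2))"
          by (simp add: sum_divide_distrib)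
      qed
      also have "\<dots> = A ?x + (\<Sum>m'\<in>U - {m}. B ?x (c m'))"
        unfolding A_def B_def E_pmf_add[OF fW] E_pmf_sum[OF fW] ..
      finally show "E_pmf (W ?x) (\<lambda>z. log 2 (pmf ?p z / pmf Q z)) \<le> A ?x + (\<Sum>m'\<in>U - {m}. B ?x (c m'))" .
    qed (use I U in simp)
    finally show ?thesis .
  qed
  have "E_pmf ?C (\<lambda>c. rel_ent (subcode_output W U c) Q)
      \<le> E_pmf ?C (\<lambda>c. E_pmf (pmf_of_set U) (\<lambda>m. A (c m) + (\<Sum>m'\<in>U - {m}. B (c m) (c m'))))"
    by (rule E_pmf_mono[OF finC bound])
  also have "\<dots> = E_pmf (pmf_of_set U) (\<lambda>m. E_pmf ?C (\<lambda>c. A (c m) + (\<Sum>m'\<in>U - {m}. B (c m) (c m'))))"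
    using finC U I by (intro E_pmf_swap) auto
  also have "\<dots> = E_pmf (pmf_of_set U) (\<lambda>m. E_pmf P A + (card U - 1) * E_pmf P (\<lambda>x. E_pmf P (B x)))"
  proof (rule E_pmf_cong)
    fix m assume "m \<in> set_pmf (pmf_of_set U)"
    hence m: "m \<in> U" using I U by simp
    show "E_pmf ?C (\<lambda>c. A (c m) + (\<Sum>m'\<in>U - {m}. B (c m) (c m'))) = E_pmf P A + (card U - 1) * E_pmf P (\<lambda>x. E_pmf P (B x))"
      using E_random_code[OF I(1) _ I(2) P, of m d A B] m I(2) by auto
  qed
  also have "\<dots> = E_pmf P (\<lambda>x. A x + (card U - 1) * E_pmf P (B x))"
    using P by (simp add: E_pmf_add integrable_measure_pmf_finite)
  also have "\<dots> \<le> E_pmf P (\<lambda>x. E_pmf (W x) (\<lambda>z. log 2 (a x z)))"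
  proof (rule E_pmf_mono[OF P])
    fix x assume x: "x \<in> set_pmf P"
    have "E_pmf P (B x) = E_pmf (W x) (\<lambda>z. E_pmf P (\<lambda>x'. pmf (W x') z / (card U * pmf Q z) / (a x z * ln 2)))"
      unfolding B_def by (rule E_pmf_swap[OF P W[OF x]])
    also have "\<dots> = E_pmf (W x) (\<lambda>z. 1 / (card U * (a x z * ln 2)))"
    proof (rule E_pmf_cong)
      fix z assume "z \<in> set_pmf (W x)"
      hence q: "0 < pmf Q z" by (rule Qpos[OF x])
      have "E_pmf P (\<lambda>x'. pmf (W x') z / (card U * pmf Q z) / (a x z * ln 2)) = pmf Q z / (card U * pmf Q z) / (a x z * ln 2)"
        unfolding Q_def pmf_bind by simp
      thus "E_pmf P (\<lambda>x'. pmf (W x') z / (card U * pmf Q z) / (a x z * ln 2)) = 1 / (card U * (a x z * ln 2))"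
        using q by simp
    qed
    finally have "A x + (card U - 1) * E_pmf P (B x) = E_pmf (W x) (\<lambda>z. (log 2 (a x z) - 1 / (a x z * ln 2))
        + (card U - 1) * (1 / (card U * (a x z * ln 2))))"
      unfolding A_def E_pmf_add[OF W[OF x]] by (simp only: integral_mult_right_zero)
    also have "\<dots> \<le> E_pmf (W x) (\<lambda>z. log 2 (a x z))"
    proof (rule E_pmf_mono[OF W[OF x]])
      fix z
      \<comment> \<open>The other codewords add back at most the amount
        \<open>1 / (a x z * ln 2)\<close> that \<open>A\<close> subtracts, so only the logarithm
        survives.\<close>
      have "real (card U - 1) * (1 / (card U * (a x z * ln 2))) = real (card U - 1) / card U * (1 / (a x z * ln 2))" by simp
      also have "\<dots> \<le> 1 * (1 / (a x z * ln 2))"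
        using a1[of x z] U by (intro mult_right_mono) auto
      finally show "(log 2 (a x z) - 1 / (a x z * ln 2)) + real (card U - 1) * (1 / (card U * (a x z * ln 2))) \<le> log 2 (a x z)" by simp
    qed
    finally show "A x + (card U - 1) * E_pmf P (B x) \<le> E_pmf (W x) (\<lambda>z. log 2 (a x z))" .
  qed
  finally show ?thesis unfolding a_def .
qed

lemma random_wiretap_code_exists:
  fixes WY :: "'x \<Rightarrow> 'y pmf" and WZ :: "'x \<Rightarrow> 'z pmf" and Ms Mu :: nat
  defines "I \<equiv> {..<Ms} \<times> {..<Mu}"
  assumes P: "finite (set_pmf P)"
    and WY: "\<And>x. x \<in> set_pmf P \<Longrightarrow> finite (set_pmf (WY x))"
    and WZ: "\<And>x. x \<in> set_pmf P \<Longrightarrow> finite (set_pmf (WZ x))"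
    and pos: "0 < Ms" "0 < Mu" "0 < \<theta>" "0 < a" "0 < b"
    and a: "E_pmf P (\<lambda>x. measure_pmf.prob (WY x) {y. pmf (WY x) y \<le> \<theta> * pmf (bind_pmf P WY) y}) + real Ms * real Mu / \<theta> \<le> a"
    and b: "E_pmf P (\<lambda>x. E_pmf (WZ x) (\<lambda>z. log 2 (1 + pmf (WZ x) z / (Mu * pmf (bind_pmf P WZ) z)))) \<le> b"
  shows "\<exists>c dec. (\<forall>m\<in>I. c m \<in> set_pmf P) \<and>
    E_pmf (pmf_of_set I) (\<lambda>m. measure_pmf.prob (WY (c m)) {y. dec y \<noteq> m}) \<le> 2 * a \<and>
    E_pmf (pmf_of_set {..<Ms}) (\<lambda>s. rel_ent (subcode_output WZ ({s} \<times> {..<Mu}) c) (bind_pmf P WZ)) \<le> 2 * b"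
proof -
  let ?C = "Pi_pmf I undefined (\<lambda>_. P)" and ?QY = "bind_pmf P WY" and ?QZ = "bind_pmf P WZ"
  define dec where "dec = threshold_decoder (\<lambda>x y. \<theta> * pmf ?QY y < pmf (WY x) y) I"
  define e where "e = (\<lambda>c. E_pmf (pmf_of_set I) (\<lambda>m. measure_pmf.prob (WY (c m)) {y. dec c y \<noteq> m}))"
  define D where "D = (\<lambda>c. E_pmf (pmf_of_set {..<Ms}) (\<lambda>s. rel_ent (subcode_output WZ ({s} \<times> {..<Mu}) c) ?QZ))"
  have I: "finite I" "I \<noteq> {}" "card I = Ms * Mu" using pos by (auto simp: I_def)
  have S: "{..<Ms} \<noteq> {}" using pos by auto
  have finC: "finite (set_pmf ?C)" using I P by (intro finite_set_Pi_pmf)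
  have finS: "finite (set_pmf (pmf_of_set {..<Ms}))" using S by simp
  have inP: "c m \<in> set_pmf P" if "c \<in> set_pmf ?C" "m \<in> I" for c m
    using set_Pi_pmf_subset'[OF I(1), of undefined "\<lambda>_. P"] that by (cases m) (auto simp: PiE_dflt_def)
  have "E_pmf ?C e \<le> a"
    using random_code_error[where W = WY and d = undefined, OF I(1,2) P WY pos(3)] a
    unfolding e_def dec_def I(3) by (simp add: not_less)
  moreover have "E_pmf ?C D \<le> b"
  proof -
    have "E_pmf ?C D = E_pmf (pmf_of_set {..<Ms}) (\<lambda>s. E_pmf ?C (\<lambda>c. rel_ent (subcode_output WZ ({s} \<times> {..<Mu}) c) ?QZ))"
      unfolding D_def by (rule E_pmf_swap[OF finC finS])
    also have "\<dots> \<le> E_pmf (pmf_of_set {..<Ms}) (\<lambda>_. b)"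
    proof (rule E_pmf_mono[OF finS])
      fix s assume "s \<in> set_pmf (pmf_of_set {..<Ms})"
      hence "s < Ms" using S by simp
      hence sub: "{s} \<times> {..<Mu} \<subseteq> I" "{s} \<times> {..<Mu} \<noteq> {}" using pos by (auto simp: I_def)
      have "card ({s} \<times> {..<Mu}) = Mu" by (simp add: card_cartesian_product_singleton)
      thus "E_pmf ?C (\<lambda>c. rel_ent (subcode_output WZ ({s} \<times> {..<Mu}) c) ?QZ) \<le> b"
        using random_code_leakage[where W = WZ and d = undefined, OF I(1) sub P WZ] b by simp
    qed
    finally show ?thesis by simp
  qed
  ultimately have "E_pmf ?C e / a \<le> 1" "E_pmf ?C D / b \<le> 1" using pos by simp_all
  \<comment> \<open>One code must be good for both receivers. After scaling by their bounds the two
    costs have mean sum at most 2; some code attains this, and since both costs are nonnegative,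
    neither exceeds twice its bound.\<close>
  hence "E_pmf ?C (\<lambda>c. e c / a + D c / b) \<le> 2" using finC by (simp add: E_pmf_add)
  then obtain c where c: "c \<in> set_pmf ?C" "e c / a + D c / b \<le> 2" using E_pmf_attained[OF finC] by blast
  have "0 \<le> e c" unfolding e_def by (intro integral_nonneg_AE) auto
  moreover have "0 \<le> D c"
    unfolding D_def
  proof (intro integral_nonneg_AE, unfold AE_measure_pmf_iff, intro ballI rel_ent_nonneg)
    fix s assume "s \<in> set_pmf (pmf_of_set {..<Ms})"
    hence s: "s < Ms" using S by simp
    have ne: "{s} \<times> {..<Mu} \<noteq> {}" using pos by auto
    have inP': "c m \<in> set_pmf P" if "m \<in> {s} \<times> {..<Mu}" for m using inP[OF c(1), of m] s that by (auto simp: I_def)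
    show "finite (set_pmf (subcode_output WZ ({s} \<times> {..<Mu}) c))"
      using inP' WZ ne by (auto simp: subcode_output_def)
    show "set_pmf (subcode_output WZ ({s} \<times> {..<Mu}) c) \<subseteq> set_pmf ?QZ"
      using inP' ne by (auto simp: subcode_output_def)
  qed
  ultimately have "e c / a \<le> 2" "D c / b \<le> 2" using c(2) pos
    by (smt (verit) divide_nonneg_pos)+
  hence "e c \<le> 2 * a" "D c \<le> 2 * b" using pos by (simp_all add: field_simps)
  moreover have "\<forall>m\<in>I. c m \<in> set_pmf P" using inP[OF c(1)] by blast
  ultimately show ?thesis unfolding e_def D_def by blast
qed

lemma pmf_of_set_Times:
  assumes "finite A" "A \<noteq> {}" "finite B" "B \<noteq> {}"
  shows "pmf_of_set (A \<times> B) = pair_pmf (pmf_of_set A) (pmf_of_set B)"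
proof (rule pmf_eqI)
  fix i :: "'a \<times> 'b"
  obtain a b where i: "i = (a, b)" by (cases i)
  have "A \<times> B \<noteq> {}" "finite (A \<times> B)" using assms by auto
  thus "pmf (pmf_of_set (A \<times> B)) i = pmf (pair_pmf (pmf_of_set A) (pmf_of_set B)) i"
    unfolding i pmf_pair pmf_of_set[OF assms(2,1)] pmf_of_set[OF assms(4,3)]
    by (simp add: indicator_times card_cartesian_product)
qed

text \<open>Messages sharing a codeword share the output law, so their success probabilities add up
  to at most 1. Hence the total success over all messages is at most the number of distinct
  codewords, while the right inverse recovers one message for each of them.\<close>

lemma inverse_encoder_error:
  fixes W :: "'x \<Rightarrow> 'y pmf" and dec :: "'y \<Rightarrow> 'm"
  assumes I: "finite I" "I \<noteq> {}"
  shows "measure_pmf.prob (pmf_of_set I) {m. inv_into I c (c m) \<noteq> m}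
    \<le> E_pmf (pmf_of_set I) (\<lambda>m. measure_pmf.prob (W (c m)) {y. dec y \<noteq> m})"
proof -
  have comp: "measure_pmf.prob (W (c m)) {y. dec y \<noteq> m} = 1 - measure_pmf.prob (W (c m)) {y. dec y = m}" for m
    using measure_pmf.prob_compl[of "{y. dec y = m}" "W (c m)"] by (simp add: Compl_eq_Diff_UNIV[symmetric] Collect_neg_eq)
  have "(\<Sum>m\<in>I. measure_pmf.prob (W (c m)) {y. dec y = m})
      = (\<Sum>x\<in>c ` I. \<Sum>m\<in>{m\<in>I. c m = x}. measure_pmf.prob (W (c m)) {y. dec y = m})"
    using I(1) by (rule sum.image_gen)
  also have "\<dots> \<le> (\<Sum>x\<in>c ` I. 1)"
  proof (rule sum_mono)
    fix x
    have "(\<Sum>m\<in>{m\<in>I. c m = x}. measure_pmf.prob (W (c m)) {y. dec y = m})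
        = (\<Sum>m\<in>{m\<in>I. c m = x}. measure_pmf.prob (W x) {y. dec y = m})"
      by (rule sum.cong) auto
    also have "\<dots> = measure_pmf.prob (W x) (\<Union>m\<in>{m\<in>I. c m = x}. {y. dec y = m})"
      using I by (intro measure_pmf.finite_measure_finite_Union[symmetric]) (auto simp: disjoint_family_on_def)
    finally show "(\<Sum>m\<in>{m\<in>I. c m = x}. measure_pmf.prob (W (c m)) {y. dec y = m}) \<le> 1" by simp
  qed
  also have "\<dots> = card (c ` I)" by simp
  finally have 1: "(\<Sum>m\<in>I. measure_pmf.prob (W (c m)) {y. dec y = m}) \<le> card (c ` I)" .
  have "inj_on (inv_into I c) (c ` I)" by (rule inj_on_inv_into) simp
  hence "card (c ` I) = card (inv_into I c ` c ` I)" by (simp add: card_image)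
  also have "\<dots> \<le> card {m\<in>I. inv_into I c (c m) = m}"
    using I by (intro card_mono) (auto intro: inv_into_into simp: f_inv_into_f[of "c _" c I])
  finally have 2: "card (c ` I) \<le> card {m\<in>I. inv_into I c (c m) = m}" .
  have "card I = card {m\<in>I. inv_into I c (c m) = m} + card {m\<in>I. inv_into I c (c m) \<noteq> m}"
    using I by (subst card_Un_disjoint[symmetric]) (auto intro: arg_cong[where f = card])
  with 1 2 have "card {m\<in>I. inv_into I c (c m) \<noteq> m} \<le> card I - (\<Sum>m\<in>I. measure_pmf.prob (W (c m)) {y. dec y = m})"
    by simp
  also have "\<dots> = (\<Sum>m\<in>I. measure_pmf.prob (W (c m)) {y. dec y \<noteq> m})"
    by (simp add: comp sum_subtractf)
  finally show ?thesis using I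
    by (simp add: E_pmf_of_set measure_pmf_of_set divide_right_mono Collect_conj_eq[symmetric] Int_def)
qed

text \<open>\<open>J\<close> keeps the message actually drawn, \<open>G\<close> only codeword and
  output. With M the drawn secret, H(S | Z) \<ge> H(M | Z) - H(M | S): soft covering bounds the
  first term, and Fano's inequality the second, as \<open>S\<close> differs from M with probability
  at most \<open>e\<close>.\<close>

lemma wiretap_code_entropy:
  fixes K :: "'x \<Rightarrow> 'o pmf" and \<eta> :: "'o \<Rightarrow> 'y" and \<zeta> :: "'o \<Rightarrow> 'z" and Ms Mu :: nat
  defines "I \<equiv> {..<Ms} \<times> {..<Mu}" and "WY \<equiv> \<lambda>x. map_pmf \<eta> (K x)" and "WZ \<equiv> \<lambda>x. map_pmf \<zeta> (K x)"
  assumes pos: "0 < Ms" "0 < Mu"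
    and K: "\<And>x. x \<in> set_pmf P \<Longrightarrow> finite (set_pmf (K x))"
    and c: "\<And>m. m \<in> I \<Longrightarrow> c m \<in> set_pmf P"
    and err: "E_pmf (pmf_of_set I) (\<lambda>m. measure_pmf.prob (WY (c m)) {y. dec y \<noteq> m}) \<le> e"
    and leak: "E_pmf (pmf_of_set {..<Ms}) (\<lambda>s. rel_ent (subcode_output WZ ({s} \<times> {..<Mu}) c) (bind_pmf P WZ)) \<le> l"
  defines "G \<equiv> bind_pmf (map_pmf c (pmf_of_set I)) (\<lambda>x. map_pmf (Pair x) (K x))"
  defines "S \<equiv> \<lambda>(x, v). fst (inv_into I c x)" and "S' \<equiv> \<lambda>(x, v). fst (dec (\<eta> v))"
  shows "measure_pmf.prob G {w. S' w \<noteq> S w} \<le> 2 * e"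
    and "H G S \<le> log 2 Ms"
    and "log 2 Ms - l - 1 - e * (log 2 Ms + 1) \<le> H G (\<lambda>w. (S w, \<zeta> (snd w))) - H G (\<lambda>w. \<zeta> (snd w))"
proof -
  define J where "J = bind_pmf (pmf_of_set I) (\<lambda>m. map_pmf (Pair m) (K (c m)))"
  have I: "finite I" "I \<noteq> {}" using pos by (auto simp: I_def)
  have Sne: "{..<Ms} \<noteq> {}" "{..<Mu} \<noteq> {}" using pos by auto
  have setI: "set_pmf (pmf_of_set I) = I" using I by simp
  have G: "G = map_pmf (\<lambda>(m, v). (c m, v)) J"
    by (simp add: G_def J_def map_bind_pmf bind_map_pmf pmf.map_comp o_def)
  have Kc: "finite (set_pmf (K (c m)))" if "m \<in> I" for m using K c that by auto
  have finJ: "finite (set_pmf J)" unfolding J_def using I Kc by auto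
  have finG: "finite (set_pmf G)" using finJ by (simp add: G)
  have J_fst: "measure_pmf.prob J {w. A (fst w)} = measure_pmf.prob (pmf_of_set I) {m. A m}" for A
  proof -
    have "map_pmf fst J = pmf_of_set I" by (simp add: J_def map_bind_pmf pmf.map_comp o_def map_pmf_const bind_return_pmf')
    hence "measure_pmf.prob (pmf_of_set I) {m. A m} = measure_pmf.prob (map_pmf fst J) {m. A m}" by simp
    thus ?thesis by (simp add: vimage_def)
  qed
  have err_inv: "measure_pmf.prob J {w. inv_into I c (c (fst w)) \<noteq> fst w} \<le> e"
    using inverse_encoder_error[OF I, of c WY dec] err J_fst[of "\<lambda>m. inv_into I c (c m) \<noteq> m"] by simp
  have err_dec: "measure_pmf.prob J {w. dec (\<eta> (snd w)) \<noteq> fst w} \<le> e"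
  proof -
    have "measure_pmf.prob J {w. dec (\<eta> (snd w)) \<noteq> fst w}
        = E_pmf (pmf_of_set I) (\<lambda>m. E_pmf (map_pmf (Pair m) (K (c m))) (indicator {w. dec (\<eta> (snd w)) \<noteq> fst w}))"
      unfolding prob_eq_E_pmf J_def using I Kc by (intro E_pmf_bind) auto
    also have "\<dots> = E_pmf (pmf_of_set I) (\<lambda>m. measure_pmf.prob (WY (c m)) {y. dec y \<noteq> m})"
      unfolding WY_def prob_eq_E_pmf integral_map_pmf by (simp add: indicator_def)
    finally show ?thesis using err by simp
  qed
  have "measure_pmf.prob G {w. S' w \<noteq> S w}
      = measure_pmf.prob J {w. fst (dec (\<eta> (snd w))) \<noteq> fst (inv_into I c (c (fst w)))}"
    by (simp add: G S_def S'_def vimage_def case_prod_unfold)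
  also have "\<dots> \<le> measure_pmf.prob J ({w. inv_into I c (c (fst w)) \<noteq> fst w} \<union> {w. dec (\<eta> (snd w)) \<noteq> fst w})"
    by (intro measure_pmf.finite_measure_mono) auto
  also have "\<dots> \<le> measure_pmf.prob J {w. inv_into I c (c (fst w)) \<noteq> fst w} + measure_pmf.prob J {w. dec (\<eta> (snd w)) \<noteq> fst w}"
    by (intro measure_Un_le) auto
  finally show "measure_pmf.prob G {w. S' w \<noteq> S w} \<le> 2 * e" using err_inv err_dec by simp
  have S_lt: "S w < Ms" if w: "w \<in> set_pmf G" for w
  proof -
    obtain m where "m \<in> I" "fst w = c m" using w setI by (auto simp: G_def)
    hence "inv_into I c (fst w) \<in> I" by (auto intro: inv_into_into)
    thus ?thesis by (auto simp: S_def I_def case_prod_unfold)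
  qed
  show "H G S \<le> log 2 Ms"
    using ent_le_log_card[of "{..<Ms}" "map_pmf S G"] S_lt by (simp add: image_subset_iff)
  let ?M = "\<lambda>w. fst (fst w)" and ?S = "\<lambda>w. fst (inv_into I c (c (fst w)))" and ?Z = "\<lambda>w. \<zeta> (snd w)"
  have GS: "H G (\<lambda>w. (S w, \<zeta> (snd w))) = H J (\<lambda>w. (?S w, ?Z w))" "H G (\<lambda>w. \<zeta> (snd w)) = H J ?Z"
    unfolding G pmf.map_comp o_def by (simp_all add: S_def case_prod_unfold)
  \<comment> \<open>Weight 1/2 makes the additive constant of Fano's inequality exactly one
    bit.\<close>
  have "H J (\<lambda>w. (?M w, ?S w)) - H J ?S
      \<le> - log 2 (1 - 1 / 2) + measure_pmf.prob J {w. ?S w \<noteq> ?M w} * (log 2 Ms - log 2 (1 / 2))"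
  proof -
    have "?M ` set_pmf J \<subseteq> {..<Ms}"
    proof (rule image_subsetI)
      fix w assume "w \<in> set_pmf J"
      hence "fst w \<in> I" unfolding J_def using setI by force
      thus "?M w \<in> {..<Ms}" unfolding I_def by auto
    qed
    hence "card (?M ` set_pmf J) \<le> Ms" using card_mono[of "{..<Ms}" "?M ` set_pmf J"] by simp
    thus ?thesis using fano[OF finJ, of "1 / 2" ?M Ms ?S] by simp
  qed
  also have "\<dots> \<le> 1 + e * (log 2 Ms + 1)"
  proof -
    have "measure_pmf.prob J {w. ?S w \<noteq> ?M w} \<le> e"
      by (rule order_trans[OF measure_pmf.finite_measure_mono err_inv]) auto
    thus ?thesis using pos by (simp add: log_divide_pos mult_right_mono)
  qed
  finally have fano: "H J (\<lambda>w. (?M w, ?S w)) - H J ?S \<le> 1 + e * (log 2 Ms + 1)" .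
  have sub: "H J (\<lambda>w. (?M w, ?Z w, ?S w)) + H J ?S \<le> H J (\<lambda>w. (?M w, ?S w)) + H J (\<lambda>w. (?Z w, ?S w))"
    by (rule H_submodular[OF finJ])
  have mono: "H J (\<lambda>w. (?M w, ?Z w)) \<le> H J (\<lambda>w. (?M w, ?Z w, ?S w))" by (rule H_mono[OF finJ]) auto
  have swap: "H J (\<lambda>w. (?Z w, ?S w)) = H J (\<lambda>w. (?S w, ?Z w))" by (rule H_cong[OF finJ]) auto
  have leak': "log 2 Ms - l \<le> H J (\<lambda>w. (?M w, ?Z w)) - H J ?Z"
  proof -
    let ?p = "\<lambda>s. subcode_output WZ ({s} \<times> {..<Mu}) c" and ?Q = "bind_pmf P WZ"
    have sub_out: "?p s = bind_pmf (pmf_of_set {..<Mu}) (\<lambda>u. WZ (c (s, u)))" for s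
      using Sne unfolding subcode_output_def
      by (simp add: pmf_of_set_Times pmf_of_set_singleton pair_pmf_def bind_return_pmf bind_assoc_pmf)
    have law: "map_pmf (\<lambda>w. (?M w, ?Z w)) J = bind_pmf (pmf_of_set {..<Ms}) (\<lambda>s. map_pmf (Pair s) (?p s))"
      unfolding J_def I_def sub_out using Sne
      by (simp add: pmf_of_set_Times pair_pmf_def map_bind_pmf bind_assoc_pmf bind_return_pmf pmf.map_comp o_def WZ_def)
    have finp: "finite (set_pmf (?p s))" and subp: "set_pmf (?p s) \<subseteq> set_pmf ?Q" if "s < Ms" for s
    proof -
      have set: "set_pmf (?p s) = (\<Union>u\<in>{..<Mu}. set_pmf (WZ (c (s, u))))"
        unfolding sub_out using Sne by simp
      have cP: "c (s, u) \<in> set_pmf P" if "u \<in> {..<Mu}" for u using c \<open>s < Ms\<close> that by (simp add: I_def)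
      show "finite (set_pmf (?p s))" unfolding set using cP K by (auto simp: WZ_def)
      show "set_pmf (?p s) \<subseteq> set_pmf ?Q" unfolding set set_bind_pmf using cP by blast
    qed
    have finS: "finite (set_pmf (pmf_of_set {..<Ms}))" using Sne by simp
    have setS: "set_pmf (pmf_of_set {..<Ms}) = {..<Ms}" using Sne by simp
    have lawZ: "map_pmf ?Z J = bind_pmf (pmf_of_set {..<Ms}) ?p"
      using arg_cong[OF law, of "map_pmf snd"] by (simp add: pmf.map_comp o_def map_bind_pmf)
    have "H J (\<lambda>w. (?M w, ?Z w)) = ent (pmf_of_set {..<Ms}) + E_pmf (pmf_of_set {..<Ms}) (\<lambda>s. ent (?p s))"
      unfolding law using finp setS finS by (intro ent_bind_Pair) auto
    moreover have "ent (pmf_of_set {..<Ms}) = log 2 Ms"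
    proof -
      have "ent (pmf_of_set {..<Ms}) = E_pmf (pmf_of_set {..<Ms}) (\<lambda>_. log 2 Ms)"
        unfolding ent_def using Sne setS by (intro E_pmf_cong) (simp add: log_divide_pos)
      thus ?thesis by simp
    qed
    \<comment> \<open>By Gibbs' inequality the fixed law \<open>?Q\<close> may replace Eve's actual
      output law. The cross entropy then splits over \<open>s\<close>, and I(M; Z) is at most the
      mean of the divergences that \<open>leak\<close> bounds.\<close>
    moreover have "H J ?Z \<le> E_pmf (pmf_of_set {..<Ms}) (\<lambda>s. E_pmf (?p s) (\<lambda>z. - log 2 (pmf ?Q z)))"
    proof -
      have "H J ?Z \<le> E_pmf (map_pmf ?Z J) (\<lambda>z. - log 2 (pmf ?Q z))"
        using finp subp setS by (intro gibbs_pmf) (auto simp: lawZ simp del: set_map_pmf)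
      also have "\<dots> = E_pmf (pmf_of_set {..<Ms}) (\<lambda>s. E_pmf (?p s) (\<lambda>z. - log 2 (pmf ?Q z)))"
        unfolding lawZ using finp setS finS by (intro E_pmf_bind) auto
      finally show ?thesis .
    qed
    moreover have "E_pmf (pmf_of_set {..<Ms}) (\<lambda>s. E_pmf (?p s) (\<lambda>z. - log 2 (pmf ?Q z)) - ent (?p s)) \<le> l"
    proof -
      have "E_pmf (pmf_of_set {..<Ms}) (\<lambda>s. E_pmf (?p s) (\<lambda>z. - log 2 (pmf ?Q z)) - ent (?p s))
          = E_pmf (pmf_of_set {..<Ms}) (\<lambda>s. rel_ent (?p s) ?Q)"
        using setS by (intro E_pmf_cong rel_ent_eq[symmetric] finp subp) auto
      thus ?thesis using leak by simp
    qed
    ultimately show ?thesis unfolding E_pmf_diff[OF finS] by linarith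
  qed
  show "log 2 Ms - l - 1 - e * (log 2 Ms + 1) \<le> H G (\<lambda>w. (S w, \<zeta> (snd w))) - H G (\<lambda>w. \<zeta> (snd w))"
    unfolding GS using fano sub mono swap leak' by linarith
qed

section \<open>Information density of memoryless channels\<close>

text \<open>The mutual information I(X; V), written as the mean divergence of the conditional from
  the average output law, hence as the mean of the information density.\<close>

definition info :: "'x pmf \<Rightarrow> ('x \<Rightarrow> 'v pmf) \<Rightarrow> real" where
  "info P V = E_pmf P (\<lambda>x. rel_ent (V x) (bind_pmf P V))"

lemma info_eq:
  assumes P: "finite (set_pmf P)" and V: "\<And>x. x \<in> set_pmf P \<Longrightarrow> finite (set_pmf (V x))"
  shows "info P V = ent (bind_pmf P V) - E_pmf P (\<lambda>x. ent (V x))"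
proof -
  have "info P V = E_pmf P (\<lambda>x. E_pmf (V x) (\<lambda>v. - log 2 (pmf (bind_pmf P V) v)) - ent (V x))"
    unfolding info_def by (intro E_pmf_cong rel_ent_eq V) auto
  also have "\<dots> = ent (bind_pmf P V) - E_pmf P (\<lambda>x. ent (V x))"
    using E_pmf_bind[where K = V, OF P V] unfolding E_pmf_diff[OF P] ent_def[of "bind_pmf P V"] by simp
  finally show ?thesis .
qed

lemma info_nonneg:
  assumes "finite (set_pmf P)" "\<And>x. x \<in> set_pmf P \<Longrightarrow> finite (set_pmf (V x))"
  shows "0 \<le> info P V"
  unfolding info_def using assms
  by (intro integral_nonneg_AE, unfold AE_measure_pmf_iff) (auto intro!: rel_ent_nonneg)

text \<open>Allows any output type, so that Bob's and Eve's marginal channels can be treated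
  separately; for pairs it coincides with \<open>transmit\<close>.\<close>

primrec memoryless :: "('x \<Rightarrow> 'v pmf) \<Rightarrow> 'x list \<Rightarrow> 'v list pmf" where
  "memoryless V [] = return_pmf []"
| "memoryless V (x # xs) = map_pmf (\<lambda>(a, l). a # l) (pair_pmf (V x) (memoryless V xs))"

lemma map_memoryless: "map_pmf (map h) (memoryless V xs) = memoryless (\<lambda>x. map_pmf h (V x)) xs"
proof (induction xs)
  case (Cons x xs)
  have "map_pmf (map h) (memoryless V (x # xs)) =
      map_pmf (\<lambda>(a, l). a # l) (map_pmf (\<lambda>(a, l). (h a, map h l)) (pair_pmf (V x) (memoryless V xs)))"
    by (simp add: pmf.map_comp o_def case_prod_unfold)
  thus ?case by (simp add: map_pair Cons.IH)
qed simp

lemma transmit_eq_memoryless: "transmit W xs = memoryless W xs"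
  by (induction xs) (simp_all only: transmit_Cons memoryless.simps transmit.simps)

lemma replicate_pmf_Suc: "replicate_pmf (Suc n) p = map_pmf (\<lambda>(a, l). a # l) (pair_pmf p (replicate_pmf n p))"
  by (simp add: pair_pmf_def map_bind_pmf)

lemma bind_replicate_memoryless: "bind_pmf (replicate_pmf n P) (memoryless V) = replicate_pmf n (bind_pmf P V)"
proof (induction n)
  case (Suc n)
  have "bind_pmf (replicate_pmf (Suc n) P) (memoryless V)
      = bind_pmf P (\<lambda>x. bind_pmf (replicate_pmf n P) (\<lambda>xs. bind_pmf (V x) (\<lambda>a. bind_pmf (memoryless V xs) (\<lambda>l. return_pmf (a # l)))))"
    by (simp add: bind_assoc_pmf bind_return_pmf pair_pmf_def map_bind_pmf)
  also have "\<dots> = bind_pmf P (\<lambda>x. bind_pmf (V x) (\<lambda>a. bind_pmf (replicate_pmf n P) (\<lambda>xs. bind_pmf (memoryless V xs) (\<lambda>l. return_pmf (a # l)))))"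
    by (subst bind_commute_pmf) (rule refl)
  also have "\<dots> = replicate_pmf (Suc n) (bind_pmf P V)"
    by (simp add: bind_assoc_pmf Suc.IH[symmetric])
  finally show ?case .
qed (simp add: bind_return_pmf)

lemma pmf_map_Cons: "pmf (map_pmf (\<lambda>(a, l). a # l) (pair_pmf p q)) (b # m) = pmf p b * pmf q m"
proof -
  have "inj (\<lambda>(a :: 'a, l). a # l)" by (auto simp: inj_def)
  from pmf_map_inj'[OF this, of "pair_pmf p q" "(b, m)"] show ?thesis by (simp add: pmf_pair)
qed

lemma pmf_memoryless: "pmf (memoryless V (map fst l)) (map snd l) = (\<Prod>(x, v)\<leftarrow>l. pmf (V x) v)"
  by (induction l) (auto simp: pmf_map_Cons)

lemma pmf_replicate: "pmf (replicate_pmf (length l) p) l = (\<Prod>v\<leftarrow>l. pmf p v)"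
  by (induction l) (simp_all add: replicate_pmf_Suc pmf_map_Cons del: replicate_pmf.simps(2))

lemma set_memoryless: "ys \<in> set_pmf (memoryless V xs) \<Longrightarrow> list_all2 (\<lambda>x y. y \<in> set_pmf (V x)) xs ys"
  by (induction xs arbitrary: ys) auto

lemma finite_set_memoryless: "(\<And>x. x \<in> set xs \<Longrightarrow> finite (set_pmf (V x))) \<Longrightarrow> finite (set_pmf (memoryless V xs))"
  by (induction xs) auto

lemma finite_set_replicate_pmf: "finite (set_pmf p) \<Longrightarrow> finite (set_pmf (replicate_pmf n p))"
  by (induction n) auto

text \<open>Zipping the input block with its output block gives i.i.d. pairs, for which the block
  information density is a sum of independent terms.\<close>

lemma E_memoryless:
  fixes V :: "'x \<Rightarrow> 'v pmf"
  assumes P: "finite (set_pmf P)" and V: "\<And>x. x \<in> set_pmf P \<Longrightarrow> finite (set_pmf (V x))"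
  defines "J \<equiv> bind_pmf P (\<lambda>x. map_pmf (Pair x) (V x))"
  shows "E_pmf (replicate_pmf n P) (\<lambda>xs. E_pmf (memoryless V xs) (F xs))
    = E_pmf (replicate_pmf n J) (\<lambda>l. F (map fst l) (map snd l))"
proof -
  let ?K = "\<lambda>x. map_pmf (Pair x) (V x)"
  have K: "finite (set_pmf (memoryless ?K xs))" if "xs \<in> set_pmf (replicate_pmf n P)" for xs
    using that V by (intro finite_set_memoryless) (auto simp: set_replicate_pmf)
  have "E_pmf (replicate_pmf n J) (\<lambda>l. F (map fst l) (map snd l))
      = E_pmf (replicate_pmf n P) (\<lambda>xs. E_pmf (memoryless ?K xs) (\<lambda>l. F (map fst l) (map snd l)))"
    unfolding J_def bind_replicate_memoryless[symmetric]
    by (intro E_pmf_bind finite_set_replicate_pmf P K)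
  also have "\<dots> = E_pmf (replicate_pmf n P) (\<lambda>xs. E_pmf (memoryless ?K xs) (\<lambda>l. F xs (map snd l)))"
  proof (intro E_pmf_cong)
    fix xs l assume "l \<in> set_pmf (memoryless ?K xs)"
    hence "list_all2 (\<lambda>x y. y \<in> set_pmf (?K x)) xs l" by (rule set_memoryless)
    hence "map fst l = xs" by induction auto
    thus "F (map fst l) (map snd l) = F xs (map snd l)" by simp
  qed
  also have "\<dots> = E_pmf (replicate_pmf n P) (\<lambda>xs. E_pmf (map_pmf (map snd) (memoryless ?K xs)) (F xs))"
    by simp
  also have "\<dots> = E_pmf (replicate_pmf n P) (\<lambda>xs. E_pmf (memoryless V xs) (F xs))"
    unfolding map_memoryless pmf.map_comp o_def by (simp add: o_def)
  finally show ?thesis ..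
qed

text \<open>In the square of the sum the cross term averages to 0 by the first claim for the shorter
  list; therefore both claims share one induction.\<close>

lemma replicate_pmf_moments:
  assumes fin: "finite (set_pmf q)" and mean: "E_pmf q d = 0"
  shows "E_pmf (replicate_pmf n q) (\<lambda>l. \<Sum>x\<leftarrow>l. d x) = 0"
    and "E_pmf (replicate_pmf n q) (\<lambda>l. (\<Sum>x\<leftarrow>l. d x)\<^sup>2) = n * E_pmf q (\<lambda>x. (d x)\<^sup>2)"
proof (induction n)
  let ?D = "\<lambda>l. \<Sum>x\<leftarrow>l. d x"
  case (Suc n)
  let ?r = "replicate_pmf n q"
  have finr: "finite (set_pmf ?r)" using fin by (rule finite_set_replicate_pmf)
  have step: "E_pmf (replicate_pmf (Suc n) q) f = E_pmf q (\<lambda>a. E_pmf ?r (\<lambda>l. f (a # l)))" for f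
    unfolding replicate_pmf_Suc using fin finr by (simp add: E_pmf_pair)
  {
    case 1
    have "E_pmf (replicate_pmf (Suc n) q) ?D = E_pmf q (\<lambda>a. d a + E_pmf ?r ?D)"
      unfolding step using finr by (simp add: E_pmf_add)
    also have "\<dots> = 0" using fin mean Suc by (simp add: E_pmf_add)
    finally show ?case .
  next
    case 2
    have "E_pmf (replicate_pmf (Suc n) q) (\<lambda>l. (?D l)\<^sup>2)
        = E_pmf q (\<lambda>a. E_pmf ?r (\<lambda>l. (d a)\<^sup>2 + 2 * d a * ?D l + (?D l)\<^sup>2))"
      unfolding step by (simp add: power2_sum algebra_simps)
    also have "\<dots> = E_pmf q (\<lambda>a. (d a)\<^sup>2 + 2 * d a * E_pmf ?r ?D + E_pmf ?r (\<lambda>l. (?D l)\<^sup>2))"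
      using finr by (simp add: E_pmf_add integrable_measure_pmf_finite)
    also have "\<dots> = E_pmf q (\<lambda>a. (d a)\<^sup>2) + n * E_pmf q (\<lambda>x. (d x)\<^sup>2)"
      using fin Suc by (simp add: E_pmf_add)
    finally show ?case by (simp add: algebra_simps)
  }
qed simp_all

definition info_variance :: "'x pmf \<Rightarrow> ('x \<Rightarrow> 'v pmf) \<Rightarrow> real" where
  "info_variance P V = E_pmf (bind_pmf P (\<lambda>x. map_pmf (Pair x) (V x)))
    (\<lambda>w. (log 2 (pmf (V (fst w)) (snd w) / pmf (bind_pmf P V) (snd w)) - info P V)\<^sup>2)"

lemma info_variance_nonneg: "0 \<le> info_variance P V"
  unfolding info_variance_def by (intro integral_nonneg_AE) auto

text \<open>The block likelihood ratio is 2 to the power \<open>n * info P V + D\<close>, with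
  \<open>D\<close> a centred sum of second moment \<open>n * v\<close>. The lower tail is
  Chebyshev's inequality. For the excess, log(1 + 2^D) \<le> 1 + |D|, and the mean of |D| is of
  order sqrt n.\<close>

lemma
  fixes V :: "'x \<Rightarrow> 'v pmf" and n :: nat and \<epsilon> M :: real
  assumes P: "finite (set_pmf P)" and V: "\<And>x. x \<in> set_pmf P \<Longrightarrow> finite (set_pmf (V x))" and n: "0 < n"
  defines "Pn \<equiv> replicate_pmf n P" and "Qn \<equiv> bind_pmf (replicate_pmf n P) (memoryless V)"
  shows info_density_lower_tail: "0 < \<epsilon> \<Longrightarrow> E_pmf Pn (\<lambda>xs. measure_pmf.prob (memoryless V xs)
      {vs. pmf (memoryless V xs) vs \<le> 2 powr (real n * (info P V - \<epsilon>)) * pmf Qn vs})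
      \<le> info_variance P V / (n * \<epsilon>\<^sup>2)"
    and info_density_excess: "2 powr (real n * info P V) \<le> M \<Longrightarrow> E_pmf Pn (\<lambda>xs. E_pmf (memoryless V xs)
      (\<lambda>vs. log 2 (1 + pmf (memoryless V xs) vs / (M * pmf Qn vs)))) \<le> 1 + (info_variance P V + 1) * sqrt n"
proof -
  define Q where "Q = bind_pmf P V"
  define J where "J = bind_pmf P (\<lambda>x. map_pmf (Pair x) (V x))"
  define \<iota> where "\<iota> = (\<lambda>w. log 2 (pmf (V (fst w)) (snd w) / pmf Q (snd w)))"
  define d where "d = (\<lambda>w. \<iota> w - info P V)"
  define D where "D = (\<lambda>l. \<Sum>w\<leftarrow>l. d w)"
  define v where "v = E_pmf J (\<lambda>w. (d w)\<^sup>2)"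
  have finJ: "finite (set_pmf J)" using P V by (auto simp: J_def)
  have "E_pmf J \<iota> = info P V"
    unfolding J_def info_def rel_ent_def \<iota>_def Q_def[symmetric]
    using P V by (subst E_pmf_bind) auto
  hence mean: "E_pmf J d = 0" using finJ by (simp add: d_def E_pmf_diff)
  have v: "info_variance P V = v"
    unfolding info_variance_def v_def d_def \<iota>_def J_def Q_def ..
  have D2: "E_pmf (replicate_pmf n J) (\<lambda>l. (D l)\<^sup>2) = n * v"
    unfolding D_def v_def by (rule replicate_pmf_moments(2)[OF finJ mean])
  have finJn: "finite (set_pmf (replicate_pmf n J))" using finJ by (rule finite_set_replicate_pmf)
  have ratio: "0 < pmf Qn (map snd l)" (is ?A)
    "pmf (memoryless V (map fst l)) (map snd l) = 2 powr (n * info P V + D l) * pmf Qn (map snd l)" (is ?B)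
    if l: "l \<in> set_pmf (replicate_pmf n J)" for l
  proof -
    have len: "length l = n" and J: "\<And>w. w \<in> set l \<Longrightarrow> w \<in> set_pmf J" using l by (auto simp: set_replicate_pmf)
    have q: "pmf Qn (map snd l) = (\<Prod>w\<leftarrow>l. pmf Q (snd w))"
      unfolding Qn_def bind_replicate_memoryless Q_def using pmf_replicate[of "map snd l"] len
      by (simp add: o_def)
    have pos: "0 < pmf Q (snd w)" "0 < pmf (V (fst w)) (snd w)" if "w \<in> set_pmf J" for w
      using that by (auto simp: J_def Q_def intro!: pmf_positive)
    have "(\<Prod>w\<leftarrow>l. pmf (V (fst w)) (snd w)) = 2 powr (length l * info P V + D l) * (\<Prod>w\<leftarrow>l. pmf Q (snd w))
      \<and> 0 < (\<Prod>w\<leftarrow>l. pmf Q (snd w))"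
      using J
    proof (induction l)
      case (Cons w l)
      have "pmf (V (fst w)) (snd w) = 2 powr (\<iota> w) * pmf Q (snd w)"
        using pos[of w] Cons.prems by (simp add: \<iota>_def case_prod_unfold)
      also have "\<iota> w = info P V + d w" by (simp add: d_def)
      finally have w: "pmf (V (fst w)) (snd w) = 2 powr (info P V + d w) * pmf Q (snd w)" .
      show ?case using Cons pos[of w]
        by (simp add: w D_def powr_add[symmetric] algebra_simps)
    qed (simp add: D_def)
    thus ?A ?B using q len by (simp_all add: pmf_memoryless case_prod_unfold)
  qed
  {
    assume \<epsilon>: "0 < \<epsilon>"
    let ?\<theta> = "2 powr (real n * (info P V - \<epsilon>))"
    have "E_pmf Pn (\<lambda>xs. measure_pmf.prob (memoryless V xs) {vs. pmf (memoryless V xs) vs \<le> ?\<theta> * pmf Qn vs})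
      = E_pmf (replicate_pmf n J) (\<lambda>l. indicator {vs. pmf (memoryless V (map fst l)) vs \<le> ?\<theta> * pmf Qn vs} (map snd l))"
      unfolding prob_eq_E_pmf Pn_def J_def by (rule E_memoryless[where V = V, OF P V])
    also have "\<dots> \<le> E_pmf (replicate_pmf n J) (\<lambda>l. (D l)\<^sup>2 / (n * \<epsilon>)\<^sup>2)"
    proof (rule E_pmf_mono[OF finJn])
      fix l assume l: "l \<in> set_pmf (replicate_pmf n J)"
      note r = ratio[OF l]
      show "indicator {vs. pmf (memoryless V (map fst l)) vs \<le> ?\<theta> * pmf Qn vs} (map snd l) \<le> (D l)\<^sup>2 / (n * \<epsilon>)\<^sup>2"
      proof (cases "pmf (memoryless V (map fst l)) (map snd l) \<le> ?\<theta> * pmf Qn (map snd l)")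
        case True
        hence "2 powr (n * info P V + D l) \<le> ?\<theta>" unfolding r(2) using r(1) by simp
        hence "n * \<epsilon> \<le> - D l" by (simp add: algebra_simps)
        moreover have "0 < n * \<epsilon>" using n \<epsilon> by simp
        ultimately have "(n * \<epsilon>)\<^sup>2 \<le> (- D l)\<^sup>2" by (intro power_mono) auto
        hence "1 \<le> (D l)\<^sup>2 / (n * \<epsilon>)\<^sup>2" using n \<epsilon> by (subst le_divide_eq_1_pos) auto
        thus ?thesis using True by simp
      qed simp
    qed
    also have "\<dots> = v / (n * \<epsilon>\<^sup>2)" using n by (simp add: D2 power_mult_distrib) (simp add: power2_eq_square)
    finally show "E_pmf Pn (\<lambda>xs. measure_pmf.prob (memoryless V xs)
      {vs. pmf (memoryless V xs) vs \<le> ?\<theta> * pmf Qn vs}) \<le> info_variance P V / (n * \<epsilon>\<^sup>2)" unfolding v .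
  next
    assume M: "2 powr (real n * info P V) \<le> M"
    have Mpos: "0 < M" using M by (smt (verit) powr_gt_zero)
    have "E_pmf Pn (\<lambda>xs. E_pmf (memoryless V xs) (\<lambda>vs. log 2 (1 + pmf (memoryless V xs) vs / (M * pmf Qn vs))))
      = E_pmf (replicate_pmf n J) (\<lambda>l. log 2 (1 + pmf (memoryless V (map fst l)) (map snd l) / (M * pmf Qn (map snd l))))"
      unfolding Pn_def J_def by (rule E_memoryless[where V = V, OF P V])
    also have "\<dots> \<le> E_pmf (replicate_pmf n J) (\<lambda>l. 1 + ((D l)\<^sup>2 / sqrt n + sqrt n))"
    proof (rule E_pmf_mono[OF finJn])
      fix l assume l: "l \<in> set_pmf (replicate_pmf n J)"
      note r = ratio[OF l]
      have "pmf (memoryless V (map fst l)) (map snd l) / (M * pmf Qn (map snd l)) = 2 powr (n * info P V) / M * 2 powr D l"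
        unfolding r(2) using r(1) by (simp add: powr_add)
      also have "\<dots> \<le> 1 * 2 powr D l"
        using M Mpos by (intro mult_right_mono) auto
      finally have "1 + pmf (memoryless V (map fst l)) (map snd l) / (M * pmf Qn (map snd l)) \<le> 1 + 2 powr D l" by simp
      also have "\<dots> \<le> 2 powr \<bar>D l\<bar> + 2 powr \<bar>D l\<bar>"
        by (intro add_mono) (auto simp: ge_one_powr_ge_zero)
      also have "\<dots> = 2 powr (1 + \<bar>D l\<bar>)" by (simp add: powr_add)
      finally have "log 2 (1 + pmf (memoryless V (map fst l)) (map snd l) / (M * pmf Qn (map snd l))) \<le> log 2 (2 powr (1 + \<bar>D l\<bar>))"
        using Mpos by (subst log_le_cancel_iff) (auto intro!: add_pos_nonneg)
      also have "\<dots> = 1 + \<bar>D l\<bar>" by simp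
      \<comment> \<open>Beyond sqrt n, one factor of the square outweighs the denominator. With the
        mean square \<open>n * v\<close>, both summands are of order sqrt n.\<close>
      also have "\<bar>D l\<bar> \<le> (D l)\<^sup>2 / sqrt n + sqrt n"
      proof (cases "\<bar>D l\<bar> \<le> sqrt n")
        case True
        moreover have "0 \<le> (D l)\<^sup>2 / sqrt n" by simp
        ultimately show ?thesis by linarith
      next
        case False
        hence "\<bar>D l\<bar> * sqrt n \<le> \<bar>D l\<bar> * \<bar>D l\<bar>" by (intro mult_left_mono) auto
        hence "\<bar>D l\<bar> \<le> (D l)\<^sup>2 / sqrt n" using n by (simp add: field_simps power2_eq_square)
        thus ?thesis by (simp add: add_increasing2)
      qed
      finally show "log 2 (1 + pmf (memoryless V (map fst l)) (map snd l) / (M * pmf Qn (map snd l))) \<le> 1 + ((D l)\<^sup>2 / sqrt n + sqrt n)"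
        by simp
    qed
    also have "\<dots> = 1 + (n * v / sqrt n + sqrt n)"
      using finJn D2 by (simp add: E_pmf_add integrable_measure_pmf_finite)
    also have "\<dots> = 1 + (v + 1) * sqrt n"
      using n by (simp add: field_simps real_sqrt_mult[symmetric])
    finally show "E_pmf Pn (\<lambda>xs. E_pmf (memoryless V xs)
      (\<lambda>vs. log 2 (1 + pmf (memoryless V xs) vs / (M * pmf Qn vs)))) \<le> 1 + (info_variance P V + 1) * sqrt n" unfolding v .
  }
qed

text \<open>\<open>a\<close> stands for the mean decoding error, \<open>b\<close> for the mean
  leakage, \<open>n * K - 1\<close> for the secret's bits after rounding; the factors 2 and 4 come
  from selecting one code and from the two ways of missing the key. The three conclusions serve
  error, rate and secrecy. Divided by \<open>n\<close>, the last two tend to R < K and 0 < \<delta>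
  K.\<close>

lemma block_length_exists:
  fixes V \<epsilon> K \<delta> R :: real
  assumes "0 < V" "0 < \<epsilon>" "0 < K" "0 < \<delta>" "R < K"
  defines "a \<equiv> \<lambda>n :: nat. V / (n * \<epsilon>\<^sup>2) + 2 * 2 powr (- (n * \<epsilon>))" and "b \<equiv> \<lambda>n :: nat. 1 + V * sqrt n"
  obtains n :: nat where "0 < n" "4 * a n < \<delta>"
    "n * R < (1 - 2 * a n) * (n * K - 1) - 2 * b n - 1 - 2 * a n"
    "2 * b n + 1 + 2 * a n < (\<delta> - 2 * a n) * (n * K - 1)"
proof -
  have "(a \<longlongrightarrow> 0) sequentially" unfolding a_def using assms(1,2) by real_asymp
  hence 1: "eventually (\<lambda>n. a n < \<delta> / 4) sequentially" using assms(4) by (intro order_tendstoD(2)) auto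
  have "((\<lambda>n. ((1 - 2 * a n) * (n * K - 1) - 2 * b n - 1 - 2 * a n) / n) \<longlongrightarrow> K) sequentially"
    unfolding a_def b_def using assms(1-3) by real_asymp
  hence 2: "eventually (\<lambda>n. R < ((1 - 2 * a n) * (n * K - 1) - 2 * b n - 1 - 2 * a n) / n) sequentially"
    using assms(5) by (intro order_tendstoD(1))
  have "((\<lambda>n. ((\<delta> - 2 * a n) * (n * K - 1) - (2 * b n + 1 + 2 * a n)) / n) \<longlongrightarrow> \<delta> * K) sequentially"
    unfolding a_def b_def using assms(1-4) by real_asymp
  hence 3: "eventually (\<lambda>n. 0 < ((\<delta> - 2 * a n) * (n * K - 1) - (2 * b n + 1 + 2 * a n)) / n) sequentially"
    by (rule order_tendstoD(1)) (use assms(3,4) in simp)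
  from eventually_conj[OF eventually_gt_at_top[of 0] eventually_conj[OF 1 eventually_conj[OF 2 3]]]
  obtain n where n: "0 < n" "a n < \<delta> / 4" "R < ((1 - 2 * a n) * (n * K - 1) - 2 * b n - 1 - 2 * a n) / n"
    "0 < ((\<delta> - 2 * a n) * (n * K - 1) - (2 * b n + 1 + 2 * a n)) / n"
    unfolding eventually_sequentially by auto
  show ?thesis
  proof (rule that[OF n(1)])
    show "4 * a n < \<delta>" using n(2) by simp
    show "n * R < (1 - 2 * a n) * (n * K - 1) - 2 * b n - 1 - 2 * a n"
      using n(1,3) by (simp add: pos_less_divide_eq mult.commute)
    show "2 * b n + 1 + 2 * a n < (\<delta> - 2 * a n) * (n * K - 1)"
      using n(1,4) by (simp add: zero_less_divide_iff)
  qed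
qed

section \<open>Achievability\<close>

text \<open>The security conditions of a one-round protocol stated for the channel alone and without
  quotients, so that they serve either direction.\<close>

definition wiretap_code ::
  "('x, 'y, 'z) dmbc \<Rightarrow> real \<Rightarrow> real \<Rightarrow> nat \<Rightarrow> 'x list pmf \<Rightarrow> ('x list \<Rightarrow> nat) \<Rightarrow> ('y list \<Rightarrow> nat) \<Rightarrow> bool" where
  "wiretap_code W R \<delta> n enc S S' \<longleftrightarrow>
    (let G = bind_pmf enc (\<lambda>xs. map_pmf (Pair xs) (transmit W xs)); K = (\<lambda>w. S (fst w)); Z = (\<lambda>w. map snd (snd w)) in
      0 < n \<and> (\<forall>xs\<in>set_pmf enc. length xs = n) \<and> n * (R - \<delta>) < H G K \<and>
      measure_pmf.prob G {w. S' (map fst (snd w)) \<noteq> K w} < \<delta> \<and>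
      (H G K = 0 \<or> 0 < H G K \<and> (1 - \<delta>) * H G K < H G (\<lambda>w. (K w, Z w)) - H G Z))"

lemma H_pair_le:
  assumes "finite (set_pmf p)"
  shows "H p (\<lambda>w. (X w, Y w)) \<le> H p X + H p Y"
proof -
  have "H p (\<lambda>w. (X w, Y w, ())) = H p (\<lambda>w. (X w, Y w))" "H p (\<lambda>w. (X w, ())) = H p X" "H p (\<lambda>w. (Y w, ())) = H p Y"
    by (rule H_cong[OF assms], simp)+
  thus ?thesis using H_submodular[OF assms, of X Y "\<lambda>_. ()"] by (simp add: map_pmf_const)
qed

lemma floor_powr_bounds:
  assumes "0 \<le> r"
  defines "M \<equiv> nat \<lfloor>2 powr r\<rfloor>"
  shows "0 < M" "real M \<le> 2 powr r" "r - 1 \<le> log 2 M" "log 2 M \<le> r"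
proof -
  have ge1: "1 \<le> 2 powr r" using assms by (simp add: ge_one_powr_ge_zero)
  hence fl: "1 \<le> \<lfloor>2 powr r\<rfloor>" by simp
  hence M: "real M = \<lfloor>2 powr r\<rfloor>" by (simp add: M_def)
  show M0: "0 < M" using fl by (simp add: M_def)
  show le: "real M \<le> 2 powr r" unfolding M by simp
  have "2 powr r \<le> 2 * real M" unfolding M using fl by linarith
  hence "2 powr (r - 1) \<le> real M" by (simp add: powr_diff)
  thus "r - 1 \<le> log 2 M" using M0 by (simp add: le_log_iff)
  show "log 2 M \<le> r" using le M0 by (simp add: log_le_iff)
qed

lemma wiretap_code_exists:
  fixes W :: "('x::finite, 'y::finite, 'z::finite) dmbc"
  assumes \<delta>: "0 < \<delta>" "\<delta> \<le> 1"
  shows "\<exists>n enc S S'. wiretap_code W (info P (\<lambda>x. map_pmf fst (W x)) - info P (\<lambda>x. map_pmf snd (W x))) \<delta> n enc S S'"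
proof -
  let ?VY = "\<lambda>x. map_pmf fst (W x)" and ?VZ = "\<lambda>x. map_pmf snd (W x)"
  define C where "C = info P ?VY - info P ?VZ"
  have fin: "finite (set_pmf q)" for q :: "'i::finite pmf" by simp
  have "\<exists>n enc S S'. wiretap_code W C \<delta> n enc S S'"
  proof (cases "0 < C")
    case False
    \<comment> \<open>A constant key meets the rate condition because \<open>C - \<delta>\<close> is
      negative; its entropy is 0.\<close>
    have "wiretap_code W C \<delta> 1 (return_pmf [undefined]) (\<lambda>_. 0) (\<lambda>_. 0)"
      using False \<delta> by (simp add: wiretap_code_def Let_def map_pmf_const)
    thus ?thesis by blast
  next
    case True
    \<comment> \<open>The bound C / 4 keeps the rate \<open>K\<close> positive, and \<delta> / 4
      keeps it above \<open>C - \<delta>\<close>.\<close>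
    define \<epsilon> where "\<epsilon> = min (C / 4) (\<delta> / 4)"
    define K where "K = C - 2 * \<epsilon>"
    have \<epsilon>: "0 < \<epsilon>" using True \<delta> by (simp add: \<epsilon>_def)
    have K: "0 < K" "C - \<delta> < K" using True \<delta> by (auto simp: K_def \<epsilon>_def min_def)
    define vY where "vY = info_variance P ?VY"
    define vZ where "vZ = info_variance P ?VZ"
    have v: "0 \<le> vY" "0 \<le> vZ" by (simp_all add: vY_def vZ_def info_variance_nonneg)
    \<comment> \<open>One constant that dominates both Bob's variance \<open>vY\<close> and Eve's
      \<open>vZ + 1\<close>.\<close>
    define V where "V = vY + vZ + 1"
    have V: "0 < V" "vY \<le> V" "vZ + 1 \<le> V" using v by (auto simp: V_def)
    define a where "a = (\<lambda>n :: nat. V / (n * \<epsilon>\<^sup>2) + 2 * 2 powr (- (n * \<epsilon>)))"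
    define b where "b = (\<lambda>n :: nat. 1 + V * sqrt n)"
    obtain n :: nat where n: "0 < n" "4 * a n < \<delta>"
      "n * (C - \<delta>) < (1 - 2 * a n) * (n * K - 1) - 2 * b n - 1 - 2 * a n"
      "2 * b n + 1 + 2 * a n < (\<delta> - 2 * a n) * (n * K - 1)"
      using block_length_exists[OF V(1) \<epsilon> K(1) \<delta>(1) K(2)] unfolding a_def b_def by blast
    have ab: "0 < a n" "0 < b n" using V \<epsilon> n(1) by (auto simp: a_def b_def intro!: add_pos_nonneg)
    \<comment> \<open>The secret's range is rounded down at a cost of at most one bit. The
      randomisation range is rounded up, since soft covering needs at least 2 to the power n I(X; Z)
      codewords per secret.\<close>
    define Ms where "Ms = nat \<lfloor>2 powr (n * K)\<rfloor>"
    define Mu where "Mu = nat \<lceil>2 powr (n * info P ?VZ)\<rceil>"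
    define \<theta> where "\<theta> = 2 powr (real n * (info P ?VY - \<epsilon>))"
    have Ms: "0 < Ms" "real Ms \<le> 2 powr (n * K)" "n * K - 1 \<le> log 2 Ms"
      using floor_powr_bounds[of "n * K"] K(1) by (simp_all add: Ms_def)
    have IZ: "0 \<le> info P ?VZ" by (rule info_nonneg) simp_all
    hence ge1: "1 \<le> 2 powr (n * info P ?VZ)" by (simp add: ge_one_powr_ge_zero)
    hence Mu: "0 < Mu" "2 powr (n * info P ?VZ) \<le> Mu" "Mu \<le> 2 * 2 powr (n * info P ?VZ)"
      unfolding Mu_def by linarith+
    let ?Pn = "replicate_pmf n P" and ?Y = "memoryless ?VY" and ?Z = "memoryless ?VZ"
    let ?I = "{..<Ms} \<times> {..<Mu}"
    have finPn: "finite (set_pmf ?Pn)" by (rule finite_set_replicate_pmf[OF fin])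
    have finY: "finite (set_pmf (?Y xs))" and finZ: "finite (set_pmf (?Z xs))" for xs
      by (rule finite_set_memoryless, simp)+
    have rel: "E_pmf ?Pn (\<lambda>xs. measure_pmf.prob (?Y xs) {y. pmf (?Y xs) y \<le> \<theta> * pmf (bind_pmf ?Pn ?Y) y}) + real Ms * real Mu / \<theta> \<le> a n"
      unfolding a_def
    proof (rule add_mono)
      have "vY / (n * \<epsilon>\<^sup>2) \<le> V / (n * \<epsilon>\<^sup>2)" using V by (intro divide_right_mono) auto
      thus "E_pmf ?Pn (\<lambda>xs. measure_pmf.prob (?Y xs) {y. pmf (?Y xs) y \<le> \<theta> * pmf (bind_pmf ?Pn ?Y) y}) \<le> V / (n * \<epsilon>\<^sup>2)"
        using info_density_lower_tail[where V = ?VY and P = P, OF fin fin n(1) \<epsilon>] unfolding \<theta>_def vY_def by simp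
      have "real Ms * real Mu / \<theta> \<le> 2 powr (n * K) * (2 * 2 powr (n * info P ?VZ)) / \<theta>"
        using Ms Mu by (intro divide_right_mono mult_mono) (auto simp: \<theta>_def)
      also have "\<dots> = 2 * 2 powr (n * K + n * info P ?VZ - real n * (info P ?VY - \<epsilon>))"
        by (simp add: \<theta>_def powr_add powr_diff)
      \<comment> \<open>Of the margin \<open>2 * \<epsilon>\<close> in \<open>K\<close>, one
        \<epsilon> pays for the decoding threshold and the other remains as the exponent; the factor
        2 stems from rounding up \<open>Mu\<close>.\<close>
      also have "n * K + n * info P ?VZ - real n * (info P ?VY - \<epsilon>) = - (n * \<epsilon>)"
        by (simp add: K_def C_def algebra_simps)
      finally show "real Ms * real Mu / \<theta> \<le> 2 * 2 powr (- (n * \<epsilon>))" .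
    qed
    have sec: "E_pmf ?Pn (\<lambda>xs. E_pmf (?Z xs) (\<lambda>z. log 2 (1 + pmf (?Z xs) z / (real Mu * pmf (bind_pmf ?Pn ?Z) z)))) \<le> b n"
    proof -
      have "(vZ + 1) * sqrt n \<le> V * sqrt n" using V by (intro mult_right_mono) auto
      thus ?thesis using info_density_excess[where V = ?VZ and P = P, OF fin fin n(1) Mu(2)] by (simp add: b_def vZ_def)
    qed
    have "0 < \<theta>" by (simp add: \<theta>_def)
    from random_wiretap_code_exists[where WY = ?Y and WZ = ?Z, OF finPn finY finZ Ms(1) Mu(1) this ab rel sec]
    obtain c dec where c': "\<forall>m\<in>?I. c m \<in> set_pmf ?Pn"
      and err: "E_pmf (pmf_of_set ?I) (\<lambda>m. measure_pmf.prob (?Y (c m)) {y. dec y \<noteq> m}) \<le> 2 * a n"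
      and leak: "E_pmf (pmf_of_set {..<Ms}) (\<lambda>s. rel_ent (subcode_output ?Z ({s} \<times> {..<Mu}) c) (bind_pmf ?Pn ?Z)) \<le> 2 * b n"
      by (elim exE conjE)
    have c: "c m \<in> set_pmf ?Pn" if "m \<in> ?I" for m using c' that by (rule bspec)
    define enc where "enc = map_pmf c (pmf_of_set ?I)"
    define S where "S = (\<lambda>xs. fst (inv_into ?I c xs))"
    define S' where "S' = (\<lambda>ys. fst (dec ys))"
    define G where "G = bind_pmf enc (\<lambda>xs. map_pmf (Pair xs) (transmit W xs))"
    let ?S = "\<lambda>w. S (fst w)" and ?E = "\<lambda>w. map snd (snd w)"
    have YZ: "(\<lambda>x. map_pmf (map fst) (transmit W x)) = ?Y" "(\<lambda>x. map_pmf (map snd) (transmit W x)) = ?Z"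
      by (simp_all add: transmit_eq_memoryless map_memoryless)
    note code = wiretap_code_entropy[where K = "transmit W" and \<eta> = "map fst" and \<zeta> = "map snd" and P = ?Pn and Ms = Ms and Mu = Mu,
        OF Ms(1) Mu(1) finite_set_transmit c err[unfolded YZ[symmetric]] leak[unfolded YZ[symmetric]]]
    have 1: "measure_pmf.prob G {w. S' (map fst (snd w)) \<noteq> ?S w} \<le> 4 * a n"
      and 2: "H G ?S \<le> log 2 Ms"
      and 3: "log 2 Ms - 2 * b n - 1 - 2 * a n * (log 2 Ms + 1) \<le> H G (\<lambda>w. (?S w, ?E w)) - H G ?E"
      using code unfolding G_def enc_def S_def S'_def by (simp_all add: case_prod_unfold)
    have fI: "finite ?I" "?I \<noteq> {}" using Ms(1) Mu(1) by auto
    have finG: "finite (set_pmf G)" unfolding G_def enc_def using fI finite_set_transmit by auto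
    have len: "length xs = n" if "xs \<in> set_pmf enc" for xs
      using that fI c by (auto simp: enc_def set_replicate_pmf)
    have a2: "0 \<le> 1 - 2 * a n" "0 \<le> \<delta> - 2 * a n" using n(2) \<delta> ab by linarith+
    have L: "(1 - 2 * a n) * (n * K - 1) \<le> (1 - 2 * a n) * log 2 Ms"
      "(\<delta> - 2 * a n) * (n * K - 1) \<le> (\<delta> - 2 * a n) * log 2 Ms"
      using a2 Ms(3) by (auto intro: mult_left_mono)
    have HS: "H G (\<lambda>w. (?S w, ?E w)) - H G ?E \<le> H G ?S" using H_pair_le[OF finG, of ?S ?E] by simp
    have "n * (C - \<delta>) < H G ?S" using n(3) L(1) 3 HS by (simp add: algebra_simps)
    moreover have ratio: "(1 - \<delta>) * H G ?S < H G (\<lambda>w. (?S w, ?E w)) - H G ?E"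
    proof -
      have "(1 - \<delta>) * H G ?S \<le> (1 - \<delta>) * log 2 Ms" using 2 \<delta> by (intro mult_left_mono) auto
      also have "\<dots> < log 2 Ms - 2 * b n - 1 - 2 * a n * (log 2 Ms + 1)"
        using n(4) L(2) by (simp add: algebra_simps)
      finally show ?thesis using 3 by simp
    qed
    \<comment> \<open>The leakage inequality is strict and conditioning does not increase entropy,
      which excludes a constant key.\<close>
    moreover have "0 < H G ?S"
    proof -
      have "0 \<le> (1 - \<delta>) * H G ?S" using \<delta> ent_nonneg by (intro mult_nonneg_nonneg) auto
      thus ?thesis using ratio HS by linarith
    qed
    moreover have "measure_pmf.prob G {w. S' (map fst (snd w)) \<noteq> ?S w} < \<delta>" using 1 n(2) by linarith
    ultimately have "wiretap_code W C \<delta> n enc S S'"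
      using n(1) len unfolding wiretap_code_def G_def[symmetric] Let_def by simp
    thus ?thesis by blast
  qed
  thus ?thesis unfolding C_def .
qed

lemma secure_forward_protocol:
  fixes Wf :: "('xf::finite, 'yf::finite, 'zf::finite) dmbc" and Wb :: "('xb::finite, 'yb::finite, 'zb::finite) dmbc"
  assumes code: "wiretap_code Wf R \<delta> n enc S S'"
  shows "\<exists>\<pi>. secure_protocol Wf Wb R \<delta> \<pi>"
proof -
  define G where "G = bind_pmf enc (\<lambda>xs. map_pmf (Pair xs) (transmit Wf xs))"
  let ?S = "\<lambda>w. S (fst w)" and ?E = "\<lambda>w. map snd (snd w)"
  have n: "0 < n" and len: "\<And>xs. xs \<in> set_pmf enc \<Longrightarrow> length xs = n" and rate: "n * (R - \<delta>) < H G ?S"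
    and err: "measure_pmf.prob G {w. S' (map fst (snd w)) \<noteq> ?S w} < \<delta>"
    and leak: "H G ?S = 0 \<or> 0 < H G ?S \<and> (1 - \<delta>) * H G ?S < H G (\<lambda>w. (?S w, ?E w)) - H G ?E"
    using code unfolding wiretap_code_def Let_def G_def by auto
  \<comment> \<open>Each view of the single round is one \<open>Inl\<close> entry, unwrapped by
    \<open>projl (hd v)\<close>: Alice finds her codeword there and Bob his outputs.\<close>
  define \<pi> :: "('xf, 'yf, 'xb, 'yb) ske_protocol" where
    "\<pi> = \<lparr>initiator = Alice, lens = [n], enc_A = (\<lambda>_. enc), enc_B = (\<lambda>_. return_pmf []), key_party = Alice,
      key_A = (\<lambda>v. S (projl (hd v))), key_B = (\<lambda>v. S' (projl (hd v)))\<rparr>"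
  let ?r = "\<lambda>(xs, yzs). [Forward xs yzs]"
  have valid: "valid_protocol \<pi>" using len by (simp add: valid_protocol_def \<pi>_def sender_def)
  have uses: "n_f \<pi> + n_b \<pi> = n" using total_uses[OF valid] by (simp add: \<pi>_def)
  have run: "run Wf Wb \<pi> = map_pmf ?r G"
    by (simp add: run_def \<pi>_def sender_def G_def bind_return_pmf map_bind_pmf pmf.map_comp o_def map_pmf_def bind_assoc_pmf)
  have finenc: "finite (set_pmf enc)"
    by (rule finite_subset[OF _ finite_set_lists_length[of n]]) (use len in auto)
  have finG: "finite (set_pmf G)" unfolding G_def using finenc finite_set_transmit by auto
  have finT: "finite (set_pmf (run Wf Wb \<pi>))" unfolding run using finG by simp
  have key: "key \<pi> (?r w) = ?S w" "key_estimate \<pi> (?r w) = S' (map fst (snd w))"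
    "View_E (?r w) = [Inl (?E w)]" for w
    by (simp_all add: key_def key_estimate_def party_key_def \<pi>_def case_prod_unfold)
  have HK: "H_ent (run Wf Wb \<pi>) (key \<pi>) = H G ?S"
    by (simp add: H_ent_eq run pmf.map_comp o_def key)
  have HC: "H_cond (run Wf Wb \<pi>) (key \<pi>) View_E = H G (\<lambda>w. (?S w, ?E w)) - H G ?E"
  proof -
    have "H_cond (run Wf Wb \<pi>) (key \<pi>) View_E
        = H (run Wf Wb \<pi>) (\<lambda>t. (key \<pi> t, View_E t)) - H (run Wf Wb \<pi>) View_E"
      by (rule H_cond_eq[OF finT])
    also have "\<dots> = H G (\<lambda>w. (?S w, [Inl (?E w) :: 'zf list + 'zb list])) - H G (\<lambda>w. [Inl (?E w) :: 'zf list + 'zb list])"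
      unfolding run pmf.map_comp o_def key ..
    also have "H G (\<lambda>w. (?S w, [Inl (?E w) :: 'zf list + 'zb list])) = H G (\<lambda>w. (?S w, ?E w))" by (rule H_cong[OF finG]) auto
    also have "H G (\<lambda>w. [Inl (?E w) :: 'zf list + 'zb list]) = H G ?E" by (rule H_cong[OF finG]) auto
    finally show ?thesis .
  qed
  have PE: "measure_pmf.prob (run Wf Wb \<pi>) {t. key_estimate \<pi> t \<noteq> key \<pi> t} < \<delta>"
    using err unfolding run measure_map_pmf vimage_def mem_Collect_eq key .
  have "secure_protocol Wf Wb R \<delta> \<pi>"
    unfolding secure_protocol_def Let_def uses HK HC
    using valid n rate PE leak by (auto simp: pos_less_divide_eq mult.commute)
  thus ?thesis ..
qed

lemma secure_backward_protocol:
  fixes Wf :: "('xf::finite, 'yf::finite, 'zf::finite) dmbc" and Wb :: "('xb::finite, 'yb::finite, 'zb::finite) dmbc"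
  assumes code: "wiretap_code Wb R \<delta> n enc S S'"
  shows "\<exists>\<pi>. secure_protocol Wf Wb R \<delta> \<pi>"
proof -
  define G where "G = bind_pmf enc (\<lambda>xs. map_pmf (Pair xs) (transmit Wb xs))"
  let ?S = "\<lambda>w. S (fst w)" and ?E = "\<lambda>w. map snd (snd w)"
  have n: "0 < n" and len: "\<And>xs. xs \<in> set_pmf enc \<Longrightarrow> length xs = n" and rate: "n * (R - \<delta>) < H G ?S"
    and err: "measure_pmf.prob G {w. S' (map fst (snd w)) \<noteq> ?S w} < \<delta>"
    and leak: "H G ?S = 0 \<or> 0 < H G ?S \<and> (1 - \<delta>) * H G ?S < H G (\<lambda>w. (?S w, ?E w)) - H G ?E"
    using code unfolding wiretap_code_def Let_def G_def by auto
  define \<pi> :: "('xf, 'yf, 'xb, 'yb) ske_protocol" where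
    "\<pi> = \<lparr>initiator = Bob, lens = [n], enc_A = (\<lambda>_. return_pmf []), enc_B = (\<lambda>_. enc), key_party = Bob,
      key_A = (\<lambda>v. S' (projr (hd v))), key_B = (\<lambda>v. S (projr (hd v)))\<rparr>"
  let ?r = "\<lambda>(xs, yzs). [Backward xs yzs]"
  have valid: "valid_protocol \<pi>" using len by (simp add: valid_protocol_def \<pi>_def sender_def)
  have uses: "n_f \<pi> + n_b \<pi> = n" using total_uses[OF valid] by (simp add: \<pi>_def)
  have run: "run Wf Wb \<pi> = map_pmf ?r G"
    by (simp add: run_def \<pi>_def sender_def G_def bind_return_pmf map_bind_pmf pmf.map_comp o_def map_pmf_def bind_assoc_pmf)
  have finenc: "finite (set_pmf enc)"
    by (rule finite_subset[OF _ finite_set_lists_length[of n]]) (use len in auto)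
  have finG: "finite (set_pmf G)" unfolding G_def using finenc finite_set_transmit by auto
  have finT: "finite (set_pmf (run Wf Wb \<pi>))" unfolding run using finG by simp
  have key: "key \<pi> (?r w) = ?S w" "key_estimate \<pi> (?r w) = S' (map fst (snd w))"
    "View_E (?r w) = [Inr (?E w)]" for w
    by (simp_all add: key_def key_estimate_def party_key_def \<pi>_def case_prod_unfold)
  have HK: "H_ent (run Wf Wb \<pi>) (key \<pi>) = H G ?S"
    by (simp add: H_ent_eq run pmf.map_comp o_def key)
  have HC: "H_cond (run Wf Wb \<pi>) (key \<pi>) View_E = H G (\<lambda>w. (?S w, ?E w)) - H G ?E"
  proof -
    have "H_cond (run Wf Wb \<pi>) (key \<pi>) View_E
        = H (run Wf Wb \<pi>) (\<lambda>t. (key \<pi> t, View_E t)) - H (run Wf Wb \<pi>) View_E"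
      by (rule H_cond_eq[OF finT])
    also have "\<dots> = H G (\<lambda>w. (?S w, [Inr (?E w) :: 'zf list + 'zb list])) - H G (\<lambda>w. [Inr (?E w) :: 'zf list + 'zb list])"
      unfolding run pmf.map_comp o_def key ..
    also have "H G (\<lambda>w. (?S w, [Inr (?E w) :: 'zf list + 'zb list])) = H G (\<lambda>w. (?S w, ?E w))" by (rule H_cong[OF finG]) auto
    also have "H G (\<lambda>w. [Inr (?E w) :: 'zf list + 'zb list]) = H G ?E" by (rule H_cong[OF finG]) auto
    finally show ?thesis .
  qed
  have PE: "measure_pmf.prob (run Wf Wb \<pi>) {t. key_estimate \<pi> t \<noteq> key \<pi> t} < \<delta>"
    using err unfolding run measure_map_pmf vimage_def mem_Collect_eq key .
  have "secure_protocol Wf Wb R \<delta> \<pi>"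
    unfolding secure_protocol_def Let_def uses HK HC
    using valid n rate PE leak by (auto simp: pos_less_divide_eq mult.commute)
  thus ?thesis ..
qed

section \<open>Reduction to the obversely degraded subchannel\<close>

lemma info_append_independent:
  assumes P: "finite (set_pmf P)" and V: "\<And>x. x \<in> set_pmf P \<Longrightarrow> finite (set_pmf (V x))" and q: "finite (set_pmf q)"
    and U: "\<And>x. U (f x) = pair_pmf (V x) q"
  shows "info (map_pmf f P) U = info P V"
proof -
  \<comment> \<open>The appended component has the same law \<open>q\<close> for every input, so it
    is independent of the rest and \<open>ent q\<close> enters both entropies below and
    cancels.\<close>
  have b: "bind_pmf (map_pmf f P) U = pair_pmf (bind_pmf P V) q"
    by (simp add: bind_map_pmf U pair_pmf_def bind_assoc_pmf)
  have finb: "finite (set_pmf (bind_pmf P V))" using P V by auto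
  have "info (map_pmf f P) U = ent (bind_pmf (map_pmf f P) U) - E_pmf (map_pmf f P) (\<lambda>x. ent (U x))"
    using P V q U by (intro info_eq) auto
  also have "\<dots> = ent (bind_pmf P V) + ent q - E_pmf P (\<lambda>x. ent (V x) + ent q)"
    unfolding b ent_pair[OF finb q] integral_map_pmf
    using V q by (intro arg_cong2[where f = "(-)"] E_pmf_cong refl) (simp add: U ent_pair)
  also have "\<dots> = info P V" using P by (simp add: info_eq[OF P V] E_pmf_add)
  finally show ?thesis .
qed

text \<open>Expanding I(X; Y, Z) in both orders gives I(X; Y) + I(X; Z | Y) = I(X; Z) + I(X; Y | Z),
  and degradedness makes I(X; Z | Y) vanish.\<close>

lemma gain_obversely_degraded:
  fixes W :: "('x::finite, 'y::finite, 'z::finite) dmbc"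
  assumes "obversely_degraded W"
  shows "gain snd P W = info P (\<lambda>x. map_pmf fst (W x)) - info P (\<lambda>x. map_pmf snd (W x))"
proof -
  let ?J = "joint P W"
  have fin: "finite (set_pmf q)" for q :: "'i::finite pmf" by simp
  have "cmi ?J (\<lambda>(x, y, z). x) (\<lambda>(x, y, z). z) (\<lambda>(x, y, z). y) = 0"
    using assms by (intro cmi_markov_chain) (simp_all add: obversely_degraded_def)
  hence mc: "H ?J (\<lambda>(x, y, z). (x, y)) + H ?J (\<lambda>(x, y, z). (z, y)) = H ?J (\<lambda>(x, y, z). (x, z, y)) + H ?J (\<lambda>(x, y, z). y)"
    by (simp add: cmi_def case_prod_unfold)
  have m1: "map_pmf (\<lambda>(x, y, z). (x, y)) ?J = bind_pmf P (\<lambda>x. map_pmf (Pair x) (map_pmf fst (W x)))"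
    by (simp add: joint_def map_bind_pmf pmf.map_comp o_def case_prod_unfold)
  have h1: "H ?J (\<lambda>(x, y, z). (x, y)) = ent P + E_pmf P (\<lambda>x. H (W x) fst)"
    unfolding m1 by (rule ent_bind_Pair) simp_all
  have "H ?J (\<lambda>(x, y, z). (z, y)) = H ?J (\<lambda>(x, y, z). (y, z))" by (rule H_cong[OF fin]) auto
  also have "map_pmf (\<lambda>(x, y, z). (y, z)) ?J = bind_pmf P W"
    by (simp add: joint_def map_bind_pmf pmf.map_comp o_def case_prod_unfold)
  finally have h2: "H ?J (\<lambda>(x, y, z). (z, y)) = ent (bind_pmf P W)" .
  have "H ?J (\<lambda>(x, y, z). (x, z, y)) = H ?J (\<lambda>w. w)" by (rule H_cong[OF fin]) auto
  also have "\<dots> = ent P + E_pmf P (\<lambda>x. ent (W x))"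
    unfolding joint_def by (simp add: ent_bind_Pair)
  finally have h3: "H ?J (\<lambda>(x, y, z). (x, z, y)) = ent P + E_pmf P (\<lambda>x. ent (W x))" .
  have m4: "map_pmf (\<lambda>(x, y, z). y) ?J = bind_pmf P (\<lambda>x. map_pmf fst (W x))"
    by (simp add: joint_def map_bind_pmf pmf.map_comp o_def case_prod_unfold)
  have i: "info P (\<lambda>x. map_pmf fst (W x)) = ent (bind_pmf P (\<lambda>x. map_pmf fst (W x))) - E_pmf P (\<lambda>x. H (W x) fst)"
    "info P (\<lambda>x. map_pmf snd (W x)) = ent (bind_pmf P (\<lambda>x. map_pmf snd (W x))) - E_pmf P (\<lambda>x. H (W x) snd)"
    by (rule info_eq; simp)+
  have g: "gain snd P W = ent (bind_pmf P W) - ent (bind_pmf P (\<lambda>x. map_pmf snd (W x)))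
      - (E_pmf P (\<lambda>x. ent (W x)) - E_pmf P (\<lambda>x. H (W x) snd))"
    unfolding gain_def E_pmf_diff[OF fin] by (simp add: map_bind_pmf)
  show ?thesis using mc unfolding h1 h2 h3 m4 i g by linarith
qed

lemma degraded_wiretap_code_exists:
  fixes W :: "('xo::finite \<times> 'xr::finite, 'yo::finite \<times> 'yr::finite, 'zo::finite \<times> 'zr::finite) dmbc"
  assumes deg: "degraded_dmbc W WO WR" and \<delta>: "0 < \<delta>" "\<delta> \<le> 1"
  shows "\<exists>n enc S S'. wiretap_code W (gain snd P WO) \<delta> n enc S S'"
proof -
  have ind: "independent_subchannels W WO WR" and obv: "obversely_degraded WO"
    using deg by (auto simp: degraded_dmbc_def)
  \<comment> \<open>The reversely degraded subchannel is fed a fixed letter; to each receiver's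
    output it only adds an independent component.\<close>
  let ?f = "\<lambda>xo. (xo, undefined :: 'xr)"
  have Y: "map_pmf fst (W (?f x)) = pair_pmf (map_pmf fst (WO x)) (map_pmf fst (WR undefined))" for x
    using arg_cong[OF independent_subchannels_pair[OF ind, of x undefined], of "map_pmf (\<lambda>(u, v). (fst u, fst v))"]
      map_pair[of fst fst "WO x" "WR undefined"]
    by (simp add: pmf.map_comp o_def case_prod_unfold)
  have Z: "map_pmf snd (W (?f x)) = pair_pmf (map_pmf snd (WO x)) (map_pmf snd (WR undefined))" for x
    using arg_cong[OF independent_subchannels_pair[OF ind, of x undefined], of "map_pmf (\<lambda>(u, v). (snd u, snd v))"]
      map_pair[of snd snd "WO x" "WR undefined"]
    by (simp add: pmf.map_comp o_def case_prod_unfold)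
  have "info (map_pmf ?f P) (\<lambda>x. map_pmf fst (W x)) = info P (\<lambda>x. map_pmf fst (WO x))"
    by (rule info_append_independent[where U = "\<lambda>x. map_pmf fst (W x)", OF _ _ _ Y]) simp_all
  moreover have "info (map_pmf ?f P) (\<lambda>x. map_pmf snd (W x)) = info P (\<lambda>x. map_pmf snd (WO x))"
    by (rule info_append_independent[where U = "\<lambda>x. map_pmf snd (W x)", OF _ _ _ Z]) simp_all
  ultimately show ?thesis
    using wiretap_code_exists[OF \<delta>, of W "map_pmf ?f P"] unfolding gain_obversely_degraded[OF obv] by simp
qed

lemma gain_nonneg:
  fixes W :: "('x::finite, 'y::finite, 'z::finite) dmbc"
  shows "0 \<le> gain snd P W"
proof -
  have fin: "finite (set_pmf (joint P W))" by simp
  show ?thesis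
    unfolding channel_I_cond_eq_gain[symmetric] channel_I_cond_def I_cond_eq[OF fin]
    using H_submodular[OF fin, of "\<lambda>(x, y, z). x" "\<lambda>(x, y, z). y" "\<lambda>(x, y, z). z"] by simp
qed

theorem theorem3:
  fixes Wf :: "('xfo::finite \<times> 'xfr::finite, 'yfo::finite \<times> 'yfr::finite, 'zfo::finite \<times> 'zfr::finite) dmbc"
    and WfO :: "('xfo, 'yfo, 'zfo) dmbc"
    and WfR :: "('xfr, 'yfr, 'zfr) dmbc"
    and Wb :: "('xbo::finite \<times> 'xbr::finite, 'ybo::finite \<times> 'ybr::finite, 'zbo::finite \<times> 'zbr::finite) dmbc"
    and WbO :: "('xbo, 'ybo, 'zbo) dmbc"
    and WbR :: "('xbr, 'ybr, 'zbr) dmbc"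
  assumes "degraded_dmbc Wf WfO WfR"
    and "degraded_dmbc Wb WbO WbR"
  shows "\<exists>C. is_maximum
               {max (channel_I_cond P WfO) (channel_I_cond Q WbO) | P Q. True} C \<and>
             is_secret_key_capacity Wf Wb C"
proof -
  obtain P where P: "\<And>P'. gain snd P' WfO \<le> gain snd P WfO" using gain_attains_max[of WfO] by blast
  obtain Q where Q: "\<And>Q'. gain snd Q' WbO \<le> gain snd Q WbO" using gain_attains_max[of WbO] by blast
  \<comment> \<open>\<open>P\<close> affects only the first argument of the maximum and
    \<open>Q\<close> only the second, so the two inputs are optimised separately.\<close>
  define C where "C = max (gain snd P WfO) (gain snd Q WbO)"
  have max: "is_maximum {max (channel_I_cond P WfO) (channel_I_cond Q WbO) | P Q. True} C"
    unfolding is_maximum_def channel_I_cond_eq_gain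
  proof safe
    show "\<exists>P Q. C = max (gain snd P WfO) (gain snd Q WbO) \<and> True" unfolding C_def by blast
    show "max (gain snd P' WfO) (gain snd Q' WbO) \<le> C" for P' Q'
      unfolding C_def using P[of P'] Q[of Q'] by (rule max.mono)
  qed
  have "achievable_rate Wf Wb C"
    unfolding achievable_rate_def
  proof (intro conjI allI impI)
    show "0 \<le> C" using gain_nonneg[of P WfO] by (simp add: C_def)
    fix \<delta> :: real assume "0 < \<delta> \<and> \<delta> \<le> 1"
    hence \<delta>: "0 < \<delta>" "\<delta> \<le> 1" by auto
    show "\<exists>\<pi>. secure_protocol Wf Wb C \<delta> \<pi>"
    proof (cases "C = gain snd P WfO")
      case True
      thus ?thesis using degraded_wiretap_code_exists[OF assms(1) \<delta>, of P] secure_forward_protocol by metis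
    next
      case False
      hence "C = gain snd Q WbO" by (simp add: C_def max_def split: if_splits)
      thus ?thesis using degraded_wiretap_code_exists[OF assms(2) \<delta>, of Q] secure_backward_protocol by metis
    qed
  qed
  moreover have "R \<le> C" if "achievable_rate Wf Wb R" for R
  proof (rule achievable_rate_le[OF _ _ that])
    show "gain snd P' Wf \<le> C" for P'
      using gain_degraded_le[OF assms(1), of P'] P[of "map_pmf fst P'"] by (simp add: C_def)
    show "gain snd Q' Wb \<le> C" for Q'
      using gain_degraded_le[OF assms(2), of Q'] Q[of "map_pmf fst Q'"] by (simp add: C_def)
  qed
  ultimately have "is_secret_key_capacity Wf Wb C"
    by (simp add: is_secret_key_capacity_def is_maximum_def)
  with max show ?thesis by blast
qed

end
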